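(* Let $n\ge 2$ and let $\Delta$ be the boundary complex of a convex simplicial $n$-polytope (so $\Delta$ is topologically an $(n-1)$-dimensional sphere), and suppose $\Delta$ is clique-closed (a flag complex). Suppose that for each $i$, all minimal induced subcomplexes $\Delta'$ of $\Delta$ with $\dim\widetilde H_i(\Delta';\Bbbk)\ne 0$ have the same number of vertices. Let $G$ be the graph with $\Delta_G=\Delta$. Then the relative jump sequence $[n;r_1,\dots,r_{n-1}]$ of $I_G$ satisfies $$1\le r_1\le r_2\le\cdots\le r_{n-1}.$$
   Context: Let $\Bbbk$ be a field of characteristic zero. For a finite simple graph $G=(V,E)$ on $N$ vertices with at least one edge, let $R=\Bbbk[x_1,\dots,x_N]$ have one variable per vertex, and let the edge ideal be $I_G=(x_ix_j:\{i,j\}\in E)$. $\Delta_G$ denotes the Stanley-Reisner complex of $I_G$, i.e. the clique complex of the complement graph $G^c$; a simplicial complex is clique-closed (flag) if it is the clique complex of its 1-skeleton, and every such complex is $\Delta_G$ for $G$ the complement of its 1-skeleton. An induced subcomplex is the restriction of the complex to a subset of the vertices; an induced subcomplex with $\dim\widetilde H_i\neq 0$ is minimal if no induced subcomplex on a proper subset of its vertices has nonzero $\widetilde H_i$. Convention: $\beta_{i,j}=\beta_{i,j}(I_G)$ denotes the graded Betti number of the quotient $R/I_G$ in homological degree $i$ and internal degree $j$ (so $\beta_{1,2}$ is the number of edges), and $\mathrm{reg}(I_G)=\max\{j-i+1:\beta_{i,j}\ne 0\}$. If $\mathrm{reg}(I_G)=k+1$, the jump sequence of $I_G$ is $[k;a_1,\dots,a_{k-1}]$,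 where $a_r=\min\{i:\beta_{i,i+r+1}\neq 0\}-1$ for $1\le r\le k-1$. The relative jump sequence is $[k;r_1,\dots,r_{k-1}]$ with $r_1=a_1$ and $r_j=a_j-a_{j-1}$ for $j\ge2$. *)

theory Defs
  imports "HOL-Analysis.Analysis" "HOL-Library.Poly_Mapping"
    "HOL-Library.Function_Algebras"
begin

section \<open>Polynomial rings and ideals\<close>

text \<open>
  The polynomial ring over \<open>'k\<close> with one variable for each element of the finite type \<open>'v\<close>:
  finitely supported functions from exponent vectors to coefficients, with the convolution product
  of \<^theory>\<open>HOL-Library.Poly_Mapping\<close>.
\<close>

type_synonym ('v, 'k) mpoly = "('v \<Rightarrow>\<^sub>0 nat) \<Rightarrow>\<^sub>0 'k"

definition Var :: "'v \<Rightarrow> ('v, 'k::comm_ring_1) mpoly" where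
  "Var v = Poly_Mapping.single (Poly_Mapping.single v 1) 1"

definition mon_degree :: "('v \<Rightarrow>\<^sub>0 nat) \<Rightarrow> nat" where
  "mon_degree m = (\<Sum>v\<in>Poly_Mapping.keys m. Poly_Mapping.lookup m v)"

definition ideal_gen :: "'r::comm_ring_1 set \<Rightarrow> 'r set" where
  "ideal_gen B = module.span (*) B"

definition irrelevant_ideal :: "('v, 'k::comm_ring_1) mpoly set" where
  "irrelevant_ideal = ideal_gen (range Var)"


section \<open>Minimal graded free resolutions and graded Betti numbers\<close>

text \<open>
  Data of a complex of finitely generated graded free modules augmented to a quotient \<open>R / I\<close>:
  \<open>\<dots> \<rightarrow> F\<^sub>2 \<rightarrow> F\<^sub>1 \<rightarrow> F\<^sub>0 \<rightarrow> R / I\<close>.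
  The module \<open>F\<^sub>i\<close> has a homogeneous basis indexed by \<open>b < rk i\<close>, the \<open>b\<close>-th element having degree
  \<open>dg i b\<close>; so \<open>F\<^sub>i\<close> is the direct sum of the twists \<open>R(- dg i b)\<close>.  The entry \<open>df i a b\<close> is the
  \<open>a\<close>-th coordinate of the image in \<open>F\<^sub>i\<close> of the \<open>b\<close>-th basis element of \<open>F\<^sub>i\<^sub>+\<^sub>1\<close>, and \<open>aug b\<close>
  represents the image in \<open>R / I\<close> of the \<open>b\<close>-th basis element of \<open>F\<^sub>0\<close>.  An element of \<open>F\<^sub>i\<close> is
  given by a function on \<open>nat\<close>, of which only the values below \<open>rk i\<close> matter.
\<close>

record (overloaded) ('v, 'k) free_complex =
  rk :: "nat \<Rightarrow> nat"
  dg :: "nat \<Rightarrow> nat \<Rightarrow> nat"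
  df :: "nat \<Rightarrow> nat \<Rightarrow> nat \<Rightarrow> ('v, 'k) mpoly"
  aug :: "nat \<Rightarrow> ('v, 'k) mpoly"

definition apply_df ::
  "('v, 'k::comm_ring_1) free_complex \<Rightarrow> nat \<Rightarrow> (nat \<Rightarrow> ('v, 'k) mpoly) \<Rightarrow> nat \<Rightarrow> ('v, 'k) mpoly"
where
  "apply_df F i f = (\<lambda>a. \<Sum>b<rk F (Suc i). df F i a b * f b)"

definition apply_aug ::
  "('v, 'k::comm_ring_1) free_complex \<Rightarrow> (nat \<Rightarrow> ('v, 'k) mpoly) \<Rightarrow> ('v, 'k) mpoly"
where
  "apply_aug F f = (\<Sum>b<rk F 0. aug F b * f b)"

text \<open>All maps are homogeneous of degree \<open>0\<close>.\<close>

definition graded_complex :: "('v, 'k::comm_ring_1) free_complex \<Rightarrow> bool" where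
  "graded_complex F \<longleftrightarrow>
     (\<forall>b < rk F 0. \<forall>m \<in> Poly_Mapping.keys (aug F b). mon_degree m = dg F 0 b) \<and>
     (\<forall>i. \<forall>a < rk F i. \<forall>b < rk F (Suc i). \<forall>m \<in> Poly_Mapping.keys (df F i a b).
        mon_degree m + dg F i a = dg F (Suc i) b)"

text \<open>Exactness at \<open>R / I\<close>, at \<open>F\<^sub>0\<close>, and at \<open>F\<^sub>i\<^sub>+\<^sub>1\<close> for all \<open>i\<close>.\<close>

definition resolves_quotient ::
  "('v, 'k::comm_ring_1) free_complex \<Rightarrow> ('v, 'k) mpoly set \<Rightarrow> bool"
where
  "resolves_quotient F I \<longleftrightarrow>
     (\<forall>p. \<exists>f. p - apply_aug F f \<in> I) \<and>
     (\<forall>f. apply_aug F f \<in> I \<longleftrightarrow> (\<exists>g. \<forall>a < rk F 0. f a = apply_df F 0 g a)) \<and>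
     (\<forall>i f. (\<forall>a < rk F i. apply_df F i f a = 0) \<longleftrightarrow>
            (\<exists>g. \<forall>b < rk F (Suc i). f b = apply_df F (Suc i) g b))"

definition minimal_complex :: "('v, 'k::comm_ring_1) free_complex \<Rightarrow> bool" where
  "minimal_complex F \<longleftrightarrow>
     (\<forall>i. \<forall>a < rk F i. \<forall>b < rk F (Suc i). df F i a b \<in> irrelevant_ideal)"

definition minimal_graded_free_resolution ::
  "('v, 'k::comm_ring_1) free_complex \<Rightarrow> ('v, 'k) mpoly set \<Rightarrow> bool"
where
  "minimal_graded_free_resolution F I \<longleftrightarrow>
     graded_complex F \<and> resolves_quotient F I \<and> minimal_complex F"

text \<open>
  The graded Betti number of \<open>R / I\<close> (not of \<open>I\<close> as a module) in homological degree \<open>i\<close> and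
  internal degree \<open>j\<close>, for a homogeneous ideal \<open>I\<close>.
\<close>

definition graded_betti :: "('v::finite, 'k::field) mpoly set \<Rightarrow> nat \<Rightarrow> nat \<Rightarrow> nat" where
  "graded_betti I i j =
     (THE c. \<exists>F. minimal_graded_free_resolution F I \<and> c = card {b. b < rk F i \<and> dg F i b = j})"

text \<open>
  The regularity of \<open>I\<close> as a module, read off from the Betti numbers of \<open>R / I\<close>; whence the
  summand \<open>1\<close>.
\<close>

definition regularity :: "('v::finite, 'k::field) mpoly set \<Rightarrow> int" where
  "regularity I = Max {int j - int i + 1 | i j. graded_betti I i j \<noteq> 0}"

text \<open>
  The list \<open>a\<close> holds \<open>a\<^sub>1, \<dots>, a\<^sub>k\<^sub>-\<^sub>1\<close>, so that \<open>a\<^sub>r\<close> is \<open>a ! (r - 1)\<close>.  The minimum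
  \<open>min {i. \<beta>\<^sub>i\<^sub>,\<^sub>i\<^sub>+\<^sub>r\<^sub>+\<^sub>1 \<noteq> 0}\<close> is required to exist.
\<close>

definition has_jump_sequence ::
  "('v::finite, 'k::field) mpoly set \<Rightarrow> nat \<Rightarrow> int list \<Rightarrow> bool"
where
  "has_jump_sequence I k a \<longleftrightarrow>
     regularity I = int k + 1 \<and> length a = k - 1 \<and>
     (\<forall>r \<in> {1..k - 1}. \<exists>m. graded_betti I m (m + r + 1) \<noteq> 0 \<and>
        (\<forall>i < m. graded_betti I i (i + r + 1) = 0) \<and> a ! (r - 1) = int m - 1)"

definition has_relative_jump_sequence ::
  "('v::finite, 'k::field) mpoly set \<Rightarrow> nat \<Rightarrow> int list \<Rightarrow> bool"
where
  "has_relative_jump_sequence I k rs \<longleftrightarrow>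
     (\<exists>a. has_jump_sequence I k a \<and>
        rs = map (\<lambda>j. if j = 0 then a ! 0 else a ! j - a ! (j - 1)) [0..<length a])"


section \<open>Graphs, edge ideals and simplicial complexes\<close>

text \<open>
  The vertex set of all graphs and complexes is the whole finite type \<open>'v\<close>.  A simplicial complex
  is the set of its faces, including the empty face.
\<close>

definition simple_graph :: "'v set set \<Rightarrow> bool" where
  "simple_graph E \<longleftrightarrow> (\<forall>e \<in> E. card e = 2)"

definition complement_graph :: "'v set set \<Rightarrow> 'v set set" where
  "complement_graph E = {e. card e = 2 \<and> e \<notin> E}"

definition clique_complex :: "'v set set \<Rightarrow> 'v set set" where
  "clique_complex E = {S. \<forall>u \<in> S. \<forall>v \<in> S. u \<noteq> v \<longrightarrow> {u, v} \<in> E}"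

definition one_skeleton :: "'v set set \<Rightarrow> 'v set set" where
  "one_skeleton \<Delta> = {e \<in> \<Delta>. card e = 2}"

definition clique_closed :: "'v set set \<Rightarrow> bool" where
  "clique_closed \<Delta> \<longleftrightarrow> \<Delta> = clique_complex (one_skeleton \<Delta>)"

definition edge_ideal :: "'v set set \<Rightarrow> ('v, 'k::comm_ring_1) mpoly set" where
  "edge_ideal E = ideal_gen {Var u * Var v | u v. {u, v} \<in> E}"

definition stanley_reisner_complex :: "('v::finite, 'k::comm_ring_1) mpoly set \<Rightarrow> 'v set set" where
  "stanley_reisner_complex I = {S. (\<Prod>v\<in>S. Var v) \<notin> I}"

lemma module_mult: "module ((*) :: 'r::comm_ring_1 \<Rightarrow> 'r \<Rightarrow> 'r)"
  by standard (auto simp: algebra_simps)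

lemma prod_Var:
  fixes S :: "'v::finite set"
  shows "(\<Prod>v\<in>S. Var v :: ('v, 'k::comm_ring_1) mpoly) =
           Poly_Mapping.single (\<Sum>v\<in>S. Poly_Mapping.single v 1) 1"
  by (induction S rule: infinite_finite_induct) (simp_all add: Var_def mult_single)

lemma lookup_sum_single:
  fixes S :: "'v::finite set"
  shows "Poly_Mapping.lookup (\<Sum>v\<in>S. Poly_Mapping.single v (1::nat)) w = (if w \<in> S then 1 else 0)"
  by (simp add: lookup_sum lookup_single when_def)

lemma keys_edge_ideal:
  fixes p :: "('v::finite, 'k::comm_ring_1) mpoly"
  assumes "p \<in> edge_ideal E" "m \<in> Poly_Mapping.keys p"
  shows "\<exists>u v. {u, v} \<in> E \<and> Poly_Mapping.lookup m u > 0 \<and> Poly_Mapping.lookup m v > 0"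
proof -
  interpret module "(*) :: ('v, 'k) mpoly \<Rightarrow> _" by (rule module_mult)
  let ?Q = "\<lambda>m. \<exists>u v. {u, v} \<in> E \<and> Poly_Mapping.lookup m u > 0 \<and> Poly_Mapping.lookup m v > 0"
  let ?J = "{p :: ('v, 'k) mpoly. \<forall>m \<in> Poly_Mapping.keys p. ?Q m}"
  have "subspace ?J"
  proof (rule subspaceI)
    fix x y :: "('v, 'k) mpoly" assume "x \<in> ?J" "y \<in> ?J"
    then show "x + y \<in> ?J" using keys_add[of x y] by blast
  next
    fix c x :: "('v, 'k) mpoly" assume x: "x \<in> ?J"
    have "?Q m" if mk: "m \<in> Poly_Mapping.keys (c * x)" for m
    proof -
      obtain s t where "m = s + t" "t \<in> Poly_Mapping.keys x"
        using mk keys_mult[of c x] by blast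
      then show ?thesis using x by (fastforce simp: lookup_add)
    qed
    then show "c * x \<in> ?J" by blast
  qed simp
  moreover have "{Var u * Var v | u v. {u, v} \<in> E} \<subseteq> ?J"
    by (force simp: Var_def mult_single lookup_add lookup_single split: if_splits)
  ultimately have "edge_ideal E \<subseteq> ?J"
    unfolding edge_ideal_def ideal_gen_def by (rule span_minimal[rotated])
  then show ?thesis using assms by blast
qed

text \<open>The Stanley-Reisner complex of an edge ideal is the clique complex of the complement graph.\<close>

lemma stanley_reisner_complex_edge_ideal:
  assumes "simple_graph E"
  shows "stanley_reisner_complex (edge_ideal E :: ('v::finite, 'k::comm_ring_1) mpoly set)
           = clique_complex (complement_graph E)"
proof -
  interpret module "(*) :: ('v, 'k) mpoly \<Rightarrow> _" by (rule module_mult)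
  have "(\<Prod>v\<in>S. Var v) \<in> (edge_ideal E :: ('v, 'k) mpoly set)
          \<longleftrightarrow> (\<exists>u \<in> S. \<exists>v \<in> S. {u, v} \<in> E)" for S
  proof
    assume L: "(\<Prod>v\<in>S. Var v) \<in> (edge_ideal E :: ('v, 'k) mpoly set)"
    show "\<exists>u \<in> S. \<exists>v \<in> S. {u, v} \<in> E"
      using keys_edge_ideal[OF L, of "\<Sum>v\<in>S. Poly_Mapping.single v 1"]
      unfolding prod_Var lookup_sum_single by (auto split: if_splits)
  next
    assume "\<exists>u \<in> S. \<exists>v \<in> S. {u, v} \<in> E"
    then obtain u v where uv: "u \<in> S" "v \<in> S" "{u, v} \<in> E" by blast
    then have "u \<noteq> v" using assms by (auto simp: simple_graph_def)
    then have "(\<Prod>w\<in>S. Var w) = (\<Prod>w\<in>S - {u, v}. Var w) * (Var u * Var v :: ('v, 'k) mpoly)"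
      using uv by (subst prod.subset_diff[of "{u, v}" S]) auto
    moreover have "Var u * Var v \<in> (edge_ideal E :: ('v, 'k) mpoly set)"
      unfolding edge_ideal_def ideal_gen_def by (rule span_base) (use uv in blast)
    ultimately show "(\<Prod>v\<in>S. Var v) \<in> (edge_ideal E :: ('v, 'k) mpoly set)"
      unfolding edge_ideal_def ideal_gen_def by (simp only: span_scale)
  qed
  then show ?thesis
    using assms
    by (auto simp: stanley_reisner_complex_def clique_complex_def complement_graph_def
        simple_graph_def card_2_iff) (metis card_2_iff doubleton_eq_iff)+
qed


section \<open>Reduced simplicial homology and minimal induced subcomplexes\<close>

definition induced_subcomplex :: "'v set set \<Rightarrow> 'v set \<Rightarrow> 'v set set" where
  "induced_subcomplex \<Delta> W = {S \<in> \<Delta>. S \<subseteq> W}"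

text \<open>
  The augmented oriented chain complex with coefficients in \<open>'k\<close>, with faces oriented by the
  linear order on \<open>'v\<close>.  A face with \<open>q\<close> vertices has dimension \<open>q - 1\<close>; in particular the empty
  face spans the chains of dimension \<open>-1\<close>.
\<close>

definition chains :: "'v set set \<Rightarrow> int \<Rightarrow> ('v::finite set \<Rightarrow> 'k::field) set" where
  "chains \<Delta> i = {c. \<forall>S. c S \<noteq> 0 \<longrightarrow> S \<in> \<Delta> \<and> int (card S) = i + 1}"

definition boundary_map ::
  "'v set set \<Rightarrow> ('v::{finite, linorder} set \<Rightarrow> 'k::field) \<Rightarrow> 'v set \<Rightarrow> 'k"
where
  "boundary_map \<Delta> c = (\<lambda>T. \<Sum>v | v \<notin> T \<and> insert v T \<in> \<Delta>.
     (- 1) ^ card {u \<in> T. u < v} * c (insert v T))"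

definition cycles :: "'v set set \<Rightarrow> int \<Rightarrow> ('v::{finite, linorder} set \<Rightarrow> 'k::field) set" where
  "cycles \<Delta> i = {c \<in> chains \<Delta> i. boundary_map \<Delta> c = (\<lambda>_. 0)}"

definition boundaries :: "'v set set \<Rightarrow> int \<Rightarrow> ('v::{finite, linorder} set \<Rightarrow> 'k::field) set" where
  "boundaries \<Delta> i = boundary_map \<Delta> ` chains \<Delta> (i + 1)"

text \<open>
  The dimension of the quotient of cycles by boundaries; the argument of type \<open>'k itself\<close> selects
  the coefficient field.
\<close>

definition reduced_homology_dim ::
  "'k::field itself \<Rightarrow> 'v::{finite, linorder} set set \<Rightarrow> int \<Rightarrow> nat"
where
  "reduced_homology_dim K \<Delta> i =
     vector_space.dim (\<lambda>a c S. a * c S) (cycles \<Delta> i :: ('v set \<Rightarrow> 'k) set) -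
     vector_space.dim (\<lambda>a c S. a * c S) (boundaries \<Delta> i :: ('v set \<Rightarrow> 'k) set)"

text \<open>The induced subcomplex on the vertex set \<open>W\<close> is minimal with nonzero homology in degree \<open>i\<close>.\<close>

definition minimal_nonzero_homology ::
  "'k::field itself \<Rightarrow> 'v::{finite, linorder} set set \<Rightarrow> int \<Rightarrow> 'v set \<Rightarrow> bool"
where
  "minimal_nonzero_homology K \<Delta> i W \<longleftrightarrow>
     reduced_homology_dim K (induced_subcomplex \<Delta> W) i \<noteq> 0 \<and>
     (\<forall>W'. W' \<subset> W \<longrightarrow> reduced_homology_dim K (induced_subcomplex \<Delta> W') i = 0)"


section \<open>Simplicial polytopes\<close>

definition simplicial_polytope :: "nat \<Rightarrow> 'a::euclidean_space set \<Rightarrow> bool" where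
  "simplicial_polytope n P \<longleftrightarrow>
     polytope P \<and> aff_dim P = int n \<and> (\<forall>F. F face_of P \<and> F \<noteq> P \<longrightarrow> (\<exists>m. m simplex F))"

text \<open>
  The map \<open>x\<close> labels the vertices of the polytope by the elements of \<open>'v\<close>; the faces of the
  boundary complex are the vertex sets of the proper faces of \<open>P\<close>, including the empty one.
\<close>

definition boundary_complex :: "'a::euclidean_space set \<Rightarrow> ('v \<Rightarrow> 'a) \<Rightarrow> 'v set set" where
  "boundary_complex P x = {S. \<exists>F. F face_of P \<and> F \<noteq> P \<and> x ` S = {p. p extreme_point_of F}}"

end

theory Submission
  imports Defs
begin

text \<open>
  Let \<open>m\<^sub>j\<close> be the number of vertices of the minimal induced subcomplexes with nonzero reduced homology in
  degree \<open>j\<close>.  Hochster's formula gives \<open>a\<^sub>r = m\<^sub>r - r - 2\<close>, hence \<open>r\<^sub>j = m\<^sub>j - m\<^sub>j\<^sub>-\<^sub>1 - 1\<close>, and the claim is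
  that \<open>m\<^sub>j\<close> is convex in \<open>j\<close>.  The link of a face \<open>F\<close> of a flag complex is induced; when \<open>\<Delta>\<close> is a polytopal
  sphere the link is a sphere, whose top cycle has all vertices in its support, so the link is minimal and
  \<open>m\<^sub>j\<close> is its number of vertices for every \<open>F\<close> of codimension \<open>j + 1\<close>.  For adjacent vertices \<open>u\<close>, \<open>v\<close> of the
  link of \<open>H\<close>, this link contains the links of \<open>H \<union> {u}\<close> and \<open>H \<union> {v}\<close>, which meet in the link of
  \<open>H \<union> {u, v}\<close>; counting vertices gives \<open>m\<^sub>j\<^sub>+\<^sub>1 \<ge> 2 m\<^sub>j - m\<^sub>j\<^sub>-\<^sub>1\<close>.
\<close>

section \<open>Koszul complexes of multigraded resolutions\<close>

text \<open>\<open>graded_betti\<close> is a definite description over all minimal graded free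
  resolutions, so Hochster's formula requires one resolution to be exhibited and the ranks of any
  two to be compared. Regularity and jump sequences depend only on which Betti numbers are nonzero;
  hence the formula is proved as an equivalence of vanishing statements, by Koszul exactness shifted
  along the resolution, and no dimension of Tor is computed. The sphere properties of links are
  obtained from linear algebra: the cones from an interior point over the proper faces of the
  polytope form a complete simplicial fan, and projecting along a ray gives a complete fan for the
  link of a vertex. Links therefore stay in one class on which induction works, without vertex
  figures. The top cycle of a fan is the sign of a determinant on facets, and its full support rests
  on the connectedness of a punctured space of dimension at least 2. The starting values, 0 vertices
  for the link of a facet and 2 for the link of a ridge, turn convexity into the bound on
  r_1.\<close>

definition psign :: "'v::linorder \<Rightarrow> 'v set \<Rightarrow> 'k::comm_ring_1" where
  "psign v T = (- 1) ^ card {u \<in> T. u < v}"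

lemma psign_square [simp]: "psign v T * psign v T = (1 :: 'k::comm_ring_1)"
  by (simp add: psign_def flip: power_mult_distrib)

lemma psign_square_mult [simp]: "psign v T * (psign v T * a) = (a :: 'k::comm_ring_1)"
  by (simp flip: mult.assoc)

lemma psign_nonzero [simp]: "psign v T \<noteq> (0 :: 'k::field)"
  by (simp add: psign_def)

lemma psign_insert:
  assumes "finite T" "w \<notin> T"
  shows "psign v (insert w T) = (if w < v then - psign v T else psign v T)"
proof -
  have "{u \<in> insert w T. u < v} = (if w < v then insert w {u \<in> T. u < v} else {u \<in> T. u < v})"
    by auto
  then show ?thesis using assms by (simp add: psign_def)
qed

lemma psign_insert_same [simp]: "psign v (insert v T) = psign v T"
proof -
  have "{u \<in> insert v T. u < v} = {u \<in> T. u < v}" by auto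
  then show ?thesis by (simp add: psign_def)
qed

lemma psign_Diff_same [simp]: "psign v (T - {v}) = psign v T"
proof -
  have "{u \<in> T - {v}. u < v} = {u \<in> T. u < v}" by auto
  then show ?thesis by (simp add: psign_def)
qed

text \<open>Of the two orders of adding \<open>v\<close> and \<open>w\<close>, exactly one changes
  the sign of the second factor, because exactly one of the two is the smaller. This is the source
  of the cancellations in squares of differentials.\<close>

lemma psign_swap:
  assumes "finite T" "v \<notin> T" "w \<notin> T" "v \<noteq> w"
  shows "psign v T * psign w (insert v T) = - (psign w T * psign v (insert w T) :: 'k::comm_ring_1)"
  using assms by (auto simp: psign_insert ac_simps)

lemma psign_swap_Diff:
  assumes "finite U" "v \<in> U" "w \<in> U" "v \<noteq> w"
  shows "psign v U * psign w (U - {v}) = - (psign w U * psign v (U - {w}) :: 'k::comm_ring_1)"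
proof -
  let ?T = "U - {v, w}"
  have e: "U - {v} = insert w ?T" "U - {w} = insert v ?T" "U = insert v (insert w ?T)"
    using assms by auto
  have 1: "psign v U = (psign v (insert w ?T) :: 'k)" "psign w U = (psign w (insert v ?T) :: 'k)"
    by (subst e(3), simp, subst e(3), simp add: insert_commute[of v w])
  have "psign v ?T * psign w (insert v ?T) = - (psign w ?T * psign v (insert w ?T) :: 'k)"
    by (rule psign_swap) (use assms in auto)
  then show ?thesis unfolding e(1,2) 1 by (simp add: ac_simps)
qed

text \<open>Terms are matched across the diagonal by the order on the index set. The shorter
  argument that the sum equals its own negative would fail in characteristic 2.\<close>

lemma sum_antisym_zero:
  fixes f :: "'v::linorder \<Rightarrow> 'v \<Rightarrow> 'k::comm_ring_1"
  assumes U: "finite U" and f: "\<And>v w. v \<in> U \<Longrightarrow> w \<in> U \<Longrightarrow> v \<noteq> w \<Longrightarrow> f v w = - f w v"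
  shows "(\<Sum>v\<in>U. \<Sum>w\<in>U - {v}. f v w) = 0"
proof -
  have split: "(\<Sum>w\<in>U - {v}. f v w) = (\<Sum>w | w \<in> U \<and> w < v. f v w) + (\<Sum>w | w \<in> U \<and> v < w. f v w)"
    for v
  proof -
    have e: "U - {v} = {w. w \<in> U \<and> w < v} \<union> {w. w \<in> U \<and> v < w}" by auto
    show ?thesis unfolding e by (rule sum.union_disjoint) (use U in auto)
  qed
  have "(\<Sum>v\<in>U. \<Sum>w | w \<in> U \<and> v < w. f v w) = (\<Sum>w\<in>U. \<Sum>v | v \<in> U \<and> v < w. f v w)"
    using U by (rule sum.swap_restrict) (rule U)
  also have "\<dots> = (\<Sum>w\<in>U. \<Sum>v | v \<in> U \<and> v < w. - f w v)"
    by (intro sum.cong refl) (use f in auto)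
  finally show ?thesis by (simp add: split sum.distrib sum_negf)
qed

text \<open>No complex is mentioned: restriction to faces is left to the places where values are
  read off. The same formula serves as simplicial coboundary and, coordinatewise, as Koszul
  differential.\<close>

definition coboundary :: "('v::linorder set \<Rightarrow> 'k::comm_ring_1) \<Rightarrow> 'v set \<Rightarrow> 'k" where
  "coboundary c U = (\<Sum>v\<in>U. psign v U * c (U - {v}))"

lemma coboundary_coboundary:
  fixes c :: "'v::{finite, linorder} set \<Rightarrow> 'k::comm_ring_1"
  shows "coboundary (coboundary c) U = 0"
proof -
  have "coboundary (coboundary c) U
      = (\<Sum>v\<in>U. \<Sum>w\<in>U - {v}. psign v U * psign w (U - {v}) * c (U - {v} - {w}))"
    by (simp add: coboundary_def sum_distrib_left mult.assoc)
  also have "\<dots> = 0"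
  proof (rule sum_antisym_zero)
    fix v w :: 'v assume "v \<in> U" "w \<in> U" "v \<noteq> w"
    moreover have "U - {v} - {w} = U - {w} - {v}" by auto
    ultimately show "psign v U * psign w (U - {v}) * c (U - {v} - {w})
        = - (psign w U * psign v (U - {w}) * c (U - {w} - {v}))"
      using psign_swap_Diff[of U v w, where ?'k='k] by simp
  qed simp
  finally show ?thesis .
qed

text \<open>Contracting homotopy of a cone with apex \<open>v\<close>, in the form needed at one set
  \<open>U\<close>. If \<open>v\<close> lies in \<open>U\<close>, only the term that removes
  \<open>v\<close> survives; otherwise the cocycle condition at \<open>insert v U\<close> expresses
  \<open>c U\<close> through the remaining terms.\<close>

lemma coboundary_cone:
  fixes c :: "'v::{finite, linorder} set \<Rightarrow> 'k::comm_ring_1"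
  assumes "v \<notin> U \<Longrightarrow> coboundary c (insert v U) = 0"
  shows "coboundary (\<lambda>T. if v \<in> T then 0 else psign v T * c (insert v T)) U = c U"
    (is "coboundary ?e U = _")
proof (cases "v \<in> U")
  case True
  have "coboundary ?e U = psign v U * ?e (U - {v}) + (\<Sum>w\<in>U - {v}. psign w U * ?e (U - {w}))"
    unfolding coboundary_def by (rule sum.remove) (use True in auto)
  also have "(\<Sum>w\<in>U - {v}. psign w U * ?e (U - {w})) = 0"
    using True by (intro sum.neutral) auto
  finally show ?thesis using True by (simp add: insert_absorb)
next
  case False
  have "0 = psign v (insert v U) * c (insert v U - {v})
        + (\<Sum>w\<in>U. psign w (insert v U) * c (insert v U - {w}))"
    using assms[OF False] False unfolding coboundary_def by (subst (asm) sum.insert) auto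
  moreover have "insert v U - {v} = U" using False by auto
  ultimately have "psign v U * c U = - (\<Sum>w\<in>U. psign w (insert v U) * c (insert v U - {w}))"
    by (simp add: eq_neg_iff_add_eq_0)
  then have "psign v U * (psign v U * c U)
      = psign v U * - (\<Sum>w\<in>U. psign w (insert v U) * c (insert v U - {w}))"
    by simp
  then have c: "c U = - psign v U * (\<Sum>w\<in>U. psign w (insert v U) * c (insert v U - {w}))"
    by simp
  have "psign w U * ?e (U - {w}) = - psign v U * (psign w (insert v U) * c (insert v U - {w}))"
    if w: "w \<in> U" for w
  proof -
    have ne: "w \<noteq> v" using w False by auto
    have e1: "insert v (U - {w}) = insert v U - {w}" using ne by auto
    have "psign v (insert v U) * psign w (insert v U - {v}) = - (psign w (insert v U) * psign v (insert v U - {w}) :: 'k)"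
      by (rule psign_swap_Diff) (use w ne in auto)
    moreover have "insert v U - {v} = U" using False by auto
    moreover have "psign v (insert v U - {w}) = (psign v (U - {w}) :: 'k)"
      by (simp flip: e1)
    ultimately have *: "psign v U * psign w U = - (psign w (insert v U) * psign v (U - {w}) :: 'k)"
      by simp
    have "psign w U * psign v (U - {w}) = psign v U * (psign v U * psign w U) * (psign v (U - {w}) :: 'k)"
      by (simp add: mult.assoc[symmetric])
    also have "\<dots> = - psign v U * psign w (insert v U) * (psign v (U - {w}) * psign v (U - {w}) :: 'k)"
      unfolding * by (simp add: algebra_simps del: psign_square_mult psign_square)
    finally have "psign w U * psign v (U - {w}) = - psign v U * (psign w (insert v U) :: 'k)" by simp
    then show ?thesis using False e1 by (simp add: mult.assoc[symmetric])
  qed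
  then show ?thesis
    unfolding c unfolding coboundary_def by (simp add: sum_distrib_left)
qed


lemma coboundary_cong: "(\<And>v. v \<in> U \<Longrightarrow> c (U - {v}) = c' (U - {v})) \<Longrightarrow> coboundary c U = coboundary c' U"
  by (simp add: coboundary_def)

lemma coboundary_diff: "coboundary (\<lambda>T. c T - c' T) U = coboundary c U - coboundary c' U"
  by (simp add: coboundary_def right_diff_distrib sum_subtractf)

lemma sum_fun_app: "(\<Sum>x\<in>A. f x) y = (\<Sum>x\<in>A. f x y)"
  by (induction A rule: infinite_finite_induct) auto

interpretation fun_space: vector_space "\<lambda>(a::'k::field) (c::'i \<Rightarrow> 'k) i. a * c i"
  by standard (auto simp: algebra_simps fun_eq_iff)

section \<open>Koszul complexes of functors on the subsets of a vertex set\<close>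

definition kdiff :: "('v::{finite, linorder} set \<Rightarrow> nat \<Rightarrow> 'k::field) \<Rightarrow> 'v set \<Rightarrow> nat \<Rightarrow> 'k" where
  "kdiff c U = (\<lambda>b. coboundary (\<lambda>T. c T b) U)"

text \<open>
  The tier \<open>Suc p\<close> consists of the complements in \<open>W\<close> of the \<open>p\<close>-element subsets; tier \<open>0\<close> is
  empty, which saves a case distinction at the end of the Koszul complex.
\<close>

definition tier :: "'v set \<Rightarrow> nat \<Rightarrow> 'v set set" where
  "tier W p = {T. T \<subseteq> W \<and> card T + p = Suc (card W)}"

lemma tier_0 [simp]: "tier (W :: 'v::finite set) 0 = {}"
proof -
  have "card T \<noteq> Suc (card W)" if "T \<subseteq> W" for T
    using card_mono[OF finite that] by simp
  then show ?thesis by (auto simp: tier_def)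
qed

lemma tier_1 [simp]: "tier (W :: 'v::finite set) (Suc 0) = {W}"
  using card_subset_eq[of W] by (auto simp: tier_def)

lemma tier_remove: "U \<in> tier (W :: 'v::finite set) p \<Longrightarrow> v \<in> U \<Longrightarrow> U - {v} \<in> tier W (Suc p)"
  using card_Suc_Diff1[of U v] by (auto simp: tier_def)

lemma tier_insert:
  "T \<in> tier (W :: 'v::finite set) (Suc p) \<Longrightarrow> v \<in> W \<Longrightarrow> v \<notin> T \<Longrightarrow> insert v T \<in> tier W p"
  by (simp add: tier_def)

lemma kdiff_cong:
  assumes "U \<in> tier W p" "\<And>T. T \<in> tier W (Suc p) \<Longrightarrow> c T = c' T"
  shows "kdiff c U = kdiff c' U"
  using assms by (auto simp: kdiff_def fun_eq_iff intro!: coboundary_cong dest: tier_remove)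

lemma kdiff_diff: "kdiff (\<lambda>T. c T - c' T) U = kdiff c U - kdiff c' U"
  by (simp add: kdiff_def fun_eq_iff coboundary_diff)

lemma kdiff_kdiff [simp]: "kdiff (kdiff c) U = 0"
  by (simp add: kdiff_def fun_eq_iff coboundary_coboundary)

lemma kdiff_in:
  assumes U: "U \<in> tier W p" and c: "\<And>T. T \<in> tier W (Suc p) \<Longrightarrow> c T \<in> M T"
    and M: "fun_space.subspace (M U)" "\<And>T. T \<subseteq> U \<Longrightarrow> M T \<subseteq> M U"
  shows "kdiff c U \<in> M U"
proof -
  have "kdiff c U = (\<Sum>v\<in>U. (\<lambda>b. psign v U * c (U - {v}) b))"
    by (simp add: kdiff_def coboundary_def fun_eq_iff sum_fun_app)
  also have "\<dots> \<in> M U"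
  proof (rule fun_space.subspace_sum[OF M(1)])
    fix v assume v: "v \<in> U"
    have "c (U - {v}) \<in> M U"
      using c[OF tier_remove[OF U v]] M(2)[of "U - {v}"] by auto
    then show "(\<lambda>b. psign v U * c (U - {v}) b) \<in> M U"
      by (rule fun_space.subspace_scale[OF M(1)])
  qed
  finally show ?thesis .
qed

text \<open>
  Exactness in homological degree \<open>p\<close> of the Koszul complexes of a functor \<open>M\<close> and of a quotient
  functor \<open>C / Z\<close> on the subsets of \<open>W\<close>.
\<close>

definition koszul_exact :: "('v::{finite, linorder} set \<Rightarrow> (nat \<Rightarrow> 'k::field) set) \<Rightarrow> 'v set \<Rightarrow> nat \<Rightarrow> bool" where
  "koszul_exact M W p \<longleftrightarrow>
     (\<forall>c. (\<forall>T \<in> tier W (Suc p). c T \<in> M T) \<longrightarrow> (\<forall>U \<in> tier W p. kdiff c U = 0) \<longrightarrow>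
       (\<exists>e. (\<forall>T \<in> tier W (Suc (Suc p)). e T \<in> M T) \<and> (\<forall>T \<in> tier W (Suc p). c T = kdiff e T)))"

definition koszul_quotient_exact ::
  "('v::{finite, linorder} set \<Rightarrow> (nat \<Rightarrow> 'k::field) set) \<Rightarrow> ('v set \<Rightarrow> (nat \<Rightarrow> 'k) set) \<Rightarrow> 'v set \<Rightarrow> nat \<Rightarrow> bool"
where
  "koszul_quotient_exact C Z W p \<longleftrightarrow>
     (\<forall>c. (\<forall>T \<in> tier W (Suc p). c T \<in> C T) \<longrightarrow> (\<forall>U \<in> tier W p. kdiff c U \<in> Z U) \<longrightarrow>
       (\<exists>e. (\<forall>T \<in> tier W (Suc (Suc p)). e T \<in> C T) \<and>
            (\<forall>T \<in> tier W (Suc p). c T - kdiff e T \<in> Z T)))"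

lemma koszul_exactE:
  assumes "koszul_exact M W p" "\<forall>T \<in> tier W (Suc p). c T \<in> M T" "\<forall>U \<in> tier W p. kdiff c U = 0"
  obtains e where "\<forall>T \<in> tier W (Suc (Suc p)). e T \<in> M T" "\<forall>T \<in> tier W (Suc p). c T = kdiff e T"
proof -
  from assms(1)[unfolded koszul_exact_def, THEN spec, THEN mp, THEN mp, OF assms(2,3)] show thesis
    by (elim exE conjE) (rule that)
qed

lemma koszul_quotient_exactE:
  assumes "koszul_quotient_exact C Z W p"
    "\<forall>T \<in> tier W (Suc p). c T \<in> C T" "\<forall>U \<in> tier W p. kdiff c U \<in> Z U"
  obtains e where "\<forall>T \<in> tier W (Suc (Suc p)). e T \<in> C T"
    "\<forall>T \<in> tier W (Suc p). c T - kdiff e T \<in> Z T"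
proof -
  from assms(1)[unfolded koszul_quotient_exact_def, THEN spec, THEN mp, THEN mp, OF assms(2,3)]
  show thesis by (elim exE conjE) (rule that)
qed

text \<open>In multidegrees with support \<open>W\<close> a basis element contributes a
  one-dimensional space exactly when its squarefree label divides the monomial, that is when the
  label is contained in \<open>W\<close>.\<close>

definition labelled_chains :: "nat \<Rightarrow> (nat \<Rightarrow> 'v set) \<Rightarrow> 'v set \<Rightarrow> (nat \<Rightarrow> 'k::field) set" where
  "labelled_chains r l W = {c. \<forall>b. c b \<noteq> 0 \<longrightarrow> b < r \<and> l b \<subseteq> W}"

lemma subspace_labelled_chains: "fun_space.subspace (labelled_chains r l W :: (nat \<Rightarrow> 'k::field) set)"
proof (rule fun_space.subspaceI)
  fix x y :: "nat \<Rightarrow> 'k" assume "x \<in> labelled_chains r l W" "y \<in> labelled_chains r l W"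
  moreover have "x b \<noteq> 0 \<or> y b \<noteq> 0" if "(x + y) b \<noteq> 0" for b using that by auto
  ultimately show "x + y \<in> labelled_chains r l W" unfolding labelled_chains_def by blast
qed (auto simp: labelled_chains_def)

lemma labelled_chains_mono: "T \<subseteq> U \<Longrightarrow> labelled_chains r l T \<subseteq> labelled_chains r l U"
  by (auto simp: labelled_chains_def)

text \<open>The complex splits over the basis elements \<open>b\<close>. A label properly contained
  in \<open>W\<close> leaves a vertex of \<open>W\<close> outside it, and the cone homotopy with
  this apex stays among sets containing the label. Only the label \<open>W\<close> obstructs
  exactness, so cycles with a component there are excluded.\<close>

lemma labelled_chains_acyclic:
  fixes c :: "'v::{finite, linorder} set \<Rightarrow> nat \<Rightarrow> 'k::field"
  assumes c: "\<And>T. T \<in> tier W (Suc p) \<Longrightarrow> c T \<in> labelled_chains r l T"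
    and d: "\<And>U. U \<in> tier W p \<Longrightarrow> kdiff c U = 0"
    and W: "\<And>T b. T \<in> tier W (Suc p) \<Longrightarrow> l b = W \<Longrightarrow> c T b = 0"
  shows "\<exists>e. (\<forall>T \<in> tier W (Suc (Suc p)). e T \<in> labelled_chains r l T) \<and>
           (\<forall>T \<in> tier W (Suc p). c T = kdiff e T)"
proof -
  define x where "x b = (SOME v. v \<in> W - l b)" for b
  have x: "x b \<in> W - l b" if "l b \<subset> W" for b
    unfolding x_def by (rule someI_ex) (use that in auto)
  define e where "e T b =
    (if l b \<subset> W \<and> x b \<notin> T then psign (x b) T * c (insert (x b) T) b else 0)" for T b
  have "e T \<in> labelled_chains r l T" if T: "T \<in> tier W (Suc (Suc p))" for T
  proof -
    have "b < r \<and> l b \<subseteq> T" if "e T b \<noteq> 0" for b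
    proof -
      have b: "l b \<subset> W" "x b \<notin> T" "c (insert (x b) T) b \<noteq> 0"
        using that by (auto simp: e_def split: if_splits)
      have "insert (x b) T \<in> tier W (Suc p)"
        by (rule tier_insert[OF T]) (use x[OF b(1)] b(2) in auto)
      then have "c (insert (x b) T) \<in> labelled_chains r l (insert (x b) T)" by (rule c)
      then have "b < r" "l b \<subseteq> insert (x b) T" using b(3) by (auto simp: labelled_chains_def)
      then show ?thesis using x[OF b(1)] by auto
    qed
    then show ?thesis by (auto simp: labelled_chains_def)
  qed
  moreover have "c T = kdiff e T" if T: "T \<in> tier W (Suc p)" for T
  proof
    fix b
    show "c T b = kdiff e T b"
    proof (cases "l b \<subset> W")
      case True
      have "coboundary (\<lambda>T. if x b \<in> T then 0 else psign (x b) T * c (insert (x b) T) b) T = c T b"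
      proof (rule coboundary_cone)
        assume "x b \<notin> T"
        then have "insert (x b) T \<in> tier W p" using tier_insert[OF T] x[OF True] by auto
        then have "kdiff c (insert (x b) T) = 0" by (rule d)
        then show "coboundary (\<lambda>T. c T b) (insert (x b) T) = 0"
          by (simp add: kdiff_def fun_eq_iff)
      qed
      moreover have "(\<lambda>T. e T b) = (\<lambda>T. if x b \<in> T then 0 else psign (x b) T * c (insert (x b) T) b)"
        using True by (auto simp: e_def)
      ultimately show ?thesis by (simp add: kdiff_def)
    next
      case False
      have "c T b = 0"
      proof (cases "l b = W")
        case True
        then show ?thesis using W[OF T] by blast
      next
        case neq: False
        with False have "\<not> l b \<subseteq> W" by blast
        then have "\<not> l b \<subseteq> T" using T by (auto simp: tier_def)
        then show ?thesis using c[OF T] by (auto simp: labelled_chains_def)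
      qed
      moreover have "e U b = 0" for U using False by (simp add: e_def)
      ultimately show ?thesis by (simp add: kdiff_def coboundary_def)
    qed
  qed
  ultimately show ?thesis by blast
qed


definition labelled_map :: "nat \<Rightarrow> (nat \<Rightarrow> nat \<Rightarrow> 'k::field) \<Rightarrow> (nat \<Rightarrow> 'k) \<Rightarrow> nat \<Rightarrow> 'k" where
  "labelled_map r m c = (\<lambda>a. \<Sum>b<r. m a b * c b)"

lemma labelled_map_diff: "labelled_map r m (c - c') = labelled_map r m c - labelled_map r m c'"
  by (simp add: labelled_map_def fun_eq_iff right_diff_distrib sum_subtractf)

lemma labelled_map_add: "labelled_map r m (c + c') = labelled_map r m c + labelled_map r m c'"
  by (simp add: labelled_map_def fun_eq_iff distrib_left sum.distrib)

lemma labelled_map_scale: "labelled_map r m (\<lambda>b. a * c b) = (\<lambda>b. a * labelled_map r m c b)"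
  by (simp add: labelled_map_def fun_eq_iff sum_distrib_left ac_simps)

lemma labelled_map_0 [simp]: "labelled_map r m 0 = 0"
  by (simp add: labelled_map_def fun_eq_iff)

lemma kdiff_labelled_map: "kdiff (\<lambda>T. labelled_map r m (c T)) U = labelled_map r m (kdiff c U)"
proof
  fix a
  have "kdiff (\<lambda>T. labelled_map r m (c T)) U a
      = (\<Sum>v\<in>U. \<Sum>b<r. psign v U * (m a b * c (U - {v}) b))"
    by (simp add: kdiff_def coboundary_def labelled_map_def sum_distrib_left)
  also have "\<dots> = (\<Sum>b<r. \<Sum>v\<in>U. psign v U * (m a b * c (U - {v}) b))"
    by (rule sum.swap)
  also have "\<dots> = labelled_map r m (kdiff c U) a"
    by (simp add: kdiff_def coboundary_def labelled_map_def sum_distrib_left ac_simps)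
  finally show "kdiff (\<lambda>T. labelled_map r m (c T)) U a = labelled_map r m (kdiff c U) a" .
qed

text \<open>With a single generator in degree 0, the base case is the kernel of the augmentation to
  the Stanley-Reisner ring, which is one-dimensional in multidegrees supported on a face and zero
  elsewhere.\<close>

primrec labelled_kernel ::
  "'v set set \<Rightarrow> (nat \<Rightarrow> nat) \<Rightarrow> (nat \<Rightarrow> nat \<Rightarrow> 'v set) \<Rightarrow> (nat \<Rightarrow> nat \<Rightarrow> nat \<Rightarrow> 'k::field) \<Rightarrow>
     nat \<Rightarrow> 'v set \<Rightarrow> (nat \<Rightarrow> 'k) set"
where
  "labelled_kernel \<Delta> rn lb mt 0 W = {c \<in> labelled_chains (rn 0) (lb 0) W. W \<in> \<Delta> \<longrightarrow> c = 0}"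
| "labelled_kernel \<Delta> rn lb mt (Suc i) W =
     {c \<in> labelled_chains (rn (Suc i)) (lb (Suc i)) W. labelled_map (rn (Suc i)) (mt i) c = 0}"

text \<open>
  Multigraded resolutions of the Stanley-Reisner ring.  The \<open>b\<close>-th basis element in homological
  degree \<open>i\<close> has the squarefree multidegree \<open>lb i b\<close>, so a matrix entry is a scalar \<open>mt i a b\<close>
  times the monomial of \<open>lb (Suc i) b - lb i a\<close>, and in multidegrees with support \<open>W\<close> the
  resolution is a complex of finite-dimensional vector spaces depending only on \<open>W\<close>.
\<close>

locale labelled_resolution =
  fixes \<Delta> :: "'v::{finite, linorder} set set"
    and rn :: "nat \<Rightarrow> nat" and lb :: "nat \<Rightarrow> nat \<Rightarrow> 'v set" and mt :: "nat \<Rightarrow> nat \<Rightarrow> nat \<Rightarrow> 'k::field"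
  assumes empty_face: "{} \<in> \<Delta>"
    and face_subset: "S \<in> \<Delta> \<Longrightarrow> T \<subseteq> S \<Longrightarrow> T \<in> \<Delta>"
    and rn_0: "rn 0 = 1" and lb_0: "lb 0 0 = {}"
    and mt_nonzero: "mt i a b \<noteq> 0 \<Longrightarrow> a < rn i \<and> b < rn (Suc i) \<and> lb i a \<subset> lb (Suc i) b"
    and exact: "labelled_kernel \<Delta> rn lb mt i W =
      labelled_map (rn (Suc i)) (mt i) ` labelled_chains (rn (Suc i)) (lb (Suc i)) W"
begin

abbreviation "C i \<equiv> labelled_chains (rn i) (lb i)"
abbreviation "Z \<equiv> labelled_kernel \<Delta> rn lb mt"
abbreviation "D i \<equiv> labelled_map (rn (Suc i)) (mt i)"

lemma kernel_subset: "Z i W \<subseteq> C i W"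
  by (cases i) auto

lemma subspace_kernel: "fun_space.subspace (Z i W)"
proof (rule fun_space.subspaceI)
  note s = subspace_labelled_chains[of "rn i" "lb i" W]
  show "0 \<in> Z i W" using fun_space.subspace_0[OF s] by (cases i) auto
  show "x + y \<in> Z i W" if "x \<in> Z i W" "y \<in> Z i W" for x y
    using fun_space.subspace_add[OF s, of x y] that by (cases i) (auto simp: labelled_map_add)
  show "(\<lambda>b. a * x b) \<in> Z i W" if "x \<in> Z i W" for a x
    using fun_space.subspace_scale[OF s, of x a] that
    by (cases i) (auto simp: labelled_map_scale fun_eq_iff)
qed

text \<open>Elements of the kernel are images, and a nonzero matrix entry into a basis element with
  label \<open>W\<close> comes from a label strictly larger than \<open>W\<close>, which is absent
  from the strand of \<open>W\<close>. The strict inclusion in \<open>mt_nonzero\<close> thus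
  encodes minimality.\<close>

lemma kernel_top_zero:
  assumes "c \<in> Z i W" "lb i b = W" shows "c b = 0"
proof -
  obtain g where g: "g \<in> C (Suc i) W" "c = D i g" using assms(1) unfolding exact by blast
  have "mt i b b' * g b' = 0" for b'
    using mt_nonzero[of i b b'] g(1) assms(2) by (auto simp: labelled_chains_def)
  then show ?thesis unfolding g(2) labelled_map_def by (intro sum.neutral) simp
qed

text \<open>
  Dimension shifting along \<open>0 \<rightarrow> Z i \<rightarrow> C i \<rightarrow> C i / Z i \<rightarrow> 0\<close>.  Only in position \<open>0\<close> does
  \<open>C i\<close> fail to be acyclic; there minimality, in the form of \<open>kernel_top_zero\<close>, takes over.
\<close>

lemma quotient_exact_Suc_iff:
  "koszul_quotient_exact (C i) (Z i) W (Suc p) \<longleftrightarrow> koszul_exact (Z i) W p"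
proof
  assume L: "koszul_quotient_exact (C i) (Z i) W (Suc p)"
  show "koszul_exact (Z i) W p"
    unfolding koszul_exact_def
  proof (intro allI impI)
    fix z assume z: "\<forall>T \<in> tier W (Suc p). z T \<in> Z i T" "\<forall>U \<in> tier W p. kdiff z U = 0"
    \<comment> \<open>The condition on the label \<open>W\<close> in the acyclicity lemma has
      content at \<open>T = W\<close> only; into a proper subset the label does not fit.\<close>
    have "z T b = 0" if T: "T \<in> tier W (Suc p)" and b: "lb i b = W" for T b
    proof (cases "T = W")
      case True
      then show ?thesis using kernel_top_zero z(1) T b by blast
    next
      case False
      then have "\<not> W \<subseteq> T" using T by (auto simp: tier_def)
      then show ?thesis using kernel_subset[of i T] bspec[OF z(1) T] b
        by (auto simp: labelled_chains_def simp del: labelled_kernel.simps)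
    qed
    then obtain c where c: "\<forall>T \<in> tier W (Suc (Suc p)). c T \<in> C i T"
        "\<forall>T \<in> tier W (Suc p). z T = kdiff c T"
      using labelled_chains_acyclic[of W p z "rn i" "lb i"] z kernel_subset by blast
    then have "\<forall>T \<in> tier W (Suc p). kdiff c T \<in> Z i T" using z(1) by simp
    then obtain e where e: "\<forall>T \<in> tier W (Suc (Suc (Suc p))). e T \<in> C i T"
        "\<forall>T \<in> tier W (Suc (Suc p)). c T - kdiff e T \<in> Z i T"
      using koszul_quotient_exactE[OF L c(1)] by blast
    have "z T = kdiff (\<lambda>T. c T - kdiff e T) T" if "T \<in> tier W (Suc p)" for T
      using c(2) that by (simp add: kdiff_diff)
    then show "\<exists>e. (\<forall>T \<in> tier W (Suc (Suc p)). e T \<in> Z i T) \<and> (\<forall>T \<in> tier W (Suc p). z T = kdiff e T)"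
      using e(2) by (intro exI[of _ "\<lambda>T. c T - kdiff e T"]) blast
  qed
next
  assume R: "koszul_exact (Z i) W p"
  show "koszul_quotient_exact (C i) (Z i) W (Suc p)"
    unfolding koszul_quotient_exact_def
  proof (intro allI impI)
    fix c assume c: "\<forall>T \<in> tier W (Suc (Suc p)). c T \<in> C i T" "\<forall>U \<in> tier W (Suc p). kdiff c U \<in> Z i U"
    obtain z where z: "\<forall>T \<in> tier W (Suc (Suc p)). z T \<in> Z i T"
        "\<forall>T \<in> tier W (Suc p). kdiff c T = kdiff z T"
      using koszul_exactE[OF R c(2)] by auto
    let ?c = "\<lambda>T. c T - z T"
    have "\<exists>e. (\<forall>T \<in> tier W (Suc (Suc (Suc p))). e T \<in> C i T) \<and>
           (\<forall>T \<in> tier W (Suc (Suc p)). ?c T = kdiff e T)"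
    proof (rule labelled_chains_acyclic)
      show cC: "?c T \<in> C i T" if "T \<in> tier W (Suc (Suc p))" for T
        using that c(1) z(1) kernel_subset[of i T]
        by (intro fun_space.subspace_diff[OF subspace_labelled_chains]) auto
      show "kdiff ?c U = 0" if "U \<in> tier W (Suc p)" for U
        using that z(2) by (simp add: kdiff_diff)
      \<comment> \<open>One position further up every set of the tier is a proper subset of
        \<open>W\<close>, so no component with label \<open>W\<close> exists.\<close>
      show "?c T b = 0" if "T \<in> tier W (Suc (Suc p))" "lb i b = W" for T b
      proof -
        have "\<not> W \<subseteq> T" using that(1) by (auto simp: tier_def)
        then show ?thesis using cC[OF that(1)] that(2) by (auto simp: labelled_chains_def)
      qed
    qed
    then obtain e where e: "\<forall>T \<in> tier W (Suc (Suc (Suc p))). e T \<in> C i T"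
        "\<forall>T \<in> tier W (Suc (Suc p)). ?c T = kdiff e T" by blast
    have "c T - kdiff e T = z T" if "T \<in> tier W (Suc (Suc p))" for T
      using e(2) that by (metis (no_types) diff_diff_eq2 add_diff_cancel_left')
    then show "\<exists>e. (\<forall>T \<in> tier W (Suc (Suc (Suc p))). e T \<in> C i T) \<and>
        (\<forall>T \<in> tier W (Suc (Suc p)). c T - kdiff e T \<in> Z i T)"
      using e(1) z(1) by auto
  qed
qed

lemma lift_kernel:
  assumes "\<forall>T \<in> A. z T \<in> Z i T"
  obtains c where "\<forall>T \<in> A. c T \<in> C (Suc i) T" "\<forall>T \<in> A. D i (c T) = z T"
  using assms unfolding exact image_iff by metis

lemma kernel_Suc_iff: "c \<in> Z (Suc i) T \<longleftrightarrow> c \<in> C (Suc i) T \<and> D i c = 0"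
  by simp

lemma map_in_kernel: "c \<in> C (Suc i) T \<Longrightarrow> D i c \<in> Z i T"
  unfolding exact by blast

text \<open>The matrix \<open>D i\<close> induces an isomorphism from
  \<open>C (Suc i) / Z (Suc i)\<close> to \<open>Z i\<close>, compatible with inclusions of subsets,
  so the two Koszul complexes are exact in the same positions.\<close>

lemma kernel_exact_iff:
  "koszul_exact (Z i) W p \<longleftrightarrow> koszul_quotient_exact (C (Suc i)) (Z (Suc i)) W p"
proof
  assume L: "koszul_exact (Z i) W p"
  show "koszul_quotient_exact (C (Suc i)) (Z (Suc i)) W p"
    unfolding koszul_quotient_exact_def
  proof (intro allI impI)
    fix c assume c: "\<forall>T \<in> tier W (Suc p). c T \<in> C (Suc i) T" "\<forall>U \<in> tier W p. kdiff c U \<in> Z (Suc i) U"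
    have d0: "\<forall>U \<in> tier W p. kdiff (\<lambda>T. D i (c T)) U = 0"
      using c(2) unfolding kdiff_labelled_map kernel_Suc_iff by blast
    have dZ: "\<forall>T \<in> tier W (Suc p). D i (c T) \<in> Z i T"
      using c(1) map_in_kernel by blast
    obtain z where z: "\<forall>T \<in> tier W (Suc (Suc p)). z T \<in> Z i T"
        "\<forall>T \<in> tier W (Suc p). D i (c T) = kdiff z T"
      by (rule koszul_exactE[OF L dZ d0])
    obtain e where e: "\<forall>T \<in> tier W (Suc (Suc p)). e T \<in> C (Suc i) T"
        "\<forall>T \<in> tier W (Suc (Suc p)). D i (e T) = z T"
      using lift_kernel[OF z(1)] .
    have "c T - kdiff e T \<in> Z (Suc i) T" if T: "T \<in> tier W (Suc p)" for T
    proof -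
      have "kdiff e T \<in> C (Suc i) T"
        by (rule kdiff_in[OF T]) (use e(1) subspace_labelled_chains labelled_chains_mono in blast)+
      moreover have "D i (kdiff e T) = kdiff z T"
        unfolding kdiff_labelled_map[symmetric] by (rule kdiff_cong[OF T]) (use e(2) in blast)
      ultimately show ?thesis
        using c(1) z(2) T unfolding kernel_Suc_iff labelled_map_diff
        by (simp add: fun_space.subspace_diff[OF subspace_labelled_chains])
    qed
    then show "\<exists>e. (\<forall>T \<in> tier W (Suc (Suc p)). e T \<in> C (Suc i) T) \<and>
        (\<forall>T \<in> tier W (Suc p). c T - kdiff e T \<in> Z (Suc i) T)"
      using e(1) by blast
  qed
next
  assume R: "koszul_quotient_exact (C (Suc i)) (Z (Suc i)) W p"
  show "koszul_exact (Z i) W p"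
    unfolding koszul_exact_def
  proof (intro allI impI)
    fix z assume z: "\<forall>T \<in> tier W (Suc p). z T \<in> Z i T" "\<forall>U \<in> tier W p. kdiff z U = 0"
    obtain c where c: "\<forall>T \<in> tier W (Suc p). c T \<in> C (Suc i) T"
        "\<forall>T \<in> tier W (Suc p). D i (c T) = z T"
      using lift_kernel[OF z(1)] .
    have "kdiff c U \<in> Z (Suc i) U" if U: "U \<in> tier W p" for U
    proof -
      have "kdiff c U \<in> C (Suc i) U"
        by (rule kdiff_in[OF U]) (use c(1) subspace_labelled_chains labelled_chains_mono in blast)+
      moreover have "D i (kdiff c U) = kdiff z U"
        unfolding kdiff_labelled_map[symmetric] by (rule kdiff_cong[OF U]) (use c(2) in blast)
      ultimately show ?thesis using z(2) U by simp
    qed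
    then obtain e where e: "\<forall>T \<in> tier W (Suc (Suc p)). e T \<in> C (Suc i) T"
        "\<forall>T \<in> tier W (Suc p). c T - kdiff e T \<in> Z (Suc i) T"
      using koszul_quotient_exactE[OF R c(1)] by blast
    have "z T = kdiff (\<lambda>T. D i (e T)) T" if "T \<in> tier W (Suc p)" for T
      using bspec[OF e(2) that] bspec[OF c(2) that]
      unfolding kdiff_labelled_map kernel_Suc_iff labelled_map_diff by simp
    moreover have "\<forall>T \<in> tier W (Suc (Suc p)). D i (e T) \<in> Z i T"
      using e(1) map_in_kernel by blast
    ultimately show "\<exists>e. (\<forall>T \<in> tier W (Suc (Suc p)). e T \<in> Z i T) \<and> (\<forall>T \<in> tier W (Suc p). z T = kdiff e T)"
      by (intro exI[of _ "\<lambda>T. D i (e T)"]) blast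
  qed
qed

text \<open>Position 0 asks whether \<open>C i W\<close> is generated modulo \<open>Z i W\<close> by
  the contributions of the sets \<open>W - {v}\<close>. A basis element with label exactly
  \<open>W\<close> is not: neither the smaller sets nor the kernel have a component there.\<close>

lemma quotient_exact_0_iff:
  "koszul_quotient_exact (C i) (Z i) W 0 \<longleftrightarrow> (\<forall>b<rn i. lb i b \<noteq> W)"
proof
  assume L: "koszul_quotient_exact (C i) (Z i) W 0"
  show "\<forall>b<rn i. lb i b \<noteq> W"
  proof (intro allI impI notI)
    fix b assume b: "b < rn i" "lb i b = W"
    define c :: "'v set \<Rightarrow> nat \<Rightarrow> 'k" where "c T b' = (if b' = b then 1 else 0)" for T b'
    have "c W \<in> C i W" using b by (auto simp: c_def labelled_chains_def)
    then obtain e where e: "\<forall>T \<in> tier W (Suc (Suc 0)). e T \<in> C i T" "c W - kdiff e W \<in> Z i W"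
      using koszul_quotient_exactE[OF L, of "c"] by auto
    have "e (W - {v}) b = 0" if "v \<in> W" for v
    proof -
      have "W - {v} \<in> tier W (Suc (Suc 0))" using tier_remove[of W W "Suc 0" v] that by simp
      then have "e (W - {v}) \<in> C i (W - {v})" using e(1) by blast
      then show ?thesis using b that by (auto simp: labelled_chains_def)
    qed
    then have "kdiff e W b = 0" by (simp add: kdiff_def coboundary_def)
    then show False using kernel_top_zero[OF e(2) b(2)] by (simp add: c_def)
  qed
next
  assume R: "\<forall>b<rn i. lb i b \<noteq> W"
  show "koszul_quotient_exact (C i) (Z i) W 0"
    unfolding koszul_quotient_exact_def
  proof (intro allI impI)
    fix c :: "'v set \<Rightarrow> nat \<Rightarrow> 'k" assume c: "\<forall>T \<in> tier W (Suc 0). c T \<in> C i T"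
    have "c T b = 0" if "T \<in> tier W (Suc 0)" "lb i b = W" for T b
      using bspec[OF c that(1)] R that(2) by (auto simp: labelled_chains_def)
    then obtain e where "\<forall>T \<in> tier W (Suc (Suc 0)). e T \<in> C i T"
        "\<forall>T \<in> tier W (Suc 0). c T = kdiff e T"
      using labelled_chains_acyclic[of W 0 c "rn i" "lb i"] c by auto
    then show "\<exists>e. (\<forall>T \<in> tier W (Suc (Suc 0)). e T \<in> C i T) \<and>
        (\<forall>T \<in> tier W (Suc 0). c T - kdiff e T \<in> Z i T)"
      using fun_space.subspace_0[OF subspace_kernel] by (intro exI[of _ e]) auto
  qed
qed

text \<open>This is the symmetry of Tor: each of the \<open>i\<close> steps down the resolution is
  traded for one Koszul position, until only the Koszul complex of the Stanley-Reisner ring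
  \<open>C 0 / Z 0\<close> is left.\<close>

lemma label_absent_iff:
  "(\<forall>b<rn i. lb i b \<noteq> W) \<longleftrightarrow> koszul_quotient_exact (C 0) (Z 0) W i"
proof -
  have "koszul_quotient_exact (C j) (Z j) W p \<longleftrightarrow> koszul_quotient_exact (C 0) (Z 0) W (p + j)" for j p
  proof (induction j arbitrary: p)
    case (Suc j)
    show ?case
      using Suc.IH[of "Suc p"] unfolding quotient_exact_Suc_iff kernel_exact_iff add_Suc_shift .
  qed simp
  from this[of i 0] show ?thesis using quotient_exact_0_iff by simp
qed

end

section \<open>Existence of multigraded resolutions\<close>

lemma labelled_map_sum:
  "labelled_map r m g = (\<Sum>b<r. (\<lambda>a. g b * m a b))"
  by (simp add: labelled_map_def fun_eq_iff sum_fun_app ac_simps)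

lemma subspace_labelled_image:
  "fun_space.subspace (labelled_map r m ` labelled_chains r l W)"
proof (rule fun_space.subspaceI)
  note s = subspace_labelled_chains[of r l W]
  show "0 \<in> labelled_map r m ` labelled_chains r l W"
    using fun_space.subspace_0[OF s] by (intro image_eqI[of _ _ 0]) auto
  show "x + y \<in> labelled_map r m ` labelled_chains r l W"
    if "x \<in> labelled_map r m ` labelled_chains r l W" "y \<in> labelled_map r m ` labelled_chains r l W" for x y
    using that fun_space.subspace_add[OF s]
    by (elim imageE) (auto simp flip: labelled_map_add intro!: imageI)
  show "(\<lambda>b. a * x b) \<in> labelled_map r m ` labelled_chains r l W"
    if "x \<in> labelled_map r m ` labelled_chains r l W" for a x
    using that fun_space.subspace_scale[OF s]
    by (elim imageE) (auto simp flip: labelled_map_scale intro!: imageI)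
qed

text \<open>\<open>N\<close> consists of the new vectors of a basis of \<open>Z\<close> that extends
  one of \<open>L\<close>. Independence modulo \<open>L\<close> is phrased as non-membership in
  spans, the form in which a relation with a nonzero coefficient is refuted later. The common bound
  \<open>r\<close> on supports makes the basis finite.\<close>

lemma basis_complement:
  fixes Z :: "(nat \<Rightarrow> 'k::field) set"
  assumes Z: "fun_space.subspace Z" "\<And>c b. c \<in> Z \<Longrightarrow> c b \<noteq> 0 \<Longrightarrow> b < r" and L: "fun_space.subspace L" "L \<subseteq> Z"
  shows "\<exists>N. finite N \<and> N \<subseteq> Z \<and> Z \<subseteq> fun_space.span (L \<union> N) \<and>
    (\<forall>n\<in>N. n \<notin> fun_space.span (L \<union> (N - {n})))"
proof -
  obtain U where U: "U \<subseteq> L" "fun_space.independent U" "L \<subseteq> fun_space.span U"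
    by (rule fun_space.basis_exists[of L])
  obtain B where B: "U \<subseteq> B" "B \<subseteq> Z" "fun_space.independent B" "Z \<subseteq> fun_space.span B"
    by (rule fun_space.maximal_independent_subset_extend[of U Z]) (use U L in auto)
  let ?e = "\<lambda>b b'. if b' = b then 1 else 0 :: 'k"
  have "Z \<subseteq> fun_space.span (?e ` {..<r})"
  proof
    fix c assume c: "c \<in> Z"
    have "c = (\<Sum>b<r. (\<lambda>b'. c b * ?e b b'))"
      using Z(2)[OF c] by (auto simp: fun_eq_iff sum_fun_app if_distrib cong: if_cong)
    also have "\<dots> \<in> fun_space.span (?e ` {..<r})"
      by (intro fun_space.span_sum fun_space.span_scale fun_space.span_base) auto
    finally show "c \<in> fun_space.span (?e ` {..<r})" .
  qed
  then have finB: "finite B"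
    using fun_space.independent_span_bound[of "?e ` {..<r}" B] B by auto
  have "Z \<subseteq> fun_space.span (L \<union> (B - U))"
  proof -
    have "B \<subseteq> L \<union> (B - U)" using U(1) by blast
    then show ?thesis using B(4) fun_space.span_mono by blast
  qed
  moreover have "n \<notin> fun_space.span (L \<union> (B - U - {n}))" if n: "n \<in> B - U" for n
  proof
    assume a: "n \<in> fun_space.span (L \<union> (B - U - {n}))"
    have "L \<union> (B - U - {n}) \<subseteq> fun_space.span (B - {n})"
      using U(3) fun_space.span_mono[of U "B - {n}"] fun_space.span_superset[of "B - {n}"] B(1) n by blast
    then have "n \<in> fun_space.span (B - {n})"
      using a fun_space.span_minimal[OF _ fun_space.subspace_span] by blast
    then show False using B(3) n unfolding fun_space.dependent_def by blast
  qed
  ultimately show ?thesis using finB B(2) by (intro exI[of _ "B - U"]) auto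
qed

text \<open>
  A minimal system of generators of the functor \<open>Z\<close>: those with label \<open>W\<close> span a complement in \<open>Z W\<close>
  of the contributions of the proper subsets of \<open>W\<close>.
\<close>

lemma labelled_generators:
  fixes Z :: "'v::finite set \<Rightarrow> (nat \<Rightarrow> 'k::field) set"
  assumes sub: "\<And>W. fun_space.subspace (Z W)" and mono: "\<And>T U. T \<subseteq> U \<Longrightarrow> Z T \<subseteq> Z U"
    and supp: "\<And>W c b. c \<in> Z W \<Longrightarrow> c b \<noteq> 0 \<Longrightarrow> b < r"
  obtains r' :: nat and l' :: "nat \<Rightarrow> 'v set" and m' :: "nat \<Rightarrow> nat \<Rightarrow> 'k" where
    "\<And>W. Z W = labelled_map r' m' ` labelled_chains r' l' W"
    "\<And>W g b. g \<in> labelled_chains r' l' W \<Longrightarrow> labelled_map r' m' g = 0 \<Longrightarrow> l' b = W \<Longrightarrow> g b = 0"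
    "\<And>a b. m' a b \<noteq> 0 \<Longrightarrow> b < r'" "\<And>b. b < r' \<Longrightarrow> (\<lambda>a. m' a b) \<in> Z (l' b)"
proof -
  define L where "L W = fun_space.span (\<Union>T \<in> {T. T \<subset> W}. Z T)" for W
  have L: "L W \<subseteq> Z W" "fun_space.subspace (L W)" for W
    unfolding L_def by (rule fun_space.span_minimal[OF _ sub]) (use mono in blast)+
  have "\<exists>N. \<forall>W. finite (N W) \<and> N W \<subseteq> Z W \<and> Z W \<subseteq> fun_space.span (L W \<union> N W) \<and>
    (\<forall>n\<in>N W. n \<notin> fun_space.span (L W \<union> (N W - {n})))"
    by (rule choice, intro allI basis_complement) (use sub supp L in auto)
  then obtain N where N: "\<And>W. finite (N W)" "\<And>W. N W \<subseteq> Z W" "\<And>W. Z W \<subseteq> fun_space.span (L W \<union> N W)"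
    "\<And>W n. n \<in> N W \<Longrightarrow> n \<notin> fun_space.span (L W \<union> (N W - {n}))" by blast
  \<comment> \<open>One basis element is numbered for each pair of a set \<open>W\<close> and a
    generator in \<open>N W\<close>, since the same vector may be a generator for several
    labels.\<close>
  have "finite (Sigma UNIV N)" using N(1) by auto
  then obtain h where h: "bij_betw h {0..<card (Sigma UNIV N)} (Sigma UNIV N)"
    using ex_bij_betw_nat_finite by blast
  define r' where "r' = card (Sigma UNIV N)"
  define l' where "l' b = fst (h b)" for b
  define m' where "m' a b = (if b < r' then snd (h b) a else 0)" for a b
  have hN: "snd (h b) \<in> N (l' b)" if "b < r'" for b
  proof -
    have "h b \<in> Sigma UNIV N" using bij_betwE[OF h] that by (simp add: r'_def)
    then show ?thesis by (cases "h b") (simp add: l'_def)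
  qed
  have col: "(\<lambda>a. m' a b) = snd (h b)" if "b < r'" for b
    using that by (simp add: m'_def)
  have colZ: "(\<lambda>a. m' a b) \<in> Z (l' b)" if "b < r'" for b
    using hN[OF that] N(2) col[OF that] by auto
  let ?J = "\<lambda>W. labelled_map r' m' ` labelled_chains r' l' W"
  have J_mono: "?J T \<subseteq> ?J U" if "T \<subseteq> U" for T U
    using labelled_chains_mono[OF that] by blast
  have "Z W \<subseteq> ?J W" for W
  proof (induction W rule: finite_psubset_induct[OF finite])
    case (1 W)
    have "(\<Union>T \<in> {T. T \<subset> W}. Z T) \<subseteq> ?J W"
    proof (rule UN_least)
      fix T assume "T \<in> {T. T \<subset> W}"
      then have T: "T \<subset> W" by simp
      show "Z T \<subseteq> ?J W" using "1.IH"[OF T] J_mono[of T W] T by blast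
    qed
    then have "L W \<subseteq> ?J W"
      unfolding L_def by (intro fun_space.span_minimal subspace_labelled_image)
    moreover have "N W \<subseteq> ?J W"
    proof
      fix n assume n: "n \<in> N W"
      then have "(W, n) \<in> h ` {0..<r'}" using h by (auto simp: bij_betw_def r'_def)
      then obtain b where b: "b < r'" "h b = (W, n)" by auto
      let ?g = "\<lambda>b'. if b' = b then 1 else 0 :: 'k"
      have "?g \<in> labelled_chains r' l' W" using b by (auto simp: labelled_chains_def l'_def)
      moreover have "n = labelled_map r' m' ?g"
        using b by (simp add: labelled_map_def m'_def fun_eq_iff if_distrib cong: if_cong)
      ultimately show "n \<in> ?J W" by blast
    qed
    ultimately have "fun_space.span (L W \<union> N W) \<subseteq> ?J W"
      by (intro fun_space.span_minimal subspace_labelled_image) auto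
    then show ?case using N(3)[of W] by blast
  qed
  moreover have "?J W \<subseteq> Z W" for W
  proof
    fix c assume "c \<in> ?J W"
    then obtain g where g: "g \<in> labelled_chains r' l' W" "c = (\<Sum>b<r'. (\<lambda>a. g b * m' a b))"
      unfolding labelled_map_sum by blast
    show "c \<in> Z W"
      unfolding g(2)
    proof (rule fun_space.subspace_sum[OF sub])
      fix b assume b: "b \<in> {..<r'}"
      show "(\<lambda>a. g b * m' a b) \<in> Z W"
      proof (cases "g b = 0")
        case True
        then show ?thesis using fun_space.subspace_0[OF sub] by (simp add: zero_fun_def)
      next
        case False
        then have "l' b \<subseteq> W" using g(1) by (auto simp: labelled_chains_def)
        then have "(\<lambda>a. m' a b) \<in> Z W" using colZ[of b] b mono by auto
        then show ?thesis by (rule fun_space.subspace_scale[OF sub])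
      qed
    qed
  qed
  ultimately have J: "\<And>W. Z W = ?J W" by blast
  \<comment> \<open>If \<open>g b\<close> were nonzero, the relation could be solved for the
    generator numbered \<open>b\<close>; all other columns in it come from proper subsets of
    \<open>W\<close> or are different elements of \<open>N W\<close>.\<close>
  have zero: "g b = 0"
    if g: "g \<in> labelled_chains r' l' W" "labelled_map r' m' g = 0" "l' b = W" for W g b
  proof (rule ccontr)
    assume gb: "g b \<noteq> 0"
    then have b: "b < r'" using g(1) by (auto simp: labelled_chains_def)
    let ?S = "fun_space.span (L W \<union> (N W - {snd (h b)}))"
    have "(\<lambda>a. g b' * m' a b') \<in> ?S" if b': "b' \<in> {..<r'} - {b}" for b'
    proof (cases "g b' = 0")
      case True
      then show ?thesis using fun_space.span_zero by (simp add: zero_fun_def)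
    next
      case False
      then have sub': "l' b' \<subseteq> W" using g(1) by (auto simp: labelled_chains_def)
      have "(\<lambda>a. m' a b') \<in> L W \<union> (N W - {snd (h b)})"
      proof (cases "l' b' = W")
        case True
        have "h b' \<noteq> h b"
          using h b b' inj_on_contraD[of h "{0..<r'}" b' b] by (auto simp: bij_betw_def r'_def)
        then have "snd (h b') \<noteq> snd (h b)" using True g(3) by (auto simp: l'_def prod_eq_iff)
        then show ?thesis using hN[of b'] b' True col[of b'] by auto
      next
        case False
        then have "(\<lambda>a. m' a b') \<in> (\<Union>T \<in> {T. T \<subset> W}. Z T)" using sub' colZ[of b'] b' by blast
        then show ?thesis unfolding L_def by (intro UnI1 fun_space.span_base)
      qed
      then show ?thesis by (intro fun_space.span_scale fun_space.span_base)
    qed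
    then have s1: "(\<Sum>b'\<in>{..<r'} - {b}. (\<lambda>a. g b' * m' a b')) \<in> ?S"
      by (rule fun_space.span_sum)
    have "(\<lambda>a. g b * m' a b) + (\<Sum>b'\<in>{..<r'} - {b}. (\<lambda>a. g b' * m' a b')) = 0"
      using g(2) b unfolding labelled_map_sum by (subst (asm) sum.remove[of _ b]) auto
    then have "(\<lambda>a. g b * m' a b) = - (\<Sum>b'\<in>{..<r'} - {b}. (\<lambda>a. g b' * m' a b'))"
      by (simp only: eq_neg_iff_add_eq_0)
    then have "(\<lambda>a. g b * m' a b) \<in> ?S" using fun_space.span_neg[OF s1] by (simp only:)
    then have "(\<lambda>a. inverse (g b) * (g b * m' a b)) \<in> ?S" by (rule fun_space.span_scale)
    moreover have "(\<lambda>a. inverse (g b) * (g b * m' a b)) = snd (h b)"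
      using gb b by (simp add: m'_def fun_eq_iff)
    ultimately show False using N(4)[of "snd (h b)" W] hN[OF b] g(3) by auto
  qed
  show thesis
    by (rule that[of r' m' l']) (use J zero colZ in \<open>auto simp: m'_def split: if_splits\<close>)
qed

text \<open>
  A stage \<open>(r, l, Z, m)\<close> consists of the labelled basis, the kernels and the incoming matrix.
\<close>

definition stage :: "nat \<times> (nat \<Rightarrow> 'v::finite set) \<times> ('v set \<Rightarrow> (nat \<Rightarrow> 'k::field) set) \<times> (nat \<Rightarrow> nat \<Rightarrow> 'k) \<Rightarrow> bool" where
  "stage s \<longleftrightarrow> (case s of (r, l, Z, m) \<Rightarrow>
     (\<forall>W. fun_space.subspace (Z W)) \<and> (\<forall>T U. T \<subseteq> U \<longrightarrow> Z T \<subseteq> Z U) \<and>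
     (\<forall>W. Z W \<subseteq> labelled_chains r l W) \<and> (\<forall>W. \<forall>c \<in> Z W. \<forall>b. l b = W \<longrightarrow> c b = 0))"

definition stage_step ::
  "nat \<times> (nat \<Rightarrow> 'v::finite set) \<times> ('v set \<Rightarrow> (nat \<Rightarrow> 'k::field) set) \<times> (nat \<Rightarrow> nat \<Rightarrow> 'k) \<Rightarrow>
   nat \<times> (nat \<Rightarrow> 'v set) \<times> ('v set \<Rightarrow> (nat \<Rightarrow> 'k) set) \<times> (nat \<Rightarrow> nat \<Rightarrow> 'k) \<Rightarrow> bool" where
  "stage_step s s' \<longleftrightarrow> (case (s, s') of ((r, l, Z, m), (r', l', Z', m')) \<Rightarrow>
     (\<forall>W. Z W = labelled_map r' m' ` labelled_chains r' l' W) \<and>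
     (\<forall>W. Z' W = {c \<in> labelled_chains r' l' W. labelled_map r' m' c = 0}) \<and>
     (\<forall>a b. m' a b \<noteq> 0 \<longrightarrow> a < r \<and> b < r' \<and> l a \<subset> l' b))"

text \<open>Labels increase strictly because a column with label \<open>l' b\<close> belongs to
  \<open>Z (l' b)\<close>, whose elements vanish at basis elements of that same label by the last
  clause of \<open>stage\<close>. Minimality of the chosen generators restores this clause for the
  next kernel.\<close>

lemma stage_step_exists:
  fixes s :: "nat \<times> (nat \<Rightarrow> 'v::finite set) \<times> ('v set \<Rightarrow> (nat \<Rightarrow> 'k::field) set) \<times> (nat \<Rightarrow> nat \<Rightarrow> 'k)"
  assumes "stage s"
  shows "\<exists>s'. stage s' \<and> stage_step s s'"
proof -
  obtain r l Z m where s: "s = (r, l, Z, m)" by (cases s) auto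
  have sub: "\<And>W. fun_space.subspace (Z W)" and mono: "\<And>T U. T \<subseteq> U \<Longrightarrow> Z T \<subseteq> Z U"
    and C: "\<And>W. Z W \<subseteq> labelled_chains r l W"
    and top: "\<And>W c b. c \<in> Z W \<Longrightarrow> l b = W \<Longrightarrow> c b = 0"
    using assms unfolding stage_def s by auto
  have supp: "b < r" if "c \<in> Z W" "c b \<noteq> 0" for W c b
    using C[of W] that by (auto simp: labelled_chains_def)
  obtain r' l' m' where 1: "\<And>W. Z W = labelled_map r' m' ` labelled_chains r' l' W"
    and 2: "\<And>W g b. g \<in> labelled_chains r' l' W \<Longrightarrow> labelled_map r' m' g = 0 \<Longrightarrow> l' b = W \<Longrightarrow> g b = 0"
    and 3: "\<And>a b. m' a b \<noteq> 0 \<Longrightarrow> b < r'" and 4: "\<And>b. b < r' \<Longrightarrow> (\<lambda>a. m' a b) \<in> Z (l' b)"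
    by (rule labelled_generators[of Z r, OF sub]) (erule mono, erule (1) supp, rule that, assumption+)
  define Z' where "Z' W = {c \<in> labelled_chains r' l' W. labelled_map r' m' c = 0}" for W
  have "a < r \<and> b < r' \<and> l a \<subset> l' b" if "m' a b \<noteq> 0" for a b
  proof -
    have b: "b < r'" using 3 that by blast
    then have Zb: "(\<lambda>a. m' a b) \<in> Z (l' b)" by (rule 4)
    then have "(\<lambda>a. m' a b) \<in> labelled_chains r l (l' b)" using C by blast
    then have "a < r" "l a \<subseteq> l' b" using that by (auto simp: labelled_chains_def)
    moreover have "l a \<noteq> l' b" using top[OF Zb] that by blast
    ultimately show ?thesis using b by blast
  qed
  then have "stage_step s (r', l', Z', m')"
    unfolding stage_step_def s Z'_def using 1 by simp
  moreover have "fun_space.subspace (Z' W)" for W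
  proof (rule fun_space.subspaceI)
    have s: "fun_space.subspace (labelled_chains r' l' W :: (nat \<Rightarrow> 'k) set)"
      by (rule subspace_labelled_chains)
    show "0 \<in> Z' W" using fun_space.subspace_0[OF s] by (simp add: Z'_def)
    show "x + y \<in> Z' W" if "x \<in> Z' W" "y \<in> Z' W" for x y
      using that fun_space.subspace_add[OF s] by (simp add: Z'_def labelled_map_add)
    show "(\<lambda>b. a * x b) \<in> Z' W" if "x \<in> Z' W" for a x
      using that fun_space.subspace_scale[OF s] by (simp add: Z'_def labelled_map_scale fun_eq_iff)
  qed
  moreover have "Z' T \<subseteq> Z' U" if "T \<subseteq> U" for T U
    using labelled_chains_mono[OF that] unfolding Z'_def by blast
  moreover have "c b = 0" if "c \<in> Z' W" "l' b = W" for W c b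
    using 2[of c W b] that by (simp add: Z'_def)
  moreover have "Z' W \<subseteq> labelled_chains r' l' W" for W by (auto simp: Z'_def)
  ultimately have "stage (r', l', Z', m')"
    unfolding stage_def by blast
  then show ?thesis using \<open>stage_step s (r', l', Z', m')\<close> by blast
qed

lemma labelled_resolution_exists:
  fixes \<Delta> :: "'v::{finite, linorder} set set"
  assumes "{} \<in> \<Delta>" and down: "\<And>S T. S \<in> \<Delta> \<Longrightarrow> T \<subseteq> S \<Longrightarrow> T \<in> \<Delta>"
  shows "\<exists>rn lb (mt :: nat \<Rightarrow> nat \<Rightarrow> nat \<Rightarrow> 'k::field). labelled_resolution \<Delta> rn lb mt"
proof -
  define Z0 :: "'v set \<Rightarrow> (nat \<Rightarrow> 'k) set"
    where "Z0 W = {c \<in> labelled_chains 1 (\<lambda>_. {}) W. W \<in> \<Delta> \<longrightarrow> c = 0}" for W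
  \<comment> \<open>The zero matrix is a placeholder, because the incoming matrix of a stage is its
    map to the previous one: \<open>mt i\<close> is read off stage \<open>Suc i\<close>.\<close>
  define s0 where "s0 = (1 :: nat, (\<lambda>_ :: nat. {} :: 'v set), Z0, (\<lambda>_ _. 0) :: nat \<Rightarrow> nat \<Rightarrow> 'k)"
  have "fun_space.subspace (Z0 W)" for W
  proof (rule fun_space.subspaceI)
    have s: "fun_space.subspace (labelled_chains 1 (\<lambda>_. {}) W :: (nat \<Rightarrow> 'k) set)"
      by (rule subspace_labelled_chains)
    show "0 \<in> Z0 W" using fun_space.subspace_0[OF s] by (simp add: Z0_def)
    show "x + y \<in> Z0 W" if "x \<in> Z0 W" "y \<in> Z0 W" for x y
      using that fun_space.subspace_add[OF s] by (simp add: Z0_def)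
    show "(\<lambda>b. a * x b) \<in> Z0 W" if "x \<in> Z0 W" for a x
      using that fun_space.subspace_scale[OF s] by (simp add: Z0_def fun_eq_iff)
  qed
  moreover have "Z0 T \<subseteq> Z0 U" if "T \<subseteq> U" for T U
    using labelled_chains_mono[OF that] down that unfolding Z0_def by blast
  ultimately have "stage s0"
    using assms(1) by (auto simp: stage_def s0_def Z0_def)
  have "\<exists>f. \<forall>n. (stage (f n) \<and> (n = 0 \<longrightarrow> f n = s0)) \<and> stage_step (f n) (f (Suc n))"
    using \<open>stage s0\<close> stage_step_exists
    by (intro dependent_nat_choice[where P="\<lambda>n s. stage s \<and> (n = 0 \<longrightarrow> s = s0)" and Q="\<lambda>_. stage_step"]) blast+
  then obtain f where f: "\<And>n. stage (f n)" "f 0 = s0" "\<And>n. stage_step (f n) (f (Suc n))" by blast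
  define rn where "rn i = fst (f i)" for i
  define lb where "lb i = fst (snd (f i))" for i
  define K where "K i = fst (snd (snd (f i)))" for i
  define mt where "mt i = snd (snd (snd (f (Suc i))))" for i
  have step: "K i W = labelled_map (rn (Suc i)) (mt i) ` labelled_chains (rn (Suc i)) (lb (Suc i)) W"
    "K (Suc i) W = {c \<in> labelled_chains (rn (Suc i)) (lb (Suc i)) W. labelled_map (rn (Suc i)) (mt i) c = 0}"
    "mt i a b \<noteq> 0 \<Longrightarrow> a < rn i \<and> b < rn (Suc i) \<and> lb i a \<subset> lb (Suc i) b" for i W a b
    using f(3)[of i] by (auto simp: stage_step_def K_def rn_def lb_def mt_def split_beta)
  have K: "labelled_kernel \<Delta> rn lb mt i W = K i W" for i W
    by (cases i) (simp_all add: step(2), simp add: K_def rn_def lb_def f(2) s0_def Z0_def)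
  have "labelled_resolution \<Delta> rn lb mt"
  proof
    show "rn 0 = 1" "lb 0 0 = {}" by (simp_all add: rn_def lb_def f(2) s0_def)
  qed (use assms step K in auto)
  then show ?thesis by blast
qed

section \<open>From multigraded data to polynomial matrices\<close>

lemma poly_eq_sum_monomials:
  "p = (\<Sum>s\<in>Poly_Mapping.keys p. Poly_Mapping.single s (Poly_Mapping.lookup p s))"
proof (rule poly_mapping_eqI)
  fix k
  have "(\<Sum>s\<in>Poly_Mapping.keys p. Poly_Mapping.lookup p s when s = k) = Poly_Mapping.lookup p k"
    by (cases "k \<in> Poly_Mapping.keys p")
      (auto simp: when_def in_keys_iff if_distrib cong: if_cong intro!: sum.neutral)
  then show "Poly_Mapping.lookup p k = Poly_Mapping.lookup
      (\<Sum>s\<in>Poly_Mapping.keys p. Poly_Mapping.single s (Poly_Mapping.lookup p s)) k"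
    by (simp add: lookup_sum lookup_single)
qed

text \<open>Divisibility by \<open>t\<close> appears as \<open>\<exists>s. m = t + s\<close>, since
  subtraction of exponents is truncated and \<open>m - t\<close> alone does not detect it.\<close>

lemma lookup_single_times:
  fixes p :: "('v, 'k::comm_ring_1) mpoly"
  shows "Poly_Mapping.lookup (Poly_Mapping.single t c * p) m =
    (if \<exists>s. m = t + s then c * Poly_Mapping.lookup p (m - t) else 0)"
proof -
  have "Poly_Mapping.single t c * p =
      (\<Sum>s\<in>Poly_Mapping.keys p. Poly_Mapping.single (t + s) (c * Poly_Mapping.lookup p s))"
    by (subst (1) poly_eq_sum_monomials[of p]) (simp add: sum_distrib_left mult_single)
  then have l: "Poly_Mapping.lookup (Poly_Mapping.single t c * p) m =
      (\<Sum>s\<in>Poly_Mapping.keys p. c * Poly_Mapping.lookup p s when t + s = m)"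
    by (simp add: lookup_sum lookup_single)
  show ?thesis
  proof (cases "\<exists>s. m = t + s")
    case True
    then obtain s0 where m: "m = t + s0" by blast
    have "(\<Sum>s\<in>Poly_Mapping.keys p. c * Poly_Mapping.lookup p s when t + s = m)
        = c * Poly_Mapping.lookup p s0"
      by (cases "s0 \<in> Poly_Mapping.keys p")
        (auto simp: m when_def in_keys_iff if_distrib cong: if_cong intro!: sum.neutral)
    then show ?thesis unfolding l by (simp add: m)
  next
    case False
    then show ?thesis unfolding l by (auto simp: when_def intro!: sum.neutral)
  qed
qed

definition xmon :: "'v::finite set \<Rightarrow> 'v \<Rightarrow>\<^sub>0 nat" where
  "xmon S = (\<Sum>v\<in>S. Poly_Mapping.single v 1)"

lemma lookup_xmon [simp]: "Poly_Mapping.lookup (xmon S) w = (if w \<in> S then 1 else 0)"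
  by (simp add: xmon_def lookup_sum lookup_single when_def)

lemma keys_xmon [simp]: "Poly_Mapping.keys (xmon S) = S"
  by (auto simp: in_keys_iff split: if_splits)

lemma mon_degree_xmon [simp]: "mon_degree (xmon S) = card S"
  by (simp add: mon_degree_def)

lemma xmon_empty [simp]: "xmon {} = 0"
  by (simp add: xmon_def)

lemma xmon_diff_add: "S \<subseteq> Poly_Mapping.keys m \<Longrightarrow> m - xmon S + xmon S = m"
  by (rule poly_mapping_eqI) (auto simp: lookup_add lookup_minus in_keys_iff Suc_leI)

lemma xmon_diff_split:
  assumes "S \<subseteq> T" "T \<subseteq> Poly_Mapping.keys m"
  shows "m - xmon S = xmon (T - S) + (m - xmon T)"
proof (rule poly_mapping_eqI)
  fix v
  have "Poly_Mapping.lookup m v \<ge> 1" if "v \<in> T" using assms that by (force simp: in_keys_iff)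
  then show "Poly_Mapping.lookup (m - xmon S) v = Poly_Mapping.lookup (xmon (T - S) + (m - xmon T)) v"
    using assms by (auto simp: lookup_add lookup_minus)
qed

lemma single_in_irrelevant_ideal:
  assumes "v \<in> Poly_Mapping.keys t"
  shows "Poly_Mapping.single t c \<in> (irrelevant_ideal :: ('v, 'k::comm_ring_1) mpoly set)"
proof -
  interpret module "(*) :: ('v, 'k) mpoly \<Rightarrow> _" by (rule module_mult)
  have "t = (t - Poly_Mapping.single v 1) + Poly_Mapping.single v 1"
    using assms by (intro poly_mapping_eqI)
      (auto simp: lookup_add lookup_minus lookup_single when_def in_keys_iff Suc_leI)
  then have "Poly_Mapping.single t c = Poly_Mapping.single (t - Poly_Mapping.single v 1) c * Var v"
    by (simp add: Var_def mult_single)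
  then show ?thesis
    unfolding irrelevant_ideal_def ideal_gen_def by (simp add: span_scale span_base)
qed

text \<open>A monomial ideal contains a polynomial exactly when it contains each of its monomials,
  and a monomial is divisible by an edge generator exactly when its support is not a clique of the
  complement. So membership depends on supports only, as the labelled data require.\<close>

lemma in_edge_ideal_iff:
  fixes p :: "('v::finite, 'k::comm_ring_1) mpoly"
  assumes E: "simple_graph E"
  shows "p \<in> edge_ideal E \<longleftrightarrow>
    (\<forall>m \<in> Poly_Mapping.keys p. Poly_Mapping.keys m \<notin> clique_complex (complement_graph E))"
proof
  assume p: "p \<in> edge_ideal E"
  show "\<forall>m \<in> Poly_Mapping.keys p. Poly_Mapping.keys m \<notin> clique_complex (complement_graph E)"
  proof
    fix m assume "m \<in> Poly_Mapping.keys p"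
    then obtain u v where uv: "{u, v} \<in> E" "Poly_Mapping.lookup m u > 0" "Poly_Mapping.lookup m v > 0"
      using keys_edge_ideal[OF p] by blast
    moreover have "u \<noteq> v" using uv(1) E by (auto simp: simple_graph_def)
    ultimately show "Poly_Mapping.keys m \<notin> clique_complex (complement_graph E)"
      by (force simp: clique_complex_def complement_graph_def in_keys_iff)
  qed
next
  interpret module "(*) :: ('v, 'k) mpoly \<Rightarrow> _" by (rule module_mult)
  assume R: "\<forall>m \<in> Poly_Mapping.keys p. Poly_Mapping.keys m \<notin> clique_complex (complement_graph E)"
  have "Poly_Mapping.single m c \<in> (edge_ideal E :: ('v, 'k) mpoly set)" if m: "m \<in> Poly_Mapping.keys p" for m c
  proof -
    obtain u v where uv: "u \<in> Poly_Mapping.keys m" "v \<in> Poly_Mapping.keys m" "u \<noteq> v" "{u, v} \<in> E"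
      using bspec[OF R m] unfolding clique_complex_def complement_graph_def by auto
    let ?s = "Poly_Mapping.single u 1 + Poly_Mapping.single v (1::nat)"
    have "m = (m - ?s) + ?s"
      using uv by (intro poly_mapping_eqI)
        (auto simp: lookup_add lookup_minus lookup_single when_def in_keys_iff Suc_leI)
    then have "Poly_Mapping.single m c = Poly_Mapping.single (m - ?s) c * (Var u * Var v)"
      by (simp add: Var_def mult_single)
    moreover have "Var u * Var v \<in> (edge_ideal E :: ('v, 'k) mpoly set)"
      unfolding edge_ideal_def ideal_gen_def by (rule span_base) (use uv in blast)
    ultimately show ?thesis unfolding edge_ideal_def ideal_gen_def by (simp only: span_scale)
  qed
  then show "p \<in> edge_ideal E"
    unfolding edge_ideal_def ideal_gen_def by (subst poly_eq_sum_monomials) (rule span_sum)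
qed

context labelled_resolution
begin

definition complex :: "('v, 'k) free_complex" where
  "complex = \<lparr>rk = rn, dg = \<lambda>i b. card (lb i b),
     df = \<lambda>i a b. Poly_Mapping.single (xmon (lb (Suc i) b - lb i a)) (mt i a b), aug = \<lambda>b. 1\<rparr>"

lemma complex_simps [simp]:
  "rk complex i = rn i" "dg complex i b = card (lb i b)" "aug complex b = 1"
  "df complex i a b = Poly_Mapping.single (xmon (lb (Suc i) b - lb i a)) (mt i a b)"
  by (simp_all add: complex_def)

text \<open>The component of multidegree \<open>m\<close> of an element of the \<open>i\<close>-th
  module, in coordinates: at \<open>b\<close> stands the coefficient of the monomial
  \<open>m\<close> divided by the label of \<open>b\<close>. The guard excludes truncated
  subtraction.\<close>

definition strand :: "nat \<Rightarrow> (nat \<Rightarrow> ('v, 'k) mpoly) \<Rightarrow> ('v \<Rightarrow>\<^sub>0 nat) \<Rightarrow> nat \<Rightarrow> 'k" where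
  "strand i f m = (\<lambda>b. if b < rn i \<and> lb i b \<subseteq> Poly_Mapping.keys m
     then Poly_Mapping.lookup (f b) (m - xmon (lb i b)) else 0)"

lemma strand_in_chains: "strand i f m \<in> C i (Poly_Mapping.keys m)"
  by (simp add: strand_def labelled_chains_def)

lemma lookup_eq_strand:
  "b < rn i \<Longrightarrow> Poly_Mapping.lookup (f b) t = strand i f (t + xmon (lb i b)) b"
  by (auto simp: strand_def in_keys_iff lookup_add)

lemma strand_eqD:
  assumes "\<And>m. strand i f m = strand i g m" "b < rn i" shows "f b = g b"
  by (rule poly_mapping_eqI) (simp add: lookup_eq_strand[OF assms(2)] assms(1))

lemma strand_apply_df: "strand i (apply_df complex i f) m = D i (strand (Suc i) f m)"
proof
  fix a
  show "strand i (apply_df complex i f) m a = D i (strand (Suc i) f m) a"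
  proof (cases "a < rn i \<and> lb i a \<subseteq> Poly_Mapping.keys m")
    case True
    have "Poly_Mapping.lookup (Poly_Mapping.single (xmon (lb (Suc i) b - lb i a)) (mt i a b) * f b) (m - xmon (lb i a))
        = mt i a b * strand (Suc i) f m b" (is "?l = _") for b
    proof (cases "mt i a b = 0")
      case False
      then have b: "b < rn (Suc i)" "lb i a \<subset> lb (Suc i) b" using mt_nonzero by blast+
      show ?thesis
      proof (cases "lb (Suc i) b \<subseteq> Poly_Mapping.keys m")
        case True
        have e: "m - xmon (lb i a) = xmon (lb (Suc i) b - lb i a) + (m - xmon (lb (Suc i) b))"
          by (rule xmon_diff_split) (use b True in auto)
        show ?thesis unfolding e lookup_single_times using b True by (auto simp: strand_def)
      next
        case False
        then obtain v where v: "v \<in> lb (Suc i) b" "v \<notin> Poly_Mapping.keys m" by blast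
        have "m - xmon (lb i a) \<noteq> xmon (lb (Suc i) b - lb i a) + s" for s
        proof
          assume "m - xmon (lb i a) = xmon (lb (Suc i) b - lb i a) + s"
          then have "Poly_Mapping.lookup (m - xmon (lb i a)) v
              = Poly_Mapping.lookup (xmon (lb (Suc i) b - lb i a) + s) v" by simp
          then show False using v True by (auto simp: lookup_add lookup_minus in_keys_iff split: if_splits)
        qed
        then have "?l = 0" by (simp add: lookup_single_times)
        then show ?thesis using False by (simp add: strand_def)
      qed
    qed simp
    then show ?thesis
      using True by (simp add: strand_def[of i] apply_df_def lookup_sum labelled_map_def)
  next
    case False
    have "mt i a b * strand (Suc i) f m b = 0" for b
      using mt_nonzero[of i a b] False by (auto simp: strand_def)
    then have "D i (strand (Suc i) f m) a = 0"
      unfolding labelled_map_def by (intro sum.neutral) blast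
    then show ?thesis using False by (auto simp: strand_def[of i])
  qed
qed

lemma in_image_iff_strands:
  "(\<exists>g. \<forall>b < rn i. f b = apply_df complex i g b) \<longleftrightarrow> (\<forall>m. strand i f m \<in> Z i (Poly_Mapping.keys m))"
proof
  assume "\<exists>g. \<forall>b < rn i. f b = apply_df complex i g b"
  then obtain g where "\<forall>b < rn i. f b = apply_df complex i g b" by blast
  then have "strand i f m = D i (strand (Suc i) g m)" for m
    unfolding strand_apply_df[symmetric] by (auto simp: strand_def)
  then show "\<forall>m. strand i f m \<in> Z i (Poly_Mapping.keys m)"
    using map_in_kernel strand_in_chains by metis
next
  assume R: "\<forall>m. strand i f m \<in> Z i (Poly_Mapping.keys m)"
  \<comment> \<open>Preimages are chosen independently in every multidegree. Choosing 0 over a zero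
    strand leaves only finitely many nonzero choices, so that they assemble to polynomials.\<close>
  have "\<exists>g \<in> C (Suc i) (Poly_Mapping.keys m). D i g = strand i f m \<and> (strand i f m = 0 \<longrightarrow> g = 0)" for m
  proof (cases "strand i f m = 0")
    case True
    then show ?thesis
      using fun_space.subspace_0[OF subspace_labelled_chains] by (intro bexI[of _ 0]) auto
  next
    case False
    then show ?thesis using R unfolding exact by fastforce
  qed
  then obtain g where g: "\<And>m. g m \<in> C (Suc i) (Poly_Mapping.keys m)"
    "\<And>m. D i (g m) = strand i f m" "\<And>m. strand i f m = 0 \<Longrightarrow> g m = 0" by metis
  have fin: "finite {m. strand i f m \<noteq> 0}"
  proof (rule finite_subset)
    show "{m. strand i f m \<noteq> 0} \<subseteq>
        (\<Union>b<rn i. (\<lambda>t. t + xmon (lb i b)) ` Poly_Mapping.keys (f b))"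
    proof
      fix m assume "m \<in> {m. strand i f m \<noteq> 0}"
      then obtain b where "strand i f m b \<noteq> 0" by (auto simp: fun_eq_iff)
      then have b: "b < rn i" "lb i b \<subseteq> Poly_Mapping.keys m"
        "Poly_Mapping.lookup (f b) (m - xmon (lb i b)) \<noteq> 0"
        by (auto simp: strand_def split: if_splits)
      have "m = (\<lambda>t. t + xmon (lb i b)) (m - xmon (lb i b))"
        using xmon_diff_add[OF b(2)] by simp
      moreover have "m - xmon (lb i b) \<in> Poly_Mapping.keys (f b)" using b by (simp add: in_keys_iff)
      ultimately show "m \<in> (\<Union>b<rn i. (\<lambda>t. t + xmon (lb i b)) ` Poly_Mapping.keys (f b))"
        using b(1) by blast
    qed
  qed auto
  define G where "G b = Abs_poly_mapping (\<lambda>t. g (t + xmon (lb (Suc i) b)) b)" for b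
  have G: "Poly_Mapping.lookup (G b) t = g (t + xmon (lb (Suc i) b)) b" for b t
  proof -
    have "finite {t. g (t + xmon (lb (Suc i) b)) b \<noteq> 0}"
    proof (rule finite_subset)
      show "{t. g (t + xmon (lb (Suc i) b)) b \<noteq> 0} \<subseteq>
          (\<lambda>t. t + xmon (lb (Suc i) b)) -` {m. strand i f m \<noteq> 0}"
        using g(3) by auto
      show "finite ((\<lambda>t. t + xmon (lb (Suc i) b)) -` {m. strand i f m \<noteq> 0})"
        by (rule finite_vimageI[OF fin]) (auto intro: injI)
    qed
    then show ?thesis by (simp add: G_def)
  qed
  have "strand (Suc i) G m = g m" for m
  proof
    fix b
    show "strand (Suc i) G m b = g m b"
    proof (cases "b < rn (Suc i) \<and> lb (Suc i) b \<subseteq> Poly_Mapping.keys m")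
      case True
      then show ?thesis by (simp add: strand_def G xmon_diff_add)
    next
      case False
      then show ?thesis using g(1)[of m] by (auto simp: strand_def labelled_chains_def)
    qed
  qed
  then have "strand i f m = strand i (apply_df complex i G) m" for m
    by (simp add: strand_apply_df g(2))
  then show "\<exists>g. \<forall>b < rn i. f b = apply_df complex i g b"
    using strand_eqD by blast
qed

lemma complex_minimal_graded_free_resolution:
  assumes I: "\<And>p. p \<in> I \<longleftrightarrow> (\<forall>m \<in> Poly_Mapping.keys p. Poly_Mapping.keys m \<notin> \<Delta>)"
  shows "minimal_graded_free_resolution complex I"
  unfolding minimal_graded_free_resolution_def
proof (intro conjI)
  show "graded_complex complex"
    unfolding graded_complex_def
  proof (intro conjI allI impI ballI)
    fix b m assume "b < rk complex 0" "m \<in> Poly_Mapping.keys (aug complex b)"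
    then show "mon_degree m = dg complex 0 b"
      by (simp add: rn_0 lb_0 mon_degree_def)
  next
    fix i a b m
    assume "a < rk complex i" "b < rk complex (Suc i)" and m: "m \<in> Poly_Mapping.keys (df complex i a b)"
    then have "mt i a b \<noteq> 0" "m = xmon (lb (Suc i) b - lb i a)" by (auto split: if_splits)
    moreover from this have "lb i a \<subseteq> lb (Suc i) b" using mt_nonzero by blast
    ultimately show "mon_degree m + dg complex i a = dg complex (Suc i) b"
      by (simp add: card_Diff_subset card_mono)
  qed
  show "minimal_complex complex"
    unfolding minimal_complex_def
  proof (intro allI impI)
    fix i a b
    show "df complex i a b \<in> irrelevant_ideal"
    proof (cases "mt i a b = 0")
      case True
      interpret module "(*) :: ('v, 'k) mpoly \<Rightarrow> _" by (rule module_mult)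
      show ?thesis using True by (simp add: irrelevant_ideal_def ideal_gen_def span_zero)
    next
      case False
      then obtain v where "v \<in> lb (Suc i) b - lb i a" using mt_nonzero by blast
      then show ?thesis by (simp add: single_in_irrelevant_ideal[of v])
    qed
  qed
  show "resolves_quotient complex I"
    unfolding resolves_quotient_def complex_simps
  proof (intro conjI allI)
    fix p
    have "p - apply_aug complex (\<lambda>_. p) \<in> I" by (simp add: apply_aug_def rn_0 I)
    then show "\<exists>f. p - apply_aug complex f \<in> I" by blast
  next
    fix f
    have s: "strand 0 f m = (\<lambda>b. if b = 0 then Poly_Mapping.lookup (f 0) m else 0)" for m
      by (auto simp: strand_def rn_0 lb_0 fun_eq_iff)
    have "apply_aug complex f \<in> I \<longleftrightarrow> (\<forall>m. strand 0 f m \<in> Z 0 (Poly_Mapping.keys m))"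
      using strand_in_chains[of 0 f]
      by (auto simp: apply_aug_def rn_0 I s in_keys_iff fun_eq_iff)
    then show "apply_aug complex f \<in> I \<longleftrightarrow> (\<exists>g. \<forall>a < rn 0. f a = apply_df complex 0 g a)"
      using in_image_iff_strands by blast
  next
    fix i f
    have "(\<forall>a < rn i. apply_df complex i f a = 0) \<longleftrightarrow> (\<forall>m. strand i (apply_df complex i f) m = 0)"
    proof
      assume "\<forall>a < rn i. apply_df complex i f a = 0"
      then show "\<forall>m. strand i (apply_df complex i f) m = 0" by (auto simp: strand_def fun_eq_iff)
    next
      assume a: "\<forall>m. strand i (apply_df complex i f) m = 0"
      have "strand i (apply_df complex i f) m = strand i 0 m" for m
        using a by (auto simp: strand_def fun_eq_iff)
      then show "\<forall>a < rn i. apply_df complex i f a = 0"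
        using strand_eqD[of i "apply_df complex i f" 0] by simp
    qed
    also have "\<dots> \<longleftrightarrow> (\<forall>m. strand (Suc i) f m \<in> Z (Suc i) (Poly_Mapping.keys m))"
      using strand_in_chains by (simp add: strand_apply_df)
    finally show "(\<forall>a < rn i. apply_df complex i f a = 0) \<longleftrightarrow>
        (\<exists>g. \<forall>b < rn (Suc i). f b = apply_df complex (Suc i) g b)"
      unfolding in_image_iff_strands .
  qed
qed

end

section \<open>Uniqueness of graded Betti numbers\<close>

lemma mon_degree_add: "mon_degree (m + t) = mon_degree m + mon_degree (t :: 'v::finite \<Rightarrow>\<^sub>0 nat)"
proof -
  have "mon_degree m = (\<Sum>v\<in>UNIV. Poly_Mapping.lookup m v)" for m :: "'v \<Rightarrow>\<^sub>0 nat"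
    unfolding mon_degree_def by (rule sum.mono_neutral_left) (auto simp: in_keys_iff)
  then show ?thesis by (simp add: lookup_add sum.distrib)
qed

lemma lookup_times_0:
  fixes p q :: "('v, 'k::comm_ring_1) mpoly"
  shows "Poly_Mapping.lookup (p * q) 0 = Poly_Mapping.lookup p 0 * Poly_Mapping.lookup q 0"
proof -
  have z: "0 = t + s \<longleftrightarrow> t = 0 \<and> s = 0" for t s :: "'v \<Rightarrow>\<^sub>0 nat"
    by (auto simp: poly_mapping_eq_iff lookup_add fun_eq_iff)
  have e: "p * q = (\<Sum>s\<in>Poly_Mapping.keys p. Poly_Mapping.single s (Poly_Mapping.lookup p s) * q)"
    by (subst (1) poly_eq_sum_monomials[of p]) (simp add: sum_distrib_right)
  have "Poly_Mapping.lookup (p * q) 0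
      = (\<Sum>s\<in>Poly_Mapping.keys p. if s = 0 then Poly_Mapping.lookup p s * Poly_Mapping.lookup q 0 else 0)"
    unfolding e lookup_sum lookup_single_times z by (intro sum.cong) auto
  then show ?thesis by (cases "0 \<in> Poly_Mapping.keys p") (auto simp: in_keys_iff)
qed

lemma lookup_irrelevant_0:
  fixes p :: "('v, 'k::comm_ring_1) mpoly"
  assumes "p \<in> irrelevant_ideal" shows "Poly_Mapping.lookup p 0 = 0"
proof -
  interpret module "(*) :: ('v, 'k) mpoly \<Rightarrow> _" by (rule module_mult)
  have "Poly_Mapping.lookup (Var v :: ('v, 'k) mpoly) 0 = 0" for v
    unfolding Var_def lookup_single by (metis lookup_single_eq lookup_zero when_def zero_neq_one)
  moreover have "subspace {p :: ('v, 'k) mpoly. Poly_Mapping.lookup p 0 = 0}"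
    by (rule subspaceI) (auto simp: lookup_add lookup_times_0)
  ultimately have "irrelevant_ideal \<subseteq> {p :: ('v, 'k) mpoly. Poly_Mapping.lookup p 0 = 0}"
    unfolding irrelevant_ideal_def ideal_gen_def by (intro span_minimal) auto
  then show ?thesis using assms by blast
qed

definition poly_filter :: "(('v \<Rightarrow>\<^sub>0 nat) \<Rightarrow> bool) \<Rightarrow> ('v, 'k::comm_ring_1) mpoly \<Rightarrow> ('v, 'k) mpoly" where
  "poly_filter P p = Abs_poly_mapping (\<lambda>m. if P m then Poly_Mapping.lookup p m else 0)"

lemma lookup_poly_filter [simp]:
  "Poly_Mapping.lookup (poly_filter P p) m = (if P m then Poly_Mapping.lookup p m else 0)"
proof -
  have "finite {m. (if P m then Poly_Mapping.lookup p m else 0) \<noteq> 0}"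
    by (rule finite_subset[OF _ finite_keys[of p]]) (auto simp: in_keys_iff split: if_splits)
  then show ?thesis by (simp add: poly_filter_def)
qed

lemma keys_poly_filter: "Poly_Mapping.keys (poly_filter P p) = {m \<in> Poly_Mapping.keys p. P m}"
  by (auto simp: in_keys_iff split: if_splits)

lemma poly_filter_diff: "poly_filter P (p - q) = poly_filter P p - poly_filter P q"
  by (rule poly_mapping_eqI) (simp add: lookup_minus)

lemma poly_filter_sum: "poly_filter P (\<Sum>x\<in>A. f x) = (\<Sum>x\<in>A. poly_filter P (f x))"
  by (rule poly_mapping_eqI) (simp add: lookup_sum)

lemma poly_filter_id: "(\<And>m. m \<in> Poly_Mapping.keys p \<Longrightarrow> P m) \<Longrightarrow> poly_filter P p = p"
  by (rule poly_mapping_eqI) (auto simp: in_keys_iff)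

lemma poly_filter_times:
  fixes p q :: "('v, 'k::comm_ring_1) mpoly"
  assumes "\<And>m t. m \<in> Poly_Mapping.keys p \<Longrightarrow> P (m + t) \<longleftrightarrow> Q t"
  shows "poly_filter P (p * q) = p * poly_filter Q q"
proof (rule poly_mapping_eqI)
  fix m
  have *: "p * r = (\<Sum>s\<in>Poly_Mapping.keys p. Poly_Mapping.single s (Poly_Mapping.lookup p s) * r)" for r
    by (subst (1) poly_eq_sum_monomials[of p]) (simp add: sum_distrib_right)
  show "Poly_Mapping.lookup (poly_filter P (p * q)) m = Poly_Mapping.lookup (p * poly_filter Q q) m"
    unfolding * poly_filter_sum lookup_sum
    by (intro sum.cong refl) (auto simp: lookup_single_times assms)
qed

section \<open>Matrices, homogeneous lifting and chain maps between resolutions\<close>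

definition mmul :: "nat \<Rightarrow> (nat \<Rightarrow> nat \<Rightarrow> 'r::comm_ring_1) \<Rightarrow> (nat \<Rightarrow> nat \<Rightarrow> 'r) \<Rightarrow> nat \<Rightarrow> nat \<Rightarrow> 'r" where
  "mmul n A B = (\<lambda>a b. \<Sum>c<n. A a c * B c b)"

lemma mmul_assoc: "mmul n (mmul m A B) C = mmul m A (mmul n B C)"
proof (intro ext)
  fix a b
  have "mmul n (mmul m A B) C a b = (\<Sum>c<n. \<Sum>d<m. A a d * B d c * C c b)"
    by (simp add: mmul_def sum_distrib_right)
  also have "\<dots> = (\<Sum>d<m. \<Sum>c<n. A a d * B d c * C c b)" by (rule sum.swap)
  finally show "mmul n (mmul m A B) C a b = mmul m A (mmul n B C) a b"
    by (simp add: mmul_def sum_distrib_left mult.assoc)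
qed

lemma mmul_cong_left: "(\<And>c. c < n \<Longrightarrow> A a c = A' a c) \<Longrightarrow> mmul n A B a b = mmul n A' B a b"
  by (simp add: mmul_def)

lemma mmul_cong_right: "(\<And>c. c < n \<Longrightarrow> B c b = B' c b) \<Longrightarrow> mmul n A B a b = mmul n A B' a b"
  by (simp add: mmul_def)

lemma mmul_diff_left: "mmul n (\<lambda>a b. A a b - A' a b) B a b = mmul n A B a b - mmul n A' B a b"
  by (simp add: mmul_def left_diff_distrib sum_subtractf)

lemma mmul_diff_right: "mmul n A (\<lambda>a b. B a b - B' a b) a b = mmul n A B a b - mmul n A B' a b"
  by (simp add: mmul_def right_diff_distrib sum_subtractf)

lemma mmul_id_left: "a < n \<Longrightarrow> mmul n (\<lambda>a b. if a = b then 1 else 0) B a b = B a b"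
  by (simp add: mmul_def if_distrib[of "\<lambda>x. x * _"] cong: if_cong)

lemma mmul_id_right: "b < n \<Longrightarrow> mmul n A (\<lambda>a b. if a = b then 1 else 0) a b = A a b"
  by (simp add: mmul_def if_distrib[of "\<lambda>x. _ * x"] cong: if_cong)

lemma apply_df_mmul: "apply_df F i (\<lambda>c. M c b) a = mmul (rk F (Suc i)) (df F i) M a b"
  by (simp add: apply_df_def mmul_def)

definition homogeneous_column ::
  "('v, 'k::comm_ring_1) free_complex \<Rightarrow> nat \<Rightarrow> nat \<Rightarrow> (nat \<Rightarrow> ('v, 'k) mpoly) \<Rightarrow> bool" where
  "homogeneous_column G i d f \<longleftrightarrow>
     (\<forall>a < rk G i. \<forall>m \<in> Poly_Mapping.keys (f a). mon_degree m + dg G i a = d)"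

definition graded_part ::
  "('v, 'k::comm_ring_1) free_complex \<Rightarrow> nat \<Rightarrow> nat \<Rightarrow> (nat \<Rightarrow> ('v, 'k) mpoly) \<Rightarrow> nat \<Rightarrow> ('v, 'k) mpoly" where
  "graded_part G i d f = (\<lambda>a. poly_filter (\<lambda>m. mon_degree m + dg G i a = d) (f a))"

lemma homogeneous_graded_part: "homogeneous_column G i d (graded_part G i d f)"
  by (auto simp: homogeneous_column_def graded_part_def keys_poly_filter)

text \<open>A homogeneous matrix commutes with taking components of a fixed total degree, so the
  degree \<open>d\<close> part of any preimage of a degree \<open>d\<close> column is again a
  preimage.\<close>

lemma homogeneous_preimage:
  fixes G :: "('v::finite, 'k::comm_ring_1) free_complex"
  assumes G: "graded_complex G" and h: "homogeneous_column G i d f"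
    and f: "\<And>a. a < rk G i \<Longrightarrow> f a = apply_df G i g a" and a: "a < rk G i"
  shows "f a = apply_df G i (graded_part G (Suc i) d g) a"
proof -
  have "f a = poly_filter (\<lambda>m. mon_degree m + dg G i a = d) (f a)"
    by (rule poly_filter_id[symmetric]) (use h a in \<open>auto simp: homogeneous_column_def\<close>)
  also have "\<dots> = (\<Sum>b<rk G (Suc i). poly_filter (\<lambda>m. mon_degree m + dg G i a = d) (df G i a b * g b))"
    using f[OF a] by (simp add: apply_df_def poly_filter_sum)
  also have "\<dots> = (\<Sum>b<rk G (Suc i). df G i a b * graded_part G (Suc i) d g b)"
  proof (intro sum.cong refl)
    fix b assume "b \<in> {..<rk G (Suc i)}"
    then have "mon_degree m + dg G i a = dg G (Suc i) b" if "m \<in> Poly_Mapping.keys (df G i a b)" for m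
      using G a that by (auto simp: graded_complex_def)
    then show "poly_filter (\<lambda>m. mon_degree m + dg G i a = d) (df G i a b * g b)
        = df G i a b * graded_part G (Suc i) d g b"
      unfolding graded_part_def by (intro poly_filter_times) (auto simp: mon_degree_add)
  qed
  finally show ?thesis by (simp add: apply_df_def)
qed

text \<open>Closure under every monomial filter says that the ideal is spanned by monomials. It
  allows passing to components of one degree: a lift modulo \<open>I\<close> can be made homogeneous
  without leaving \<open>I\<close>.\<close>

locale monomial_ideal =
  fixes I :: "('v::finite, 'k::comm_ring_1) mpoly set"
  assumes zero_closed: "0 \<in> I" and diff_closed: "p \<in> I \<Longrightarrow> q \<in> I \<Longrightarrow> p - q \<in> I"
    and mult_closed: "p \<in> I \<Longrightarrow> q * p \<in> I" and filter_closed: "p \<in> I \<Longrightarrow> poly_filter P p \<in> I"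
begin

lemma add_closed: "p \<in> I \<Longrightarrow> q \<in> I \<Longrightarrow> p + q \<in> I"
  using diff_closed[of p "0 - q"] diff_closed[of 0 q] zero_closed by simp

lemma sum_closed: "(\<And>x. x \<in> A \<Longrightarrow> f x \<in> I) \<Longrightarrow> sum f A \<in> I"
  by (induction A rule: infinite_finite_induct) (auto simp: zero_closed add_closed)

lemma aug_exact:
  "resolves_quotient F I \<Longrightarrow>
    apply_aug F f \<in> I \<longleftrightarrow> (\<exists>g. \<forall>a < rk F 0. f a = apply_df F 0 g a)"
  unfolding resolves_quotient_def by blast

lemma df_exact:
  "resolves_quotient F I \<Longrightarrow> (\<forall>a < rk F i. apply_df F i f a = 0) \<longleftrightarrow>
    (\<exists>g. \<forall>b < rk F (Suc i). f b = apply_df F (Suc i) g b)"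
  unfolding resolves_quotient_def by blast

lemma df_df:
  assumes "resolves_quotient F I" "a < rk F i" "b < rk F (Suc (Suc i))"
  shows "mmul (rk F (Suc i)) (df F i) (df F (Suc i)) a b = 0"
proof -
  let ?e = "\<lambda>b'. if b' = b then 1 else 0"
  have "apply_df F i (apply_df F (Suc i) ?e) a = 0"
    using assms(2) df_exact[OF assms(1), of i "apply_df F (Suc i) ?e"] by blast
  moreover have "apply_df F (Suc i) ?e = (\<lambda>c. df F (Suc i) c b)"
    using assms(3) by (simp add: apply_df_def if_distrib cong: if_cong)
  ultimately show ?thesis unfolding apply_df_mmul[symmetric] by simp
qed

lemma aug_df:
  assumes "resolves_quotient F I" "b < rk F 1"
  shows "apply_aug F (\<lambda>c. df F 0 c b) \<in> I"
proof -
  let ?e = "\<lambda>b'. if b' = b then 1 else 0"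
  have "apply_aug F (apply_df F 0 ?e) \<in> I"
    using aug_exact[OF assms(1), of "apply_df F 0 ?e"] by blast
  moreover have "apply_df F 0 ?e = (\<lambda>c. df F 0 c b)"
    using assms(2) by (simp add: apply_df_def if_distrib cong: if_cong)
  ultimately show ?thesis by simp
qed

lemma apply_aug_mmul:
  "apply_aug G (\<lambda>a. mmul n M N a b) = (\<Sum>c<n. apply_aug G (\<lambda>a. M a c) * N c b)"
proof -
  have "apply_aug G (\<lambda>a. mmul n M N a b) = (\<Sum>a<rk G 0. \<Sum>c<n. aug G a * M a c * N c b)"
    by (simp add: apply_aug_def mmul_def sum_distrib_left mult.assoc)
  also have "\<dots> = (\<Sum>c<n. \<Sum>a<rk G 0. aug G a * M a c * N c b)" by (rule sum.swap)
  finally show ?thesis by (simp add: apply_aug_def sum_distrib_right)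
qed

lemma apply_aug_mmul_closed:
  assumes "\<And>c. c < n \<Longrightarrow> v c - apply_aug G (\<lambda>a. M a c) \<in> I"
  shows "(\<Sum>c<n. v c * N c b) - apply_aug G (\<lambda>a. mmul n M N a b) \<in> I"
proof -
  have "(\<Sum>c<n. v c * N c b) - apply_aug G (\<lambda>a. mmul n M N a b)
      = (\<Sum>c<n. N c b * (v c - apply_aug G (\<lambda>a. M a c)))"
    unfolding apply_aug_mmul by (simp add: sum_subtractf algebra_simps)
  also have "\<dots> \<in> I" by (intro sum_closed mult_closed assms) auto
  finally show ?thesis .
qed

definition chain_map ::
  "('v, 'k) free_complex \<Rightarrow> ('v, 'k) free_complex \<Rightarrow> (nat \<Rightarrow> nat \<Rightarrow> nat \<Rightarrow> ('v, 'k) mpoly) \<Rightarrow> bool" where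
  "chain_map F G \<phi> \<longleftrightarrow>
     (\<forall>b < rk F 0. aug F b - apply_aug G (\<lambda>a. \<phi> 0 a b) \<in> I) \<and>
     (\<forall>i. \<forall>b < rk F (Suc i). \<forall>a < rk G i.
        mmul (rk G (Suc i)) (df G i) (\<phi> (Suc i)) a b = mmul (rk F i) (\<phi> i) (df F i) a b) \<and>
     (\<forall>i. \<forall>b < rk F i. homogeneous_column G i (dg F i b) (\<lambda>a. \<phi> i a b))"

text \<open>The comparison theorem for the identity of \<open>R / I\<close>. Components are chosen
  one degree at a time and a choice may depend only on the one before; \<open>liftable\<close>
  states in terms of the current component alone that the next square can be filled.\<close>

lemma chain_map_exists:
  assumes F: "graded_complex F" "resolves_quotient F I" and G: "graded_complex G" "resolves_quotient G I"
  shows "\<exists>\<phi>. chain_map F G \<phi>"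
proof -
  define hom where "hom i M \<longleftrightarrow> (\<forall>b < rk F i. homogeneous_column G i (dg F i b) (\<lambda>a. M a b))"
    for i and M :: "nat \<Rightarrow> nat \<Rightarrow> ('v, 'k) mpoly"
  define liftable where "liftable i M \<longleftrightarrow>
    (\<forall>b < rk F (Suc i). \<exists>g. \<forall>a < rk G i. mmul (rk F i) M (df F i) a b = apply_df G i g a)"
    for i and M :: "nat \<Rightarrow> nat \<Rightarrow> ('v, 'k) mpoly"
  define commutes where "commutes i M M' \<longleftrightarrow> (\<forall>b < rk F (Suc i). \<forall>a < rk G i.
    mmul (rk G (Suc i)) (df G i) M' a b = mmul (rk F i) M (df F i) a b)"
    for i and M M' :: "nat \<Rightarrow> nat \<Rightarrow> ('v, 'k) mpoly"
  define start where "start M \<longleftrightarrow> (\<forall>b < rk F 0. aug F b - apply_aug G (\<lambda>a. M a b) \<in> I)"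
    for M :: "nat \<Rightarrow> nat \<Rightarrow> ('v, 'k) mpoly"
  have "\<exists>M. hom 0 M \<and> liftable 0 M \<and> start M"
  proof -
    have "\<exists>f. aug F b - apply_aug G f \<in> I" for b
      using G(2) by (simp add: resolves_quotient_def)
    then obtain f where f: "\<And>b. aug F b - apply_aug G (f b) \<in> I" by metis
    define M where "M a b = graded_part G 0 (dg F 0 b) (f b) a" for a b
    have "hom 0 M"
      by (simp add: hom_def M_def homogeneous_graded_part)
    moreover have "start M"
      unfolding start_def
    proof (intro allI impI)
      fix b assume b: "b < rk F 0"
      let ?P = "\<lambda>m. mon_degree m = dg F 0 b"
      have "poly_filter ?P (aug F b) = aug F b"
        by (rule poly_filter_id) (use F(1) b in \<open>auto simp: graded_complex_def\<close>)
      moreover have "poly_filter ?P (apply_aug G (f b)) = apply_aug G (\<lambda>a. M a b)"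
        unfolding apply_aug_def poly_filter_sum
      proof (intro sum.cong refl)
        fix a assume "a \<in> {..<rk G 0}"
        then have "mon_degree m = dg G 0 a" if "m \<in> Poly_Mapping.keys (aug G a)" for m
          using G(1) that by (auto simp: graded_complex_def)
        then show "poly_filter ?P (aug G a * f b a) = aug G a * M a b"
          unfolding M_def graded_part_def by (intro poly_filter_times) (auto simp: mon_degree_add)
      qed
      ultimately have "aug F b - apply_aug G (\<lambda>a. M a b) = poly_filter ?P (aug F b - apply_aug G (f b))"
        by (simp add: poly_filter_diff)
      then show "aug F b - apply_aug G (\<lambda>a. M a b) \<in> I" using filter_closed[OF f] by simp
    qed
    moreover have "liftable 0 M"
      unfolding liftable_def
    proof (intro allI impI)
      fix b assume b: "b < rk F (Suc 0)"
      have "(\<Sum>c<rk F 0. aug F c * df F 0 c b) - apply_aug G (\<lambda>a. mmul (rk F 0) M (df F 0) a b) \<in> I"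
        by (rule apply_aug_mmul_closed) (use \<open>start M\<close> in \<open>auto simp: start_def\<close>)
      moreover have "(\<Sum>c<rk F 0. aug F c * df F 0 c b) \<in> I"
        using aug_df[OF F(2), of b] b by (simp add: apply_aug_def)
      ultimately have "apply_aug G (\<lambda>a. mmul (rk F 0) M (df F 0) a b) \<in> I"
        using diff_closed by fastforce
      then show "\<exists>g. \<forall>a < rk G 0. mmul (rk F 0) M (df F 0) a b = apply_df G 0 g a"
        using aug_exact[OF G(2), of "\<lambda>a. mmul (rk F 0) M (df F 0) a b"] by simp
    qed
    ultimately show ?thesis by blast
  qed
  moreover have "\<exists>M'. (hom (Suc i) M' \<and> liftable (Suc i) M') \<and> commutes i M M'"
    if M: "hom i M" "liftable i M" for i M
  proof -
    obtain g where g: "\<And>b a. b < rk F (Suc i) \<Longrightarrow> a < rk G i \<Longrightarrow>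
        mmul (rk F i) M (df F i) a b = apply_df G i (g b) a"
      using M(2) unfolding liftable_def by metis
    define M' where "M' a b = graded_part G (Suc i) (dg F (Suc i) b) (g b) a" for a b
    have "hom (Suc i) M'"
      by (simp add: hom_def M'_def homogeneous_graded_part)
    moreover have com: "commutes i M M'"
      unfolding commutes_def
    proof (intro allI impI)
      fix b a assume b: "b < rk F (Suc i)" and a: "a < rk G i"
      have "homogeneous_column G i (dg F (Suc i) b) (\<lambda>a. mmul (rk F i) M (df F i) a b)"
        unfolding homogeneous_column_def
      proof (intro allI impI ballI)
        fix a m assume a: "a < rk G i" and m: "m \<in> Poly_Mapping.keys (mmul (rk F i) M (df F i) a b)"
        then obtain c where c: "c < rk F i" "m \<in> Poly_Mapping.keys (M a c * df F i c b)"
          using keys_sum[of "\<lambda>c. M a c * df F i c b" "{..<rk F i}"] unfolding mmul_def by blast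
        then obtain s t where st: "m = s + t" "s \<in> Poly_Mapping.keys (M a c)" "t \<in> Poly_Mapping.keys (df F i c b)"
          using keys_mult by blast
        have "mon_degree s + dg G i a = dg F i c"
          using M(1) c(1) a st(2) by (auto simp: hom_def homogeneous_column_def)
        moreover have "mon_degree t + dg F i c = dg F (Suc i) b"
          using F(1) b c(1) st(3) by (auto simp: graded_complex_def)
        ultimately show "mon_degree m + dg G i a = dg F (Suc i) b" by (simp add: st(1) mon_degree_add)
      qed
      from homogeneous_preimage[OF G(1) this, of "g b"] g[OF b] a
      show "mmul (rk G (Suc i)) (df G i) M' a b = mmul (rk F i) M (df F i) a b"
        unfolding apply_df_mmul[symmetric] by (simp add: M'_def)
    qed
    moreover have "liftable (Suc i) M'"
      unfolding liftable_def
    proof (intro allI impI)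
      fix b assume b: "b < rk F (Suc (Suc i))"
      have "apply_df G i (\<lambda>c. mmul (rk F (Suc i)) M' (df F (Suc i)) c b) a = 0" if a: "a < rk G i" for a
      proof -
        have "apply_df G i (\<lambda>c. mmul (rk F (Suc i)) M' (df F (Suc i)) c b) a
            = mmul (rk F (Suc i)) (mmul (rk G (Suc i)) (df G i) M') (df F (Suc i)) a b"
          by (simp add: apply_df_mmul mmul_assoc)
        also have "\<dots> = mmul (rk F (Suc i)) (mmul (rk F i) M (df F i)) (df F (Suc i)) a b"
          by (rule mmul_cong_left) (use com a in \<open>auto simp: commutes_def\<close>)
        also have "\<dots> = mmul (rk F i) M (mmul (rk F (Suc i)) (df F i) (df F (Suc i))) a b"
          by (simp add: mmul_assoc)
        also have "\<dots> = 0" using df_df[OF F(2) _ b] by (simp add: mmul_def[of _ M])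
        finally show ?thesis .
      qed
      then show "\<exists>g. \<forall>a < rk G (Suc i). mmul (rk F (Suc i)) M' (df F (Suc i)) a b = apply_df G (Suc i) g a"
        using df_exact[OF G(2), of i "\<lambda>a. mmul (rk F (Suc i)) M' (df F (Suc i)) a b"] by simp
    qed
    ultimately show ?thesis by blast
  qed
  ultimately have "\<exists>\<phi>. \<forall>i. ((hom i (\<phi> i) \<and> liftable i (\<phi> i)) \<and> (i = 0 \<longrightarrow> start (\<phi> i))) \<and>
      commutes i (\<phi> i) (\<phi> (Suc i))"
    by (intro dependent_nat_choice[where P="\<lambda>i M. (hom i M \<and> liftable i M) \<and> (i = 0 \<longrightarrow> start M)"]) blast+
  then obtain \<phi> where \<phi>: "\<And>i. hom i (\<phi> i)" "start (\<phi> 0)" "\<And>i. commutes i (\<phi> i) (\<phi> (Suc i))"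
    by blast
  have "chain_map F G \<phi>"
    unfolding chain_map_def
    using \<phi>(1)[unfolded hom_def] \<phi>(2)[unfolded start_def] \<phi>(3)[unfolded commutes_def] by simp
  then show ?thesis by blast
qed

text \<open>\<open>X\<close> is an endomorphism of a minimal resolution inducing zero on
  \<open>R / I\<close>, hence null-homotopic: \<open>X = d h + h d\<close>. The entries of
  \<open>d\<close> lie in the irrelevant ideal, so all constant terms of \<open>X\<close>
  vanish.\<close>

lemma null_homotopic_constant_term:
  assumes F: "minimal_graded_free_resolution F I"
    and X0: "\<And>b. b < rk F 0 \<Longrightarrow> apply_aug F (\<lambda>a. X 0 a b) \<in> I"
    and X: "\<And>i a b. a < rk F i \<Longrightarrow> b < rk F (Suc i) \<Longrightarrow>
      mmul (rk F (Suc i)) (df F i) (X (Suc i)) a b = mmul (rk F i) (X i) (df F i) a b"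
    and ab: "a < rk F i" "b < rk F i"
  shows "Poly_Mapping.lookup (X i a b) 0 = 0"
proof -
  note res = F[unfolded minimal_graded_free_resolution_def, THEN conjunct2, THEN conjunct1]
  \<comment> \<open>In view of \<open>d X = X d\<close>, this says that
    \<open>X (Suc i) - h d\<close> is annihilated by \<open>d\<close>, which is what exactness needs
    to produce the next \<open>h\<close>.\<close>
  define good where "good i h \<longleftrightarrow> (\<forall>b < rk F (Suc i). \<forall>a < rk F i.
      mmul (rk F i) (mmul (rk F (Suc i)) (df F i) h) (df F i) a b = mmul (rk F i) (X i) (df F i) a b)"
    for i and h :: "nat \<Rightarrow> nat \<Rightarrow> ('v, 'k) mpoly"
  define start where "start h \<longleftrightarrow> (\<forall>b < rk F 0. \<forall>a < rk F 0.
      mmul (rk F (Suc 0)) (df F 0) h a b = X 0 a b)"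
    for h :: "nat \<Rightarrow> nat \<Rightarrow> ('v, 'k) mpoly"
  define step where "step i h h' \<longleftrightarrow> (\<forall>b < rk F (Suc i). \<forall>a < rk F (Suc i).
      mmul (rk F (Suc (Suc i))) (df F (Suc i)) h' a b = X (Suc i) a b - mmul (rk F i) h (df F i) a b)"
    for i and h h' :: "nat \<Rightarrow> nat \<Rightarrow> ('v, 'k) mpoly"
  have "\<exists>h. good 0 h \<and> start h"
  proof -
    have "\<exists>g. \<forall>a < rk F 0. X 0 a b = apply_df F 0 g a" if "b < rk F 0" for b
      using X0[OF that] aug_exact[OF res, of "\<lambda>a. X 0 a b"] by simp
    then obtain g where g: "\<And>a b. b < rk F 0 \<Longrightarrow> a < rk F 0 \<Longrightarrow> X 0 a b = apply_df F 0 (g b) a" by metis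
    define h where "h a b = g b a" for a b
    have "start h" unfolding start_def apply_df_mmul[symmetric] by (simp add: h_def g)
    moreover from this have "good 0 h"
      unfolding good_def by (intro allI impI mmul_cong_left) (auto simp: start_def)
    ultimately show ?thesis by blast
  qed
  moreover have "\<exists>h'. good (Suc i) h' \<and> step i h h'" if h: "good i h" for i h
  proof -
    let ?Y = "\<lambda>a b. X (Suc i) a b - mmul (rk F i) h (df F i) a b"
    have "\<exists>g. \<forall>a < rk F (Suc i). ?Y a b = apply_df F (Suc i) g a" if b: "b < rk F (Suc i)" for b
    proof -
      have "apply_df F i (\<lambda>c. ?Y c b) a = 0" if a: "a < rk F i" for a
      proof -
        have "apply_df F i (\<lambda>c. ?Y c b) a = mmul (rk F (Suc i)) (df F i) ?Y a b"
          using apply_df_mmul[of F i ?Y b a] by simp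
        also have "\<dots> = mmul (rk F (Suc i)) (df F i) (X (Suc i)) a b
            - mmul (rk F i) (mmul (rk F (Suc i)) (df F i) h) (df F i) a b"
          unfolding mmul_diff_right mmul_assoc ..
        also have "\<dots> = 0" using h a b X[OF a b] by (simp add: good_def)
        finally show ?thesis .
      qed
      then show ?thesis using df_exact[OF res, of i "\<lambda>c. ?Y c b"] by simp
    qed
    then obtain g where g: "\<And>a b. b < rk F (Suc i) \<Longrightarrow> a < rk F (Suc i) \<Longrightarrow> ?Y a b = apply_df F (Suc i) (g b) a"
      by metis
    define h' where "h' a b = g b a" for a b
    have st: "step i h h'" unfolding step_def apply_df_mmul[symmetric] by (simp add: h'_def g)
    moreover have "good (Suc i) h'"
      unfolding good_def
    proof (intro allI impI)
      fix b a assume b: "b < rk F (Suc (Suc i))" and a: "a < rk F (Suc i)"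
      have "mmul (rk F (Suc i)) (mmul (rk F (Suc (Suc i))) (df F (Suc i)) h') (df F (Suc i)) a b
          = mmul (rk F (Suc i)) ?Y (df F (Suc i)) a b"
        by (rule mmul_cong_left) (use st a in \<open>auto simp: step_def\<close>)
      also have "\<dots> = mmul (rk F (Suc i)) (X (Suc i)) (df F (Suc i)) a b
          - mmul (rk F i) h (mmul (rk F (Suc i)) (df F i) (df F (Suc i))) a b"
        by (simp add: mmul_diff_left mmul_assoc)
      also have "mmul (rk F i) h (mmul (rk F (Suc i)) (df F i) (df F (Suc i))) a b = 0"
        using df_df[OF res _ b] by (simp add: mmul_def[of _ h])
      finally show "mmul (rk F (Suc i)) (mmul (rk F (Suc (Suc i))) (df F (Suc i)) h') (df F (Suc i)) a b
          = mmul (rk F (Suc i)) (X (Suc i)) (df F (Suc i)) a b" by simp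
    qed
    ultimately show ?thesis by blast
  qed
  ultimately have "\<exists>h. \<forall>i. (good i (h i) \<and> (i = 0 \<longrightarrow> start (h i))) \<and> step i (h i) (h (Suc i))"
    by (intro dependent_nat_choice[where P="\<lambda>i h. good i h \<and> (i = 0 \<longrightarrow> start h)"]) blast+
  then obtain h where h: "start (h 0)" "\<And>i. step i (h i) (h (Suc i))" by blast
  have df0: "Poly_Mapping.lookup (df F i a b) 0 = 0" if "a < rk F i" "b < rk F (Suc i)" for i a b
    using F that lookup_irrelevant_0
    unfolding minimal_graded_free_resolution_def minimal_complex_def by blast
  have m0: "Poly_Mapping.lookup (mmul (rk F (Suc i)) (df F i) M a b) 0 = 0" if "a < rk F i" for i M a b
    using df0 that by (simp add: mmul_def lookup_sum lookup_times_0)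
  show ?thesis
  proof (cases i)
    case 0
    then have "X i a b = mmul (rk F (Suc 0)) (df F 0) (h 0) a b"
      using h(1) ab by (simp add: start_def)
    then show ?thesis using m0[of a 0] ab 0 by simp
  next
    case (Suc j)
    have "X i a b = mmul (rk F (Suc i)) (df F i) (h i) a b + mmul (rk F j) (h j) (df F j) a b"
      using h(2)[of j] ab Suc by (simp add: step_def)
    moreover have "Poly_Mapping.lookup (mmul (rk F j) (h j) (df F j) a b) 0 = 0"
      using df0[of _ j b] ab Suc by (simp add: mmul_def lookup_sum lookup_times_0)
    ultimately show ?thesis using m0[of a i] ab by (simp add: lookup_add)
  qed
qed

text \<open>The difference of the composite and the identity induces zero on \<open>R / I\<close>,
  so its matrix has no constant terms. Only diagonal entries are kept, because traces suffice to
  compare ranks.\<close>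

lemma chain_map_composite:
  assumes F: "minimal_graded_free_resolution F I"
    and \<phi>: "chain_map F G \<phi>" and \<psi>: "chain_map G F \<psi>" and b: "b < rk F i"
  shows "(\<Sum>a<rk G i. Poly_Mapping.lookup (\<psi> i b a) 0 * Poly_Mapping.lookup (\<phi> i a b) 0) = 1"
proof -
  let ?id = "\<lambda>a b. if a = b then 1 else 0 :: ('v, 'k) mpoly"
  define X where "X i a b = mmul (rk G i) (\<psi> i) (\<phi> i) a b - ?id a b" for i a b
  have "Poly_Mapping.lookup (X i b b) 0 = 0"
  proof (rule null_homotopic_constant_term[where X=X, OF F _ _ b b])
    fix b assume b: "b < rk F 0"
    have "(\<Sum>c<rk G 0. aug G c * \<phi> 0 c b) - apply_aug F (\<lambda>a. mmul (rk G 0) (\<psi> 0) (\<phi> 0) a b) \<in> I"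
      by (rule apply_aug_mmul_closed) (use \<psi> in \<open>auto simp: chain_map_def\<close>)
    moreover have "aug F b - (\<Sum>c<rk G 0. aug G c * \<phi> 0 c b) \<in> I"
      using \<phi> b by (auto simp: chain_map_def apply_aug_def)
    ultimately have "aug F b - apply_aug F (\<lambda>a. mmul (rk G 0) (\<psi> 0) (\<phi> 0) a b) \<in> I"
      using add_closed by fastforce
    moreover have "apply_aug F (\<lambda>a. ?id a b) = aug F b"
      using b by (simp add: apply_aug_def if_distrib cong: if_cong)
    moreover have "apply_aug F (\<lambda>a. X 0 a b)
        = apply_aug F (\<lambda>a. mmul (rk G 0) (\<psi> 0) (\<phi> 0) a b) - apply_aug F (\<lambda>a. ?id a b)"
      by (simp add: apply_aug_def X_def right_diff_distrib sum_subtractf)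
    ultimately show "apply_aug F (\<lambda>a. X 0 a b) \<in> I"
      using diff_closed[OF zero_closed] by fastforce
  next
    fix i a b assume a: "a < rk F i" and b: "b < rk F (Suc i)"
    have "mmul (rk F (Suc i)) (df F i) (mmul (rk G (Suc i)) (\<psi> (Suc i)) (\<phi> (Suc i))) a b
        = mmul (rk G (Suc i)) (mmul (rk F (Suc i)) (df F i) (\<psi> (Suc i))) (\<phi> (Suc i)) a b"
      by (simp add: mmul_assoc)
    also have "\<dots> = mmul (rk G (Suc i)) (mmul (rk G i) (\<psi> i) (df G i)) (\<phi> (Suc i)) a b"
      by (rule mmul_cong_left) (use \<psi> a in \<open>auto simp: chain_map_def\<close>)
    also have "\<dots> = mmul (rk G i) (\<psi> i) (mmul (rk G (Suc i)) (df G i) (\<phi> (Suc i))) a b"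
      by (simp add: mmul_assoc)
    also have "\<dots> = mmul (rk G i) (\<psi> i) (mmul (rk F i) (\<phi> i) (df F i)) a b"
      by (rule mmul_cong_right) (use \<phi> b in \<open>auto simp: chain_map_def\<close>)
    also have "\<dots> = mmul (rk F i) (mmul (rk G i) (\<psi> i) (\<phi> i)) (df F i) a b"
      by (simp add: mmul_assoc)
    finally show "mmul (rk F (Suc i)) (df F i) (X (Suc i)) a b = mmul (rk F i) (X i) (df F i) a b"
      unfolding X_def mmul_diff_left mmul_diff_right
      using a b by (simp add: mmul_id_left mmul_id_right)
  qed
  then show ?thesis
    by (simp add: X_def lookup_minus mmul_def lookup_sum lookup_times_0)
qed

end

text \<open>
  Modulo the variables, mutually inverse homotopy equivalences become mutually inverse matrices, so both
  ranks are the trace of the same product; here characteristic zero is convenient.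
\<close>

lemma minimal_resolution_rank_unique:
  fixes I :: "('v::finite, 'k::field_char_0) mpoly set"
  assumes "monomial_ideal I"
    and F: "minimal_graded_free_resolution F I" and G: "minimal_graded_free_resolution G I"
  shows "card {b. b < rk F i \<and> dg F i b = j} = card {b. b < rk G i \<and> dg G i b = j}"
proof -
  interpret monomial_ideal I by fact
  obtain \<phi> \<psi> where \<phi>: "chain_map F G \<phi>" and \<psi>: "chain_map G F \<psi>"
    using chain_map_exists F G unfolding minimal_graded_free_resolution_def by meson
  let ?p = "\<lambda>a b. Poly_Mapping.lookup (\<phi> i a b) 0" and ?q = "\<lambda>b a. Poly_Mapping.lookup (\<psi> i b a) 0"
  let ?B = "{b. b < rk F i \<and> dg F i b = j}" and ?A = "{a. a < rk G i \<and> dg G i a = j}"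
  \<comment> \<open>Homogeneity allows a nonzero constant entry only between basis elements of equal
    degree, so the constant parts are block matrices and each degree can be compared
    separately.\<close>
  have p: "dg G i a = dg F i b" if "a < rk G i" "b < rk F i" "?p a b \<noteq> 0" for a b
  proof -
    have "homogeneous_column G i (dg F i b) (\<lambda>a. \<phi> i a b)"
      using \<phi> that(2) unfolding chain_map_def by blast
    then have "mon_degree (0 :: 'v \<Rightarrow>\<^sub>0 nat) + dg G i a = dg F i b"
      using that(1,3) unfolding homogeneous_column_def by (simp add: in_keys_iff)
    then show ?thesis by (simp add: mon_degree_def)
  qed
  have FG: "(\<Sum>a\<in>?A. ?q b a * ?p a b) = 1" if b: "b \<in> ?B" for b
  proof -
    have "(\<Sum>a\<in>?A. ?q b a * ?p a b) = (\<Sum>a<rk G i. ?q b a * ?p a b)"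
      using p b by (intro sum.mono_neutral_left) auto
    then show ?thesis using chain_map_composite[OF F \<phi> \<psi>, of b i] b by simp
  qed
  have GF: "(\<Sum>b\<in>?B. ?p a b * ?q b a) = 1" if a: "a \<in> ?A" for a
  proof -
    have "(\<Sum>b\<in>?B. ?p a b * ?q b a) = (\<Sum>b<rk F i. ?p a b * ?q b a)"
      using p a by (intro sum.mono_neutral_left) auto
    then show ?thesis using chain_map_composite[OF G \<psi> \<phi>, of a i] a by simp
  qed
  have "(of_nat (card ?B) :: 'k) = (\<Sum>b\<in>?B. \<Sum>a\<in>?A. ?q b a * ?p a b)" using FG by simp
  also have "\<dots> = (\<Sum>a\<in>?A. \<Sum>b\<in>?B. ?p a b * ?q b a)" by (subst sum.swap) (simp add: mult.commute)
  also have "\<dots> = of_nat (card ?A)" using GF by simp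
  finally show ?thesis by simp
qed

section \<open>Hochster's formula\<close>

text \<open>The boundary on functions on all subsets, free of a complex: a chain of a subcomplex has
  the same boundary in every larger complex, which is what the passage between induced subcomplexes
  needs.\<close>

definition simplicial_boundary :: "('v::linorder set \<Rightarrow> 'k::comm_ring_1) \<Rightarrow> 'v set \<Rightarrow> 'k" where
  "simplicial_boundary c T = (\<Sum>v\<in>- T. psign v T * c (insert v T))"

lemma boundary_map_eq:
  fixes c :: "'v::{finite, linorder} set \<Rightarrow> 'k::field"
  assumes "\<And>S. c S \<noteq> 0 \<Longrightarrow> S \<in> \<Delta>"
  shows "boundary_map \<Delta> c = simplicial_boundary c"
proof
  fix T
  show "boundary_map \<Delta> c T = simplicial_boundary c T"
    unfolding boundary_map_def simplicial_boundary_def psign_def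
    by (rule sum.mono_neutral_left) (use assms in auto)
qed

lemma simplicial_boundary_twice:
  fixes c :: "'v::{finite, linorder} set \<Rightarrow> 'k::comm_ring_1"
  shows "simplicial_boundary (simplicial_boundary c) T = 0"
proof -
  have e: "- insert v T = - T - {v}" for v by auto
  have "simplicial_boundary (simplicial_boundary c) T
      = (\<Sum>v\<in>- T. \<Sum>w\<in>- T - {v}. psign v T * psign w (insert v T) * c (insert w (insert v T)))"
    by (simp add: simplicial_boundary_def sum_distrib_left mult.assoc e)
  also have "\<dots> = 0"
  proof (rule sum_antisym_zero)
    fix v w assume vw: "v \<in> - T" "w \<in> - T" "v \<noteq> w"
    have "psign v T * psign w (insert v T) = - (psign w T * psign v (insert w T) :: 'k)"
      by (rule psign_swap) (use vw in auto)
    then show "psign v T * psign w (insert v T) * c (insert w (insert v T))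
        = - (psign w T * psign v (insert w T) * c (insert v (insert w T)))"
      by (simp add: insert_commute[of v w])
  qed simp
  finally show ?thesis .
qed

lemma coboundary_boundary_adjoint:
  fixes f z :: "'v::{finite, linorder} set \<Rightarrow> 'k::comm_ring_1"
  shows "(\<Sum>U\<in>UNIV. coboundary f U * z U) = (\<Sum>T\<in>UNIV. f T * simplicial_boundary z T)"
proof -
  have "(\<Sum>U\<in>UNIV. coboundary f U * z U)
      = (\<Sum>(U, v)\<in>(SIGMA U:UNIV. U). psign v U * f (U - {v}) * z U)"
    by (simp add: coboundary_def sum_distrib_right sum.Sigma)
  also have "\<dots> = (\<Sum>(T, v)\<in>(SIGMA T:UNIV. - T). psign v T * f T * z (insert v T))"
    by (rule sum.reindex_bij_witness[of _ "\<lambda>(T, v). (insert v T, v)" "\<lambda>(U, v). (U - {v}, v)"])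
      (auto simp: insert_absorb)
  also have "\<dots> = (\<Sum>T\<in>UNIV. f T * simplicial_boundary z T)"
    by (simp add: simplicial_boundary_def sum_distrib_left sum.Sigma[symmetric] ac_simps)
  finally show ?thesis .
qed

section \<open>Duality between homology and cohomology over a field\<close>

interpretation fin_fun_space: finite_dimensional_vector_space
  "\<lambda>(a::'k::field) (c::'i::finite \<Rightarrow> 'k) i. a * c i" "range (\<lambda>i j. if j = i then 1 else 0)"
proof
  let ?e = "\<lambda>i j :: 'i. if j = i then 1 else 0 :: 'k"
  show "finite (range ?e)" by simp
  have rep: "c = (\<Sum>i\<in>UNIV. (\<lambda>j. c i * ?e i j))" for c
    by (simp add: fun_eq_iff sum_fun_app if_distrib cong: if_cong)
  show "fun_space.span (range ?e) = UNIV"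
  proof -
    have "c \<in> fun_space.span (range ?e)" for c
      by (subst rep) (intro fun_space.span_sum fun_space.span_scale fun_space.span_base rangeI)
    then show ?thesis by blast
  qed
  show "fun_space.independent (range ?e)"
  proof
    assume "fun_space.dependent (range ?e)"
    then obtain i where i: "?e i \<in> fun_space.span (range ?e - {?e i})"
      unfolding fun_space.dependent_def by blast
    have "range ?e - {?e i} \<subseteq> {c. c i = 0}" by auto
    moreover have "fun_space.subspace {c. c i = (0::'k)}" by (rule fun_space.subspaceI) auto
    ultimately have "fun_space.span (range ?e - {?e i}) \<subseteq> {c. c i = 0}"
      by (rule fun_space.span_minimal)
    then show False using i by auto
  qed
qed

text \<open>A basis of \<open>B\<close> stays independent after adding \<open>z\<close>, so some
  linear functional kills \<open>B\<close> but not \<open>z\<close>. It is returned as a coefficient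
  vector \<open>f\<close>, to be fed into the adjunction of boundary and coboundary.\<close>

lemma separating_functional:
  fixes B :: "('i::finite \<Rightarrow> 'k::field) set"
  assumes B: "fun_space.subspace B" and z: "z \<notin> B"
  obtains f where "\<And>b. b \<in> B \<Longrightarrow> (\<Sum>i\<in>UNIV. f i * b i) = 0" "(\<Sum>i\<in>UNIV. f i * z i) \<noteq> 0"
proof -
  interpret p: vector_space_pair "\<lambda>(a::'k) (c::'i \<Rightarrow> 'k) i. a * c i" "(*) :: 'k \<Rightarrow> 'k \<Rightarrow> 'k"
  proof (intro vector_space_pair.intro)
    show "vector_space (\<lambda>(a::'k) (c::'i \<Rightarrow> 'k) i. a * c i)" by (rule fun_space.vector_space_axioms)
    show "vector_space ((*) :: 'k \<Rightarrow> 'k \<Rightarrow> 'k)" by unfold_locales (simp_all add: algebra_simps)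
  qed
  obtain U where U: "U \<subseteq> B" "fun_space.independent U" "B \<subseteq> fun_space.span U"
    by (rule fun_space.basis_exists[of B])
  have "z \<notin> fun_space.span U"
    using z fun_space.span_minimal[OF U(1) B] by blast
  then have "fun_space.independent (insert z U)"
    using U(2) by (simp add: fun_space.independent_insert)
  then obtain l where
    l: "Vector_Spaces.linear (\<lambda>(a::'k) (c::'i \<Rightarrow> 'k) i. a * c i) ((*) :: 'k \<Rightarrow> 'k \<Rightarrow> 'k) l"
      "\<And>x. x \<in> insert z U \<Longrightarrow> l x = (if x = z then 1 else 0)"
    using p.linear_independent_extend[of "insert z U" "\<lambda>x. if x = z then 1 else 0"] by blast
  let ?e = "\<lambda>i j :: 'i. if j = i then 1 else 0 :: 'k"
  have lc: "l c = (\<Sum>i\<in>UNIV. l (?e i) * c i)" for c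
  proof -
    have "c = (\<Sum>i\<in>UNIV. (\<lambda>j. c i * ?e i j))"
      by (simp add: fun_eq_iff sum_fun_app if_distrib cong: if_cong)
    then have "l c = (\<Sum>i\<in>UNIV. l (\<lambda>j. c i * ?e i j))" using p.linear_sum[OF l(1)] by metis
    also have "\<dots> = (\<Sum>i\<in>UNIV. c i * l (?e i))" by (intro sum.cong refl p.linear_scale[OF l(1)])
    finally show ?thesis by (simp add: mult.commute)
  qed
  have "l b = 0" if "b \<in> B" for b
  proof (rule p.linear_eq_0_on_span[OF l(1), of U])
    show "b \<in> fun_space.span U" using that U(3) by blast
    show "l x = 0" if "x \<in> U" for x using l(2)[of x] that z U(1) by auto
  qed
  moreover have "l z \<noteq> 0" using l(2)[of z] by simp
  ultimately show thesis using that[of "\<lambda>i. l (?e i)"] by (simp flip: lc)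
qed

text \<open>Faces are counted by vertices, so \<open>q\<close> stands for homological degree
  \<open>q - 1\<close> and degree -1 needs no negative index.\<close>

definition homology_vanishes :: "'k::field itself \<Rightarrow> 'v::{finite, linorder} set set \<Rightarrow> nat \<Rightarrow> bool" where
  "homology_vanishes K X q \<longleftrightarrow>
     (\<forall>z :: 'v set \<Rightarrow> 'k. (\<forall>S. z S \<noteq> 0 \<longrightarrow> S \<in> X \<and> card S = q) \<longrightarrow> (\<forall>T. simplicial_boundary z T = 0) \<longrightarrow>
       (\<exists>y. (\<forall>S. y S \<noteq> 0 \<longrightarrow> S \<in> X \<and> card S = Suc q) \<and> z = simplicial_boundary y))"

text \<open>Cochains are arbitrary functions on sets, compared on faces only. When \<open>X\<close>
  is a complex, the coboundary at a face sees values on faces only, so this is the cohomology of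
  \<open>X\<close>.\<close>

definition cohomology_vanishes :: "'k::field itself \<Rightarrow> 'v::{finite, linorder} set set \<Rightarrow> nat \<Rightarrow> bool" where
  "cohomology_vanishes K X q \<longleftrightarrow>
     (\<forall>f :: 'v set \<Rightarrow> 'k. (\<forall>U \<in> X. card U = Suc q \<longrightarrow> coboundary f U = 0) \<longrightarrow>
       (\<exists>e. \<forall>T \<in> X. card T = q \<longrightarrow> f T = coboundary e T))"

lemma simplicial_boundary_add:
  "simplicial_boundary (c + d) = simplicial_boundary c + simplicial_boundary d"
  by (simp add: simplicial_boundary_def distrib_left sum.distrib fun_eq_iff)

lemma simplicial_boundary_scale:
  "simplicial_boundary (\<lambda>S. a * c S) T = a * simplicial_boundary c T"
  by (simp add: simplicial_boundary_def sum_distrib_left ac_simps)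

lemma coboundary_add: "coboundary (\<lambda>S. c S + d S) T = coboundary c T + coboundary d T"
  by (simp add: coboundary_def distrib_left sum.distrib)

lemma coboundary_scale: "coboundary (\<lambda>S. a * c S) T = a * coboundary c T"
  by (simp add: coboundary_def sum_distrib_left ac_simps)

definition cochains_on :: "'v set set \<Rightarrow> nat \<Rightarrow> ('v set \<Rightarrow> 'k::field) set" where
  "cochains_on X q = {c. \<forall>S. c S \<noteq> 0 \<longrightarrow> S \<in> X \<and> card S = q}"

lemma subspace_cochains_on: "fun_space.subspace (cochains_on X q :: ('v set \<Rightarrow> 'k::field) set)"
proof (rule fun_space.subspaceI)
  fix x y :: "'v set \<Rightarrow> 'k" assume "x \<in> cochains_on X q" "y \<in> cochains_on X q"
  moreover have "x b \<noteq> 0 \<or> y b \<noteq> 0" if "(x + y) b \<noteq> 0" for b using that by auto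
  ultimately show "x + y \<in> cochains_on X q" unfolding cochains_on_def by blast
qed (auto simp: cochains_on_def)

lemma subspace_boundary_image:
  "fun_space.subspace (simplicial_boundary ` cochains_on X q :: ('v::linorder set \<Rightarrow> 'k::field) set)"
proof (rule fun_space.subspaceI)
  note s = subspace_cochains_on[where 'k='k, of X q]
  have "0 = simplicial_boundary (0 :: 'v set \<Rightarrow> 'k)"
    by (simp add: simplicial_boundary_def fun_eq_iff)
  then show "0 \<in> (simplicial_boundary ` cochains_on X q :: ('v set \<Rightarrow> 'k) set)"
    using fun_space.subspace_0[OF s] by blast
  fix x y :: "'v set \<Rightarrow> 'k" and a
  assume x: "x \<in> simplicial_boundary ` cochains_on X q"
  then obtain c where c: "c \<in> cochains_on X q" "x = simplicial_boundary c" by blast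
  have "(\<lambda>b. a * x b) = simplicial_boundary (\<lambda>b. a * c b)"
    by (simp add: c(2) simplicial_boundary_scale fun_eq_iff)
  then show "(\<lambda>b. a * x b) \<in> simplicial_boundary ` cochains_on X q"
    using fun_space.subspace_scale[OF s c(1)] by blast
  assume y: "y \<in> simplicial_boundary ` cochains_on X q"
  then obtain d where d: "d \<in> cochains_on X q" "y = simplicial_boundary d" by blast
  have "x + y = simplicial_boundary (c + d)"
    unfolding c(2) d(2) simplicial_boundary_add ..
  then show "x + y \<in> simplicial_boundary ` cochains_on X q"
    using fun_space.subspace_add[OF s c(1) d(1)] by blast
qed

text \<open>A cocycle that is no coboundary is detected by a functional vanishing on coboundaries;
  by adjointness this functional is a cycle, hence a boundary, and so it pairs to zero with every
  cocycle. The converse exchanges the two roles.\<close>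

lemma homology_vanishes_iff_cohomology_vanishes:
  "homology_vanishes K X q \<longleftrightarrow> cohomology_vanishes (K :: 'k::field itself) (X :: 'v::{finite, linorder} set set) q"
proof
  assume H: "homology_vanishes K X q"
  show "cohomology_vanishes K X q"
    unfolding cohomology_vanishes_def
  proof (intro allI impI)
    fix f :: "'v set \<Rightarrow> 'k" assume f: "\<forall>U \<in> X. card U = Suc q \<longrightarrow> coboundary f U = 0"
    \<comment> \<open>Cutting off outside the \<open>q\<close>-element faces turns equality on faces
      into equality of functions, so that separation applies.\<close>
    let ?r = "\<lambda>c S. if S \<in> X \<and> card S = q then c S else 0"
    let ?B = "{?r (coboundary e) | e. True} :: ('v set \<Rightarrow> 'k) set"
    have "?r f \<in> ?B"
    proof (rule ccontr)
      assume nf: "?r f \<notin> ?B"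
      have "fun_space.subspace ?B"
      proof (rule fun_space.subspaceI)
        show "0 \<in> ?B" by (intro CollectI exI[of _ "\<lambda>_. 0"]) (auto simp: coboundary_def fun_eq_iff)
        show "x + y \<in> ?B" if "x \<in> ?B" "y \<in> ?B" for x y
        proof -
          from that obtain e d where "x = ?r (coboundary e)" "y = ?r (coboundary d)" by blast
          then show ?thesis
            by (intro CollectI exI[of _ "\<lambda>S. e S + d S"]) (auto simp: coboundary_add fun_eq_iff)
        qed
        show "(\<lambda>b. a * x b) \<in> ?B" if "x \<in> ?B" for a x
        proof -
          from that obtain e where "x = ?r (coboundary e)" by blast
          then show ?thesis
            by (intro CollectI exI[of _ "\<lambda>S. a * e S"]) (auto simp: coboundary_scale fun_eq_iff)
        qed
      qed
      from separating_functional[OF this nf]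
      obtain g where g: "\<And>b. b \<in> ?B \<Longrightarrow> (\<Sum>S\<in>UNIV. g S * b S) = 0" "(\<Sum>S\<in>UNIV. g S * ?r f S) \<noteq> 0"
        by blast
      have sw: "(\<Sum>S\<in>UNIV. g S * ?r c S) = (\<Sum>S\<in>UNIV. c S * ?r g S)" for c
        by (intro sum.cong refl) auto
      have cyc: "\<forall>T. simplicial_boundary (?r g) T = 0"
      proof
        fix T :: "'v set"
        \<comment> \<open>Pairing with the coboundary of the indicator of \<open>T\<close> reads off
          the boundary of \<open>?r g\<close> at \<open>T\<close>.\<close>
        let ?e = "\<lambda>S :: 'v set. if S = T then 1 else 0 :: 'k"
        have "0 = (\<Sum>S\<in>UNIV. g S * ?r (coboundary ?e) S)" by (rule g(1)[symmetric]) blast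
        also have "\<dots> = (\<Sum>S\<in>UNIV. ?e S * simplicial_boundary (?r g) S)"
          unfolding sw by (rule coboundary_boundary_adjoint)
        finally show "simplicial_boundary (?r g) T = 0"
          by (simp add: if_distrib[of "\<lambda>x. x * _"] cong: if_cong)
      qed
      have supp: "\<forall>S. ?r g S \<noteq> 0 \<longrightarrow> S \<in> X \<and> card S = q" by simp
      from H[unfolded homology_vanishes_def, THEN spec, THEN mp, THEN mp, OF supp cyc]
      obtain y where "(\<forall>S. y S \<noteq> 0 \<longrightarrow> S \<in> X \<and> card S = Suc q) \<and> ?r g = simplicial_boundary y"
        by (rule exE)
      then have y: "\<forall>S. y S \<noteq> 0 \<longrightarrow> S \<in> X \<and> card S = Suc q" "?r g = simplicial_boundary y"
        by (rule conjunct1, rule conjunct2)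
      have "(\<Sum>S\<in>UNIV. g S * ?r f S) = (\<Sum>S\<in>UNIV. f S * simplicial_boundary y S)"
        unfolding sw using fun_cong[OF y(2)] by (intro sum.cong refl) (simp only:)
      also have "\<dots> = (\<Sum>S\<in>UNIV. coboundary f S * y S)" by (rule coboundary_boundary_adjoint[symmetric])
      also have "\<dots> = 0" using f y(1) by (intro sum.neutral) (metis mult_eq_0_iff)
      finally show False using g(2) by simp
    qed
    then obtain e where "?r f = ?r (coboundary e)" by blast
    then have "f T = coboundary e T" if "T \<in> X" "card T = q" for T
      using that by (auto dest: fun_cong[of _ _ T])
    then show "\<exists>e. \<forall>T \<in> X. card T = q \<longrightarrow> f T = coboundary e T" by blast
  qed
next
  assume C: "cohomology_vanishes K X q"
  show "homology_vanishes K X q"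
    unfolding homology_vanishes_def
  proof (intro allI impI)
    fix z :: "'v set \<Rightarrow> 'k"
    assume z: "\<forall>S. z S \<noteq> 0 \<longrightarrow> S \<in> X \<and> card S = q" "\<forall>T. simplicial_boundary z T = 0"
    have "z \<in> simplicial_boundary ` cochains_on X (Suc q)"
    proof (rule ccontr)
      assume "z \<notin> simplicial_boundary ` cochains_on X (Suc q)"
      from separating_functional[OF subspace_boundary_image this]
      obtain f where f: "\<And>b. b \<in> simplicial_boundary ` cochains_on X (Suc q) \<Longrightarrow> (\<Sum>S\<in>UNIV. f S * b S) = 0"
        "(\<Sum>S\<in>UNIV. f S * z S) \<noteq> 0" by blast
      have cf: "\<forall>U \<in> X. card U = Suc q \<longrightarrow> coboundary f U = 0"
      proof (intro ballI impI)
        fix U assume U: "U \<in> X" "card U = Suc q"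
        let ?y = "\<lambda>S. if S = U then 1 else 0 :: 'k"
        have "?y \<in> cochains_on X (Suc q)" using U by (auto simp: cochains_on_def)
        then have "0 = (\<Sum>S\<in>UNIV. f S * simplicial_boundary ?y S)" using f(1) by auto
        also have "\<dots> = (\<Sum>S\<in>UNIV. coboundary f S * ?y S)" by (rule coboundary_boundary_adjoint[symmetric])
        finally show "coboundary f U = 0" by (simp add: if_distrib cong: if_cong)
      qed
      from C[unfolded cohomology_vanishes_def, THEN spec, THEN mp, OF cf]
      obtain e where e: "\<forall>T \<in> X. card T = q \<longrightarrow> f T = coboundary e T"
        by (rule exE)
      have "(\<Sum>S\<in>UNIV. f S * z S) = (\<Sum>S\<in>UNIV. coboundary e S * z S)"
        using e z(1) by (intro sum.cong refl) (metis mult_zero_right)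
      also have "\<dots> = (\<Sum>S\<in>UNIV. e S * simplicial_boundary z S)" by (rule coboundary_boundary_adjoint)
      finally show False using f(2) z(2) by simp
    qed
    then show "\<exists>y. (\<forall>S. y S \<noteq> 0 \<longrightarrow> S \<in> X \<and> card S = Suc q) \<and> z = simplicial_boundary y"
      unfolding cochains_on_def by blast
  qed
qed

section \<open>Vanishing of reduced homology dimensions\<close>

lemma chains_eq_cochains_on: "chains X (int q - 1) = cochains_on X q"
  by (simp add: chains_def cochains_on_def)

lemma reduced_homology_dim_eq_0_iff:
  fixes X :: "'v::{finite, linorder} set set"
  assumes down: "\<And>S T. S \<in> X \<Longrightarrow> T \<subseteq> S \<Longrightarrow> T \<in> X"
  shows "reduced_homology_dim K X (int q - 1) = 0 \<longleftrightarrow> homology_vanishes (K :: 'k::field itself) X q"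
proof -
  define Z where "Z = (cycles X (int q - 1) :: ('v set \<Rightarrow> 'k) set)"
  define B where "B = (boundaries X (int q - 1) :: ('v set \<Rightarrow> 'k) set)"
  have bm: "boundary_map X c = simplicial_boundary c" if "c \<in> cochains_on X n" for c :: "'v set \<Rightarrow> 'k" and n
    by (rule boundary_map_eq) (use that in \<open>auto simp: cochains_on_def\<close>)
  have Z: "Z = {c \<in> cochains_on X q. \<forall>T. simplicial_boundary c T = 0}"
    using bm by (auto simp: Z_def cycles_def chains_eq_cochains_on fun_eq_iff)
  have "chains X (int q - 1 + 1) = (cochains_on X (Suc q) :: ('v set \<Rightarrow> 'k) set)"
    using chains_eq_cochains_on[of X "Suc q"] by simp
  then have B: "B = simplicial_boundary ` cochains_on X (Suc q)"
    unfolding B_def boundaries_def using bm[of _ "Suc q"] by (simp cong: image_cong)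
  have sB: "fun_space.subspace B" unfolding B by (rule subspace_boundary_image)
  have sZ: "fun_space.subspace Z"
  proof (rule fun_space.subspaceI)
    note s = subspace_cochains_on[where 'k='k, of X q]
    show "0 \<in> Z" using fun_space.subspace_0[OF s] by (simp add: Z simplicial_boundary_def)
    show "x + y \<in> Z" if "x \<in> Z" "y \<in> Z" for x y
      using that fun_space.subspace_add[OF s, of x y] by (simp add: Z simplicial_boundary_add)
    show "(\<lambda>b. a * x b) \<in> Z" if "x \<in> Z" for a x
      using that fun_space.subspace_scale[OF s, of x a] by (simp add: Z simplicial_boundary_scale)
  qed
  \<comment> \<open>The dimensions are subtracted as natural numbers, so a zero difference means
    equality only because boundaries are cycles. Downward closure keeps the support of a boundary
    inside \<open>X\<close>.\<close>
  have BZ: "B \<subseteq> Z"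
  proof
    fix z assume "z \<in> B"
    then obtain y where y: "y \<in> cochains_on X (Suc q)" "z = simplicial_boundary y" unfolding B by blast
    have "T \<in> X \<and> card T = q" if "z T \<noteq> 0" for T
    proof -
      have "(\<Sum>v\<in>- T. psign v T * y (insert v T)) \<noteq> 0"
        using that by (simp add: y(2) simplicial_boundary_def)
      then obtain v where "v \<in> - T" "psign v T * y (insert v T) \<noteq> 0"
        by (rule sum.not_neutral_contains_not_neutral)
      then have v: "v \<notin> T" "y (insert v T) \<noteq> 0" by auto
      then have "insert v T \<in> X" "card (insert v T) = Suc q" using y(1) by (auto simp: cochains_on_def)
      then show ?thesis using v(1) down[of "insert v T" T] by auto
    qed
    then show "z \<in> Z" by (simp add: Z cochains_on_def y(2) simplicial_boundary_twice)
  qed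
  have "reduced_homology_dim K X (int q - 1) = fun_space.dim Z - fun_space.dim B"
    by (simp add: reduced_homology_dim_def Z_def B_def)
  also have "\<dots> = 0 \<longleftrightarrow> Z \<subseteq> B"
  proof
    assume "fun_space.dim Z - fun_space.dim B = 0"
    then show "Z \<subseteq> B" using fin_fun_space.subspace_dim_equal[OF sB sZ BZ] by simp
  next
    assume "Z \<subseteq> B"
    then show "fun_space.dim Z - fun_space.dim B = 0" using BZ by auto
  qed
  also have "\<dots> \<longleftrightarrow> homology_vanishes K X q"
  proof
    assume ZB: "Z \<subseteq> B"
    show "homology_vanishes K X q"
      unfolding homology_vanishes_def
    proof (intro allI impI)
      fix z :: "'v set \<Rightarrow> 'k"
      assume "\<forall>S. z S \<noteq> 0 \<longrightarrow> S \<in> X \<and> card S = q" "\<forall>T. simplicial_boundary z T = 0"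
      then have "z \<in> Z" by (simp add: Z cochains_on_def)
      then obtain y where "y \<in> cochains_on X (Suc q)" "z = simplicial_boundary y" using ZB B by blast
      then show "\<exists>y. (\<forall>S. y S \<noteq> 0 \<longrightarrow> S \<in> X \<and> card S = Suc q) \<and> z = simplicial_boundary y"
        by (intro exI[of _ y]) (simp add: cochains_on_def)
    qed
  next
    assume H: "homology_vanishes K X q"
    show "Z \<subseteq> B"
    proof
      fix z assume "z \<in> Z"
      then have z: "\<forall>S. z S \<noteq> 0 \<longrightarrow> S \<in> X \<and> card S = q" "\<forall>T. simplicial_boundary z T = 0"
        by (simp_all add: Z cochains_on_def)
      from H[unfolded homology_vanishes_def, THEN spec, THEN mp, THEN mp, OF z]
      show "z \<in> B" unfolding B cochains_on_def by (elim exE conjE) (rule image_eqI, assumption, simp)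
    qed
  qed
  finally show ?thesis .
qed

lemma reduced_homology_dim_negative:
  assumes "i < - 1" shows "reduced_homology_dim (K :: 'k::field itself) (X :: 'v::{finite, linorder} set set) i = 0"
proof -
  have "chains X i = {0 :: 'v set \<Rightarrow> 'k}"
    using assms by (force simp: chains_def fun_eq_iff)
  then have "cycles X i \<subseteq> {0 :: 'v set \<Rightarrow> 'k}" by (auto simp: cycles_def)
  then have dim0: "fun_space.dim (cycles X i :: ('v set \<Rightarrow> 'k) set) = 0"
    using fin_fun_space.dim_eq_0 by blast
  show ?thesis by (simp only: reduced_homology_dim_def dim0 diff_0_eq_0)
qed

context labelled_resolution
begin

text \<open>\<open>C 0 / Z 0\<close> is one-dimensional on faces and zero on other sets, so its
  Koszul complex in multidegree \<open>W\<close> is the cochain complex of the induced subcomplex.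
  Removing \<open>p\<close> vertices from \<open>W\<close> leaves the sets with \<open>q\<close>
  elements.\<close>

lemma koszul_iff_cohomology:
  assumes q: "q + p = card W"
  shows "koszul_quotient_exact (C 0) (Z 0) W p \<longleftrightarrow>
    cohomology_vanishes TYPE('k) (induced_subcomplex \<Delta> W) q"
proof -
  have C0: "c \<in> C 0 T \<longleftrightarrow> (\<forall>b. b \<noteq> 0 \<longrightarrow> c b = 0)" for c :: "nat \<Rightarrow> 'k" and T
    by (auto simp: labelled_chains_def rn_0) (metis emptyE gr0I lb_0)
  have Z0: "c \<in> Z 0 T \<longleftrightarrow> (\<forall>b. b \<noteq> 0 \<longrightarrow> c b = 0) \<and> (T \<in> \<Delta> \<longrightarrow> c 0 = 0)" for c T
    by (auto simp: C0 fun_eq_iff) (metis neq0_conv)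
  have tU: "U \<in> tier W p \<and> U \<in> \<Delta> \<longleftrightarrow> U \<in> induced_subcomplex \<Delta> W \<and> card U = Suc q" for U
    using q by (auto simp: tier_def induced_subcomplex_def)
  have tT: "T \<in> tier W (Suc p) \<and> T \<in> \<Delta> \<longleftrightarrow> T \<in> induced_subcomplex \<Delta> W \<and> card T = q" for T
    using q by (auto simp: tier_def induced_subcomplex_def)
  have kd: "kdiff c U b = 0" if "\<And>v. v \<in> U \<Longrightarrow> c (U - {v}) b = 0" for c :: "'v set \<Rightarrow> nat \<Rightarrow> 'k" and U b
    using that by (simp add: kdiff_def coboundary_def)
  show ?thesis
  proof
    assume L: "koszul_quotient_exact (C 0) (Z 0) W p"
    show "cohomology_vanishes TYPE('k) (induced_subcomplex \<Delta> W) q"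
      unfolding cohomology_vanishes_def
    proof (intro allI impI)
      fix f :: "'v set \<Rightarrow> 'k"
      assume f: "\<forall>U \<in> induced_subcomplex \<Delta> W. card U = Suc q \<longrightarrow> coboundary f U = 0"
      define c where "c T = (\<lambda>b :: nat. if b = 0 then f T else 0)" for T
      have cC: "\<forall>T \<in> tier W (Suc p). c T \<in> C 0 T" by (simp add: C0 c_def)
      have "kdiff c U \<in> Z 0 U" if "U \<in> tier W p" for U
        using f tU[of U] that by (auto simp: Z0 kd c_def kdiff_def coboundary_def simp del: labelled_kernel.simps)
      then obtain e where e: "\<forall>T \<in> tier W (Suc p). c T - kdiff e T \<in> Z 0 T"
        using koszul_quotient_exactE[OF L cC] by blast
      have "f T = coboundary (\<lambda>S. e S 0) T" if "T \<in> induced_subcomplex \<Delta> W" "card T = q" for T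
      proof -
        have "T \<in> tier W (Suc p)" "T \<in> \<Delta>" using tT that by blast+
        then have "(c T - kdiff e T) 0 = 0" using e Z0 by blast
        then show ?thesis by (simp add: c_def kdiff_def)
      qed
      then show "\<exists>e. \<forall>T \<in> induced_subcomplex \<Delta> W. card T = q \<longrightarrow> f T = coboundary e T" by blast
    qed
  next
    assume R: "cohomology_vanishes TYPE('k) (induced_subcomplex \<Delta> W) q"
    show "koszul_quotient_exact (C 0) (Z 0) W p"
      unfolding koszul_quotient_exact_def
    proof (intro allI impI)
      fix c :: "'v set \<Rightarrow> nat \<Rightarrow> 'k"
      assume c: "\<forall>T \<in> tier W (Suc p). c T \<in> C 0 T" "\<forall>U \<in> tier W p. kdiff c U \<in> Z 0 U"
      have c0: "\<forall>U \<in> induced_subcomplex \<Delta> W. card U = Suc q \<longrightarrow> coboundary (\<lambda>T. c T 0) U = 0"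
      proof (intro ballI impI)
        fix U assume "U \<in> induced_subcomplex \<Delta> W" "card U = Suc q"
        then have "U \<in> tier W p" "U \<in> \<Delta>" using tU by blast+
        then have "kdiff c U 0 = 0" using c(2) Z0 by blast
        then show "coboundary (\<lambda>T. c T 0) U = 0" by (simp add: kdiff_def)
      qed
      from R[unfolded cohomology_vanishes_def, THEN spec, THEN mp, OF c0]
      obtain f where f: "\<forall>T \<in> induced_subcomplex \<Delta> W. card T = q \<longrightarrow> c T 0 = coboundary f T"
        by (rule exE)
      define e where "e T = (\<lambda>b :: nat. if b = 0 then f T else 0)" for T
      have "\<forall>T \<in> tier W (Suc (Suc p)). e T \<in> C 0 T" by (simp add: C0 e_def)
      moreover have "c T - kdiff e T \<in> Z 0 T" if T: "T \<in> tier W (Suc p)" for T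
      proof -
        have "c T b = 0" if "b \<noteq> 0" for b using c(1) T C0 that by blast
        moreover have "kdiff e T b = 0" if "b \<noteq> 0" for b using that by (intro kd) (simp add: e_def)
        moreover have "c T 0 = kdiff e T 0" if "T \<in> \<Delta>"
          using f tT[of T] T that by (simp add: e_def kdiff_def)
        ultimately show ?thesis unfolding Z0 by simp
      qed
      ultimately show "\<exists>e. (\<forall>T \<in> tier W (Suc (Suc p)). e T \<in> C 0 T) \<and>
          (\<forall>T \<in> tier W (Suc p). c T - kdiff e T \<in> Z 0 T)" by blast
    qed
  qed
qed

lemma label_absent_iff_homology:
  "(\<forall>b<rn i. lb i b \<noteq> W) \<longleftrightarrow>
    reduced_homology_dim TYPE('k) (induced_subcomplex \<Delta> W) (int (card W) - int i - 1) = 0"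
proof (cases "i \<le> card W")
  case True
  have "(\<forall>b<rn i. lb i b \<noteq> W) \<longleftrightarrow> homology_vanishes TYPE('k) (induced_subcomplex \<Delta> W) (card W - i)"
    unfolding label_absent_iff homology_vanishes_iff_cohomology_vanishes
    by (rule koszul_iff_cohomology) (use True in simp)
  also have "\<dots> \<longleftrightarrow> reduced_homology_dim TYPE('k) (induced_subcomplex \<Delta> W) (int (card W - i) - 1) = 0"
    by (rule reduced_homology_dim_eq_0_iff[symmetric])
      (use face_subset in \<open>auto simp: induced_subcomplex_def\<close>)
  finally show ?thesis using True by (simp add: of_nat_diff)
next
  case False
  \<comment> \<open>More vertices would have to be removed than \<open>W\<close> has, and the
    homological degree is below -1: both sides are trivially true.\<close>
  have "tier W (Suc i) = {}" "tier W (Suc (Suc i)) = {}" using False by (auto simp: tier_def)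
  then have "koszul_quotient_exact (C 0) (Z 0) W i" by (simp add: koszul_quotient_exact_def)
  then show ?thesis using False label_absent_iff by (simp add: reduced_homology_dim_negative)
qed

end

text \<open>Existence of a labelled resolution and invariance of ranks evaluate the definite
  description. A Betti number in internal degree \<open>j\<close> counts labels with
  \<open>j\<close> elements, and absence of the label \<open>W\<close> means vanishing of one
  reduced homology group; multiplicities are not recorded.\<close>

lemma hochster_nonvanishing:
  fixes E :: "'v::{finite, linorder} set set"
  assumes E: "simple_graph E"
    and \<Delta>: "stanley_reisner_complex (edge_ideal E :: ('v, 'k::field_char_0) mpoly set) = \<Delta>"
  shows "graded_betti (edge_ideal E :: ('v, 'k) mpoly set) i j \<noteq> 0 \<longleftrightarrow>
    (\<exists>W. card W = j \<and> reduced_homology_dim TYPE('k) (induced_subcomplex \<Delta> W) (int j - int i - 1) \<noteq> 0)"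
proof -
  let ?I = "edge_ideal E :: ('v, 'k) mpoly set"
  have cl: "\<Delta> = clique_complex (complement_graph E)"
    using stanley_reisner_complex_edge_ideal[OF E, where 'k='k] \<Delta> by simp
  have I: "p \<in> ?I \<longleftrightarrow> (\<forall>m \<in> Poly_Mapping.keys p. Poly_Mapping.keys m \<notin> \<Delta>)" for p
    unfolding cl by (rule in_edge_ideal_iff[OF E])
  have down: "T \<in> \<Delta>" if "S \<in> \<Delta>" "T \<subseteq> S" for S T
    using that unfolding cl clique_complex_def by blast
  have mi: "monomial_ideal ?I"
  proof
    show "0 \<in> ?I" by (simp add: I)
    show "p - q \<in> ?I" if "p \<in> ?I" "q \<in> ?I" for p q
      using that keys_diff[of p q] unfolding I by blast
    show "q * p \<in> ?I" if "p \<in> ?I" for p q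
      unfolding I
    proof
      fix m assume "m \<in> Poly_Mapping.keys (q * p)"
      then obtain s t where st: "m = s + t" "t \<in> Poly_Mapping.keys p" using keys_mult by blast
      have "Poly_Mapping.keys t \<subseteq> Poly_Mapping.keys m" by (auto simp: st(1) in_keys_iff lookup_add)
      then show "Poly_Mapping.keys m \<notin> \<Delta>" using that st(2) down unfolding I by blast
    qed
    show "poly_filter P p \<in> ?I" if "p \<in> ?I" for P p
      using that unfolding I keys_poly_filter by blast
  qed
  obtain rn lb and mt :: "nat \<Rightarrow> nat \<Rightarrow> nat \<Rightarrow> 'k" where "labelled_resolution \<Delta> rn lb mt"
    using labelled_resolution_exists[of \<Delta>, where 'k='k] down by (auto simp: cl clique_complex_def)
  then interpret labelled_resolution \<Delta> rn lb mt .
  have res: "minimal_graded_free_resolution complex ?I"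
    by (rule complex_minimal_graded_free_resolution) (rule I)
  have "graded_betti ?I i j = card {b. b < rk complex i \<and> dg complex i b = j}"
    unfolding graded_betti_def
  proof (rule the_equality)
    show "\<exists>F. minimal_graded_free_resolution F ?I \<and>
        card {b. b < rk complex i \<and> dg complex i b = j} = card {b. b < rk F i \<and> dg F i b = j}"
      using res by (intro exI[of _ complex]) simp
    fix c assume "\<exists>F. minimal_graded_free_resolution F ?I \<and> c = card {b. b < rk F i \<and> dg F i b = j}"
    then obtain F where F: "minimal_graded_free_resolution F ?I" "c = card {b. b < rk F i \<and> dg F i b = j}"
      by blast
    show "c = card {b. b < rk complex i \<and> dg complex i b = j}"
      unfolding F(2) by (rule minimal_resolution_rank_unique[OF mi F(1) res])
  qed
  then have "graded_betti ?I i j \<noteq> 0 \<longleftrightarrow> (\<exists>b<rn i. card (lb i b) = j)" by auto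
  also have "\<dots> \<longleftrightarrow> (\<exists>W. card W = j \<and> \<not> (\<forall>b<rn i. lb i b \<noteq> W))" by auto
  finally show ?thesis unfolding label_absent_iff_homology by auto
qed

section \<open>Complete simplicial fans\<close>

text \<open>Independence is that of an indexed family, so coefficients are functions on vertices and
  injectivity of \<open>y\<close> on \<open>S\<close> becomes a consequence. The clause
  \<open>finite S\<close> excludes sums that are 0 by default.\<close>

definition lin_indep_family :: "('v \<Rightarrow> 'a::euclidean_space) \<Rightarrow> 'v set \<Rightarrow> bool" where
  "lin_indep_family y S \<longleftrightarrow> finite S \<and> (\<forall>a. (\<Sum>v\<in>S. a v *\<^sub>R y v) = 0 \<longrightarrow> (\<forall>v\<in>S. a v = 0))"

lemma lin_indep_familyD:
  "lin_indep_family y S \<Longrightarrow> (\<Sum>v\<in>S. a v *\<^sub>R y v) = 0 \<Longrightarrow> v \<in> S \<Longrightarrow> a v = 0"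
  by (auto simp: lin_indep_family_def)

lemma lin_indep_family_inj:
  assumes "lin_indep_family y S" shows "inj_on y S"
proof (rule inj_onI, rule ccontr)
  fix u v assume uv: "u \<in> S" "v \<in> S" "y u = y v" "u \<noteq> v"
  have fin: "finite S" using assms by (simp add: lin_indep_family_def)
  let ?a = "\<lambda>w. (if w = u then 1 else 0) - (if w = v then 1 else 0) :: real"
  have "(\<Sum>w\<in>S. ?a w *\<^sub>R y w) = 0"
    using uv fin by (simp add: scaleR_diff_left sum_subtractf if_distrib[of "\<lambda>x. x *\<^sub>R _"] cong: if_cong)
  then have "?a u = 0" using lin_indep_familyD[OF assms, of ?a u] uv(1) by simp
  then show False using uv(4) by simp
qed

lemma lin_indep_family_independent:
  assumes "lin_indep_family y S" shows "independent (y ` S)"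
proof -
  have fin: "finite S" using assms by (simp add: lin_indep_family_def)
  have inj: "inj_on y S" by (rule lin_indep_family_inj[OF assms])
  have "u x = 0" if "(\<Sum>v\<in>y ` S. u v *\<^sub>R v) = 0" "x \<in> y ` S" for u x
  proof -
    have "(\<Sum>v\<in>S. u (y v) *\<^sub>R y v) = 0" using that(1) by (simp add: sum.reindex[OF inj])
    then show ?thesis using lin_indep_familyD[OF assms, of "\<lambda>v. u (y v)"] that(2) by auto
  qed
  then show ?thesis using fin by (auto simp: dependent_finite)
qed

lemma lin_indep_family_subset:
  assumes S: "lin_indep_family y S" and T: "T \<subseteq> S" shows "lin_indep_family y T"
  unfolding lin_indep_family_def
proof (intro conjI allI impI ballI)
  have fin: "finite S" using S by (simp add: lin_indep_family_def)
  show "finite T" using fin T finite_subset by blast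
  fix a v assume 0: "(\<Sum>v\<in>T. a v *\<^sub>R y v) = 0" and v: "v \<in> T"
  let ?a = "\<lambda>v. if v \<in> T then a v else 0"
  have "(\<Sum>v\<in>S. ?a v *\<^sub>R y v) = (\<Sum>v\<in>T. ?a v *\<^sub>R y v)"
    using fin T by (intro sum.mono_neutral_right) auto
  also have "\<dots> = 0" using 0 by simp
  finally show "a v = 0" using lin_indep_familyD[OF S, of ?a v] T v by auto
qed

lemma lin_indep_family_extend:
  assumes "lin_indep_family y S"
  obtains g :: "'a::euclidean_space \<Rightarrow> real" where "linear g" "\<And>v. v \<in> S \<Longrightarrow> g (y v) = f v"
proof -
  have inj: "inj_on y S" by (rule lin_indep_family_inj[OF assms])
  obtain g where "linear g" "\<forall>x \<in> y ` S. g x = f (inv_into S y x)"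
    using linear_independent_extend[OF lin_indep_family_independent[OF assms],
        of "\<lambda>x. f (inv_into S y x)"] by blast
  then show thesis using that[of g] inj by simp
qed

text \<open>
  Here \<open>\<omega>\<close> is a determinant of the vectors \<open>y v\<close>, and \<open>g T\<close> is this determinant as a linear function of
  the one vector that is added to \<open>T\<close>.
\<close>

lemma alternating_form_exists:
  fixes y :: "'v::{finite, linorder} \<Rightarrow> 'a::euclidean_space"
  assumes "lin_indep_family y A"
  shows "\<exists>(\<omega> :: 'v set \<Rightarrow> real) (g :: 'v set \<Rightarrow> 'a \<Rightarrow> real).
    (\<forall>T. Suc (card T) = card A \<longrightarrow> linear (g T) \<and> (\<forall>v. v \<notin> T \<longrightarrow> g T (y v) = psign v T * \<omega> (insert v T)) \<and>
      (\<forall>v\<in>T. g T (y v) = 0)) \<and> \<omega> A \<noteq> 0"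
proof -
  have "finite A" by simp
  then show ?thesis using assms
  proof (induction A rule: finite_induct)
    case empty
    show ?case by (intro exI[of _ "\<lambda>_. 1"]) auto
  next
    case (insert v0 A)
    have "lin_indep_family y A" using insert.prems lin_indep_family_subset by blast
    then obtain \<omega>' g' where
      g': "\<And>T. Suc (card T) = card A \<Longrightarrow> linear (g' T :: 'a \<Rightarrow> real)"
        "\<And>T v. Suc (card T) = card A \<Longrightarrow> v \<notin> T \<Longrightarrow> g' T (y v) = psign v T * \<omega>' (insert v T)"
        "\<And>T v. Suc (card T) = card A \<Longrightarrow> v \<in> T \<Longrightarrow> g' T (y v) = 0"
      and \<omega>'A: "\<omega>' A \<noteq> 0" using insert.IH by blast
    obtain e :: "'a \<Rightarrow> real" where e: "linear e" "\<And>v. v \<in> insert v0 A \<Longrightarrow> e (y v) = (if v = v0 then 1 else 0)"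
      using lin_indep_family_extend[OF insert.prems, of "\<lambda>v. if v = v0 then 1 else 0"] by metis
    \<comment> \<open>Laplace expansion along a new row given by the functional \<open>e\<close>,
      which is 1 on the new vector and 0 on the old ones.\<close>
    define \<omega> where "\<omega> S = (\<Sum>v\<in>S. psign v S * e (y v) * \<omega>' (S - {v}))" for S
    \<comment> \<open>The same expansion with \<open>u\<close> as an extra column: \<open>u\<close>
      meets the new row in the leading term and otherwise enters the smaller determinants
      \<open>g'\<close>.\<close>
    define g where "g T u = e u * \<omega>' T - (\<Sum>t\<in>T. psign t T * e (y t) * g' (T - {t}) u)" for T u
    have cardT: "Suc (card (T - {t})) = card A"
      if "Suc (card T) = card (insert v0 A)" "t \<in> T" for T :: "'v set" and t
      using that insert.hyps card_Suc_Diff1[of T t] by simp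
    have "linear (g T)" if T: "Suc (card T) = card (insert v0 A)" for T
    proof (rule linearI)
      show "g T (u + w) = g T u + g T w" for u w
        using g'(1)[OF cardT[OF T]] e(1)
        by (simp add: g_def linear_add algebra_simps sum.distrib cong: sum.cong)
      show "g T (c *\<^sub>R u) = c *\<^sub>R g T u" for c u
        using g'(1)[OF cardT[OF T]] e(1)
        by (simp add: g_def linear_scale algebra_simps sum_distrib_left cong: sum.cong)
    qed
    moreover have "g T (y v) = psign v T * \<omega> (insert v T)"
      if T: "Suc (card T) = card (insert v0 A)" and v: "v \<notin> T" for T v
    proof -
      have "psign v T * \<omega> (insert v T) = psign v T * (psign v (insert v T) * e (y v) * \<omega>' (insert v T - {v}))
          + (\<Sum>t\<in>T. psign v T * (psign t (insert v T) * e (y t) * \<omega>' (insert v T - {t})))"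
        using v by (simp add: \<omega>_def distrib_left sum_distrib_left)
      also have "psign v T * (psign v (insert v T) * e (y v) * \<omega>' (insert v T - {v})) = e (y v) * \<omega>' T"
        using v by (simp add: mult.assoc)
      also have "(\<Sum>t\<in>T. psign v T * (psign t (insert v T) * e (y t) * \<omega>' (insert v T - {t})))
          = (\<Sum>t\<in>T. - (psign t T * e (y t) * g' (T - {t}) (y v)))"
      proof (intro sum.cong refl)
        fix t assume t: "t \<in> T"
        then have ne: "v \<noteq> t" using v by blast
        have 1: "insert v T - {t} = insert v (T - {t})" using ne by auto
        have "psign v (insert v T) * psign t (insert v T - {v})
            = - (psign t (insert v T) * psign v (insert v T - {t}) :: real)"
          by (rule psign_swap_Diff) (use t ne in auto)
        then have "psign v T * psign t T = - (psign t (insert v T) * psign v (T - {t}) :: real)"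
          using v by (simp add: 1)
        then have "psign t T * (psign v T * psign t T) * psign t (insert v T)
            = psign t T * (- (psign t (insert v T) * psign v (T - {t}))) * (psign t (insert v T) :: real)"
          by simp
        moreover have "psign t T * (psign v T * psign t T) * psign t (insert v T)
            = (psign t T * psign t T) * (psign v T * psign t (insert v T)) * (1 :: real)"
          by (simp only: ac_simps mult_1_right)
        moreover have "psign t T * (- (psign t (insert v T) * psign v (T - {t}))) * (psign t (insert v T) :: real)
            = - ((psign t (insert v T) * psign t (insert v T)) * (psign t T * psign v (T - {t})))"
          by (simp only: ac_simps mult_minus_right mult_minus_left)
        ultimately have 2: "psign v T * psign t (insert v T) = - (psign t T * psign v (T - {t}) :: real)"
          by (simp only: psign_square mult_1_left mult_1_right)
        have "g' (T - {t}) (y v) = psign v (T - {t}) * \<omega>' (insert v (T - {t}))"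
          by (rule g'(2)[OF cardT[OF T t]]) (use v in auto)
        then have "- (psign t T * e (y t) * g' (T - {t}) (y v))
            = (- (psign t T * psign v (T - {t}))) * (e (y t) * \<omega>' (insert v (T - {t})))" by simp
        also have "\<dots> = psign v T * (psign t (insert v T) * e (y t) * \<omega>' (insert v T - {t}))"
          unfolding 2[symmetric] 1 by simp
        finally show "psign v T * (psign t (insert v T) * e (y t) * \<omega>' (insert v T - {t}))
            = - (psign t T * e (y t) * g' (T - {t}) (y v))" by simp
      qed
      finally show ?thesis by (simp add: g_def sum_negf)
    qed
    moreover have "g T (y w) = 0"
      if T: "Suc (card T) = card (insert v0 A)" and w: "w \<in> T" for T w
    proof -
      \<comment> \<open>A repeated column: of the sum only the summand \<open>t = w\<close>
        survives, and it cancels the leading term of \<open>g\<close>.\<close>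
      have "(\<Sum>t\<in>T. psign t T * e (y t) * g' (T - {t}) (y w))
          = psign w T * e (y w) * g' (T - {w}) (y w) + (\<Sum>t\<in>T - {w}. psign t T * e (y t) * g' (T - {t}) (y w))"
        using w by (intro sum.remove) auto
      also have "(\<Sum>t\<in>T - {w}. psign t T * e (y t) * g' (T - {t}) (y w)) = 0"
        using g'(3)[OF cardT[OF T], where v = w] w by (intro sum.neutral) auto
      also have "g' (T - {w}) (y w) = psign w T * \<omega>' T"
        using g'(2)[OF cardT[OF T w], of w] w by (simp add: insert_absorb)
      finally show ?thesis by (simp add: g_def)
    qed
    moreover have "\<omega> (insert v0 A) \<noteq> 0"
    proof -
      have "\<omega> (insert v0 A) = psign v0 A * \<omega>' A
          + (\<Sum>v\<in>A. psign v (insert v0 A) * e (y v) * \<omega>' (insert v0 A - {v}))"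
        using insert.hyps e(2)[of v0] by (simp add: \<omega>_def)
      also have "(\<Sum>v\<in>A. psign v (insert v0 A) * e (y v) * \<omega>' (insert v0 A - {v})) = 0"
        using insert.hyps e(2) by (intro sum.neutral) auto
      finally show ?thesis using \<omega>'A by simp
    qed
    ultimately show ?case by (intro exI[of _ \<omega>] exI[of _ g]) blast
  qed
qed

text \<open>
  A complete simplicial fan in the \<open>d\<close>-dimensional space \<open>L\<close>: the ray of the vertex \<open>v\<close> is spanned
  by \<open>y v\<close>, and the relatively open cones over the faces of \<open>\<Delta>\<close> partition \<open>L\<close>.
\<close>

locale complete_fan =
  fixes \<Delta> :: "'v::{finite, linorder} set set" and y :: "'v \<Rightarrow> 'a::euclidean_space"
    and L :: "'a set" and d :: nat
  assumes subspace_L: "subspace L" and dim_L: "dim L = d" and y_in_L: "y v \<in> L"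
    and empty_face: "{} \<in> \<Delta>" and face_subset: "S \<in> \<Delta> \<Longrightarrow> T \<subseteq> S \<Longrightarrow> T \<in> \<Delta>"
    and cover: "u \<in> L \<Longrightarrow> \<exists>S\<in>\<Delta>. \<exists>c. (\<forall>v\<in>S. c v > 0) \<and> u = (\<Sum>v\<in>S. c v *\<^sub>R y v)"
    and unique: "S \<in> \<Delta> \<Longrightarrow> T \<in> \<Delta> \<Longrightarrow> (\<And>v. v \<in> S \<Longrightarrow> c v > 0) \<Longrightarrow> (\<And>v. v \<in> T \<Longrightarrow> e v > 0) \<Longrightarrow>
      (\<Sum>v\<in>S. c v *\<^sub>R y v) = (\<Sum>v\<in>T. e v *\<^sub>R y v) \<Longrightarrow> S = T \<and> (\<forall>v\<in>S. c v = e v)"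
begin

lemma unique_nonneg:
  assumes S: "S \<in> \<Delta>" and T: "T \<in> \<Delta>" and c: "\<And>v. v \<in> S \<Longrightarrow> c v \<ge> 0" and e: "\<And>v. v \<in> T \<Longrightarrow> e v \<ge> 0"
    and eq: "(\<Sum>v\<in>S. c v *\<^sub>R y v) = (\<Sum>v\<in>T. e v *\<^sub>R y v)"
  shows "{v \<in> S. c v > 0} = {v \<in> T. e v > 0}"
proof (rule unique[THEN conjunct1])
  show "{v \<in> S. c v > 0} \<in> \<Delta>" "{v \<in> T. e v > 0} \<in> \<Delta>"
    by (rule face_subset[OF S], blast, rule face_subset[OF T], blast)
  have "(\<Sum>v\<in>{v \<in> S. c v > 0}. c v *\<^sub>R y v) = (\<Sum>v\<in>S. c v *\<^sub>R y v)"
    using c by (intro sum.mono_neutral_left) (auto simp: less_le)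
  also have "\<dots> = (\<Sum>v\<in>{v \<in> T. e v > 0}. e v *\<^sub>R y v)"
    unfolding eq using e by (intro sum.mono_neutral_right) (auto simp: less_le)
  finally show "(\<Sum>v\<in>{v \<in> S. c v > 0}. c v *\<^sub>R y v) = (\<Sum>v\<in>{v \<in> T. e v > 0}. e v *\<^sub>R y v)" .
qed auto

text \<open>The positive and negative parts of a linear relation are two nonnegative combinations of
  one vector over the same face. Their supports are disjoint and, by uniqueness, equal, so both are
  empty.\<close>

lemma lin_indep_face:
  assumes S: "S \<in> \<Delta>" shows "lin_indep_family y S"
  unfolding lin_indep_family_def
proof (intro conjI allI impI ballI)
  fix a v assume 0: "(\<Sum>v\<in>S. a v *\<^sub>R y v) = 0" and v: "v \<in> S"
  let ?c = "\<lambda>v. max (a v) 0" and ?e = "\<lambda>v. max (- a v) 0"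
  have "(\<Sum>v\<in>S. ?c v *\<^sub>R y v) - (\<Sum>v\<in>S. ?e v *\<^sub>R y v) = (\<Sum>v\<in>S. a v *\<^sub>R y v)"
    unfolding sum_subtractf[symmetric] scaleR_diff_left[symmetric] by (intro sum.cong refl) (auto simp: max_def)
  then have eq: "(\<Sum>v\<in>S. ?c v *\<^sub>R y v) = (\<Sum>v\<in>S. ?e v *\<^sub>R y v)" using 0 by simp
  have "{v \<in> S. ?c v > 0} = {v \<in> S. ?e v > 0}"
    by (rule unique_nonneg[OF S S _ _ eq]) auto
  then have "v \<in> {v \<in> S. ?c v > 0} \<longleftrightarrow> v \<in> {v \<in> S. ?e v > 0}" by blast
  then show "a v = 0" using v by (cases "a v" "0 :: real" rule: linorder_cases) auto
qed simp

lemma card_face_le: "S \<in> \<Delta> \<Longrightarrow> card S \<le> d"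
proof -
  assume S: "S \<in> \<Delta>"
  have "card (y ` S) \<le> dim L"
    by (rule independent_card_le_dim)
      (use y_in_L lin_indep_family_independent[OF lin_indep_face[OF S]] in auto)
  then show ?thesis by (simp add: card_image[OF lin_indep_family_inj[OF lin_indep_face[OF S]]] dim_L)
qed

lemma y_nonzero: "{v} \<in> \<Delta> \<Longrightarrow> y v \<noteq> 0"
  using lin_indep_familyD[OF lin_indep_face[of "{v}"], of "\<lambda>_. 1" v] by auto

text \<open>
  Infinitely many of the points \<open>u + n *\<^sub>R y w\<close> lie in the same cone.  Their coefficients are affine in \<open>n\<close>
  with nonnegative slopes, and the slopes represent \<open>y w\<close>.
\<close>

lemma ray_meets_star:
  assumes w: "{w} \<in> \<Delta>" and u: "u \<in> L"
  shows "\<exists>S\<in>\<Delta>. \<exists>c t. w \<in> S \<and> (\<forall>v\<in>S. c v > 0) \<and> u + t *\<^sub>R y w = (\<Sum>v\<in>S. c v *\<^sub>R y v)"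
proof -
  have "\<exists>S c. S \<in> \<Delta> \<and> (\<forall>v\<in>S. c v > 0) \<and> u + real n *\<^sub>R y w = (\<Sum>v\<in>S. c v *\<^sub>R y v)" for n :: nat
    using cover[of "u + real n *\<^sub>R y w"] u y_in_L subspace_L by (meson subspace_add subspace_scale)
  then obtain S c where Sc: "\<And>n. S n \<in> \<Delta>" "\<And>n v. v \<in> S n \<Longrightarrow> c n v > 0"
    "\<And>n. u + real n *\<^sub>R y w = (\<Sum>v\<in>S n. c n v *\<^sub>R y v)" by metis
  have "finite (range S)" by simp
  then obtain k where inf: "infinite {n. S n = S k}"
    using inf_img_fin_dom[of S UNIV] by (auto simp: vimage_def)
  obtain m where m: "S m = S k" "m > k"
    using inf finite_subset[of "{n. S n = S k}" "{..k}"] by (force simp: not_less)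
  define \<beta> where "\<beta> v = (c m v - c k v) / (real m - real k)" for v
  have mk: "real m - real k > 0" using m(2) by simp
  have step: "(\<Sum>v\<in>S k. \<beta> v *\<^sub>R y v) = y w"
  proof -
    have "(real m - real k) *\<^sub>R (\<Sum>v\<in>S k. \<beta> v *\<^sub>R y v) = (\<Sum>v\<in>S k. (c m v - c k v) *\<^sub>R y v)"
      using mk by (simp add: scaleR_sum_right \<beta>_def)
    also have "\<dots> = (u + real m *\<^sub>R y w) - (u + real k *\<^sub>R y w)"
      unfolding Sc(3) m(1) by (simp add: scaleR_diff_left sum_subtractf)
    also have "\<dots> = (real m - real k) *\<^sub>R y w" by (simp add: scaleR_diff_left)
    finally show ?thesis using mk by simp
  qed
  have coeff: "c n v = c k v + (real n - real k) * \<beta> v" if n: "S n = S k" and v: "v \<in> S k" for n v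
  proof -
    have "(\<Sum>v\<in>S k. (c n v - c k v - (real n - real k) * \<beta> v) *\<^sub>R y v)
        = (\<Sum>v\<in>S n. c n v *\<^sub>R y v) - (\<Sum>v\<in>S k. c k v *\<^sub>R y v) - (real n - real k) *\<^sub>R (\<Sum>v\<in>S k. \<beta> v *\<^sub>R y v)"
      unfolding n by (simp add: scaleR_diff_left sum_subtractf scaleR_sum_right)
    also have "\<dots> = 0" unfolding Sc(3)[symmetric] step by (simp add: algebra_simps)
    finally have "c n v - c k v - (real n - real k) * \<beta> v = 0"
      using lin_indep_familyD[OF lin_indep_face[OF Sc(1)[of k]],
          of "\<lambda>v. c n v - c k v - (real n - real k) * \<beta> v"] v by simp
    then show ?thesis by simp
  qed
  have \<beta>: "\<beta> v \<ge> 0" if v: "v \<in> S k" for v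
  proof (rule ccontr)
    assume "\<not> \<beta> v \<ge> 0"
    then have neg: "\<beta> v < 0" by simp
    \<comment> \<open>Beyond this bound a negative slope makes the coefficient of \<open>v\<close>
      negative, while infinitely many \<open>n\<close> with the same face are available.\<close>
    obtain N :: nat where N: "real N > real k + c k v / (- \<beta> v)" using reals_Archimedean2 by blast
    obtain n where n: "S n = S k" "n > N"
      using inf finite_subset[of "{n. S n = S k}" "{..N}"] by (force simp: not_less)
    have "real n - real k > c k v / (- \<beta> v)" using N n(2) by simp
    then have "(real n - real k) * (- \<beta> v) > c k v"
      using neg pos_divide_less_eq[of "- \<beta> v" "c k v" "real n - real k"] by linarith
    then have "c n v < 0" using coeff[OF n(1) v] by simp
    then show False using Sc(2)[of v n] n(1) v by simp
  qed
  have eq: "(\<Sum>v\<in>S k. \<beta> v *\<^sub>R y v) = (\<Sum>v\<in>{w}. 1 *\<^sub>R y v)" using step by simp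
  have "{v \<in> S k. \<beta> v > 0} = {v \<in> {w}. (1::real) > 0}"
    by (rule unique_nonneg[OF Sc(1) w \<beta> _ eq]) auto
  then have "w \<in> {v \<in> S k. \<beta> v > 0}" by simp
  then have "w \<in> S k" by simp
  then show ?thesis
    using Sc(1)[of k] Sc(2)[of _ k] Sc(3)[of k]
    by (intro bexI[of _ "S k"] exI[of _ "c k"] exI[of _ "real k"]) auto
qed

text \<open>Orthogonal projection along \<open>y w\<close>. The projected cones cover because every
  vector can be moved in the direction \<open>y w\<close> into a cone whose face contains
  \<open>w\<close>; they do not overlap because adding a large multiple of \<open>y w\<close> lifts
  equal projections to equal points over faces containing \<open>w\<close>. The relation between
  \<open>y'\<close> and \<open>y\<close> is kept for comparing determinants.\<close>

lemma vertex_link: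
  assumes w: "{w} \<in> \<Delta>"
  shows "\<exists>y' L'. complete_fan {T. w \<notin> T \<and> insert w T \<in> \<Delta>} y' L' (d - 1) \<and>
    (\<forall>v. \<exists>t. y' v = y v - t *\<^sub>R y w)"
proof -
  define t where "t v = (y v \<bullet> y w) / (y w \<bullet> y w)" for v
  define y' where "y' v = y v - t v *\<^sub>R y w" for v
  define L' where "L' = {u \<in> L. u \<bullet> y w = 0}"
  have ww: "y w \<bullet> y w > 0" using y_nonzero[OF w] by simp
  have "complete_fan {T. w \<notin> T \<and> insert w T \<in> \<Delta>} y' L' (d - 1)"
  proof
    show "subspace L'"
      using subspace_L by (auto simp: L'_def subspace_def inner_add_left)
    have "dim {u \<in> L. \<forall>x \<in> span {y w}. orthogonal x u} + dim (span {y w}) = dim L"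
      by (rule dim_subspace_orthogonal_to_vectors)
        (use subspace_L y_in_L span_minimal[of "{y w}" L] in auto)
    moreover have "{u \<in> L. \<forall>x \<in> span {y w}. orthogonal x u} = L'"
      by (auto simp: L'_def span_singleton orthogonal_def inner_commute)
    moreover have "dim (span {y w}) = 1" using y_nonzero[OF w] by (simp add: dim_span)
    ultimately show "dim L' = d - 1" using dim_L by simp
    show "y' v \<in> L'" for v
      using ww subspace_L y_in_L by (simp add: L'_def y'_def t_def inner_diff_left subspace_diff subspace_scale)
    show "{} \<in> {T. w \<notin> T \<and> insert w T \<in> \<Delta>}" using w by simp
    show "T \<in> {T. w \<notin> T \<and> insert w T \<in> \<Delta>}" if "S \<in> {T. w \<notin> T \<and> insert w T \<in> \<Delta>}" "T \<subseteq> S" for S T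
      using that face_subset[of "insert w S" "insert w T"] by auto
  next
    fix u assume u: "u \<in> L'"
    then obtain S c s where S: "S \<in> \<Delta>" "w \<in> S" "\<forall>v\<in>S. c v > 0" "u + s *\<^sub>R y w = (\<Sum>v\<in>S. c v *\<^sub>R y v)"
      using ray_meets_star[OF w, of u] by (auto simp: L'_def)
    let ?p = "\<lambda>x. x - ((x \<bullet> y w) / (y w \<bullet> y w)) *\<^sub>R y w"
    have lin: "linear ?p"
      by (rule linearI) (simp_all add: inner_add_left add_divide_distrib algebra_simps)
    have "u = ?p (u + s *\<^sub>R y w)" using u ww by (simp add: L'_def inner_add_left)
    also have "\<dots> = (\<Sum>v\<in>S. c v *\<^sub>R y' v)"
      unfolding S(4) linear_sum[OF lin] linear_scale[OF lin] by (simp add: y'_def t_def)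
    also have "\<dots> = c w *\<^sub>R y' w + (\<Sum>v\<in>S - {w}. c v *\<^sub>R y' v)" using S(2) by (intro sum.remove) auto
    also have "y' w = 0" using ww by (simp add: y'_def t_def)
    finally have "u = (\<Sum>v\<in>S - {w}. c v *\<^sub>R y' v)" by simp
    moreover have "S - {w} \<in> {T. w \<notin> T \<and> insert w T \<in> \<Delta>}" using S(1,2) by (simp add: insert_absorb)
    ultimately show "\<exists>S\<in>{T. w \<notin> T \<and> insert w T \<in> \<Delta>}. \<exists>c. (\<forall>v\<in>S. c v > 0) \<and> u = (\<Sum>v\<in>S. c v *\<^sub>R y' v)"
      using S(3) by (intro bexI[of _ "S - {w}"] exI[of _ c]) auto
  next
    fix S T c e
    assume S: "S \<in> {T. w \<notin> T \<and> insert w T \<in> \<Delta>}" and T: "T \<in> {T. w \<notin> T \<and> insert w T \<in> \<Delta>}"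
      and c: "\<And>v. v \<in> S \<Longrightarrow> c v > (0 :: real)" and e: "\<And>v. v \<in> T \<Longrightarrow> e v > (0 :: real)"
      and eq: "(\<Sum>v\<in>S. c v *\<^sub>R y' v) = (\<Sum>v\<in>T. e v *\<^sub>R y' v)"
    define a where "a = (\<Sum>v\<in>S. c v * t v)"
    define b where "b = (\<Sum>v\<in>T. e v * t v)"
    \<comment> \<open>Larger than \<open>a\<close> and \<open>b\<close>, so that in both lifts of
      the common vector by \<open>M *\<^sub>R y w\<close> the coefficient of \<open>w\<close>,
      \<open>M - a\<close> or \<open>M - b\<close>, is positive.\<close>
    define M where "M = max a b + 1"
    let ?c = "\<lambda>v. if v = w then M - a else c v" and ?e = "\<lambda>v. if v = w then M - b else e v"
    have s1: "(\<Sum>v\<in>S. c v *\<^sub>R y' v) = (\<Sum>v\<in>S. c v *\<^sub>R y v) - a *\<^sub>R y w"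
      by (simp add: y'_def a_def scaleR_diff_right sum_subtractf scaleR_sum_left)
    have s2: "(\<Sum>v\<in>T. e v *\<^sub>R y' v) = (\<Sum>v\<in>T. e v *\<^sub>R y v) - b *\<^sub>R y w"
      by (simp add: y'_def b_def scaleR_diff_right sum_subtractf scaleR_sum_left)
    have "(\<Sum>v\<in>insert w S. ?c v *\<^sub>R y v) = (M - a) *\<^sub>R y w + (\<Sum>v\<in>S. ?c v *\<^sub>R y v)"
      using S by simp
    also have "(\<Sum>v\<in>S. ?c v *\<^sub>R y v) = (\<Sum>v\<in>S. c v *\<^sub>R y v)" using S by (intro sum.cong) auto
    finally have 1: "(\<Sum>v\<in>insert w S. ?c v *\<^sub>R y v) = M *\<^sub>R y w + (\<Sum>v\<in>S. c v *\<^sub>R y' v)"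
      unfolding s1 by (simp add: algebra_simps)
    have "(\<Sum>v\<in>insert w T. ?e v *\<^sub>R y v) = (M - b) *\<^sub>R y w + (\<Sum>v\<in>T. ?e v *\<^sub>R y v)"
      using T by simp
    also have "(\<Sum>v\<in>T. ?e v *\<^sub>R y v) = (\<Sum>v\<in>T. e v *\<^sub>R y v)" using T by (intro sum.cong) auto
    finally have 2: "(\<Sum>v\<in>insert w T. ?e v *\<^sub>R y v) = M *\<^sub>R y w + (\<Sum>v\<in>T. e v *\<^sub>R y' v)"
      unfolding s2 by (simp add: algebra_simps)
    have "insert w S = insert w T \<and> (\<forall>v\<in>insert w S. ?c v = ?e v)"
    proof (rule unique)
      show "insert w S \<in> \<Delta>" "insert w T \<in> \<Delta>" using S T by auto
      show "?c v > 0" if "v \<in> insert w S" for v using that c by (auto simp: M_def)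
      show "?e v > 0" if "v \<in> insert w T" for v using that e by (auto simp: M_def)
      show "(\<Sum>v\<in>insert w S. ?c v *\<^sub>R y v) = (\<Sum>v\<in>insert w T. ?e v *\<^sub>R y v)" unfolding 1 2 eq ..
    qed
    moreover have "w \<notin> S" "w \<notin> T" using S T by auto
    ultimately show "S = T \<and> (\<forall>v\<in>S. c v = e v)" by (metis insert_ident insertCI)
  qed
  then show ?thesis by (auto simp: y'_def)
qed

end

text \<open>Links of faces arise by iterating vertex links. The last clause says that a linear
  functional vanishing on the rays of \<open>F\<close> cannot distinguish \<open>y v\<close> from
  \<open>y' v\<close>.\<close>

lemma face_link:
  assumes "complete_fan \<Delta> y L d" "F \<in> \<Delta>"
  shows "\<exists>y' L'. complete_fan {T. T \<inter> F = {} \<and> T \<union> F \<in> \<Delta>} y' L' (d - card F) \<and>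
    (\<forall>v. y v - y' v \<in> span (y ` F))"
proof -
  interpret complete_fan \<Delta> y L d by fact
  have "finite F" by simp
  then show ?thesis using assms(2)
  proof (induction F rule: finite_induct)
    case empty
    have "{T. T \<inter> {} = {} \<and> T \<union> {} \<in> \<Delta>} = \<Delta>" by simp
    then show ?case using assms(1) by (intro exI[of _ y] exI[of _ L]) (simp add: span_zero)
  next
    case (insert w F)
    let ?l = "\<lambda>F. {T. T \<inter> F = {} \<and> T \<union> F \<in> \<Delta>}"
    have "F \<in> \<Delta>" using insert.prems face_subset by blast
    then obtain y' L' where y': "complete_fan (?l F) y' L' (d - card F)" "\<And>v. y v - y' v \<in> span (y ` F)"
      using insert.IH by blast
    have w: "{w} \<in> ?l F" using insert by simp
    obtain y'' L'' where "complete_fan {T. w \<notin> T \<and> insert w T \<in> ?l F} y'' L'' (d - card F - 1) \<and>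
        (\<forall>v. \<exists>t. y'' v = y' v - t *\<^sub>R y' w)"
      using complete_fan.vertex_link[OF y'(1) w] by (elim exE)
    then have y'': "complete_fan {T. w \<notin> T \<and> insert w T \<in> ?l F} y'' L'' (d - card F - 1)"
      "\<And>v. \<exists>t. y'' v = y' v - t *\<^sub>R y' w" by blast+
    have e1: "{T. w \<notin> T \<and> insert w T \<in> ?l F} = ?l (insert w F)" using insert.hyps by auto
    have e2: "d - card F - 1 = d - card (insert w F)" using insert.hyps by simp
    have "y v - y'' v \<in> span (y ` insert w F)" for v
    proof -
      obtain t where t: "y'' v = y' v - t *\<^sub>R y' w" using y''(2) by blast
      have sub: "span (y ` F) \<subseteq> span (y ` insert w F)" by (rule span_mono) auto
      have "y v - y'' v = (y v - y' v) + t *\<^sub>R (y w - (y w - y' w))" by (simp add: t)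
      also have "\<dots> \<in> span (y ` insert w F)"
      proof (rule span_add)
        show "y v - y' v \<in> span (y ` insert w F)" using y'(2)[of v] sub by blast
        show "t *\<^sub>R (y w - (y w - y' w)) \<in> span (y ` insert w F)"
        proof (rule span_scale, rule span_diff)
          show "y w \<in> span (y ` insert w F)" by (rule span_base) simp
          show "y w - y' w \<in> span (y ` insert w F)" using y'(2)[of w] sub by blast
        qed
      qed
      finally show ?thesis .
    qed
    then show ?case using y''(1)[unfolded e1 e2] by blast
  qed
qed

text \<open>A nonzero vector of \<open>L\<close> lies in the cone of a nonempty face. The link of
  one of its vertices has dimension one less, and a facet of this link is completed by the
  vertex.\<close>

lemma facet_exists:
  fixes y :: "'v::{finite, linorder} \<Rightarrow> 'a::euclidean_space"
  assumes "complete_fan \<Delta> y L d"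
  shows "\<exists>F\<in>\<Delta>. card F = d"
  using assms
proof (induction d arbitrary: \<Delta> y L)
  case 0
  interpret complete_fan \<Delta> y L 0 by (rule 0)
  show ?case using empty_face by (intro bexI[of _ "{}"]) auto
next
  case (Suc d)
  interpret complete_fan \<Delta> y L "Suc d" by (rule Suc.prems)
  have "L \<noteq> {0}" using dim_L by auto
  then obtain u where u: "u \<in> L" "u \<noteq> 0" using subspace_0[OF subspace_L] by blast
  obtain S c where S: "S \<in> \<Delta>" "u = (\<Sum>v\<in>S. c v *\<^sub>R y v)" using cover[OF u(1)] by blast
  then obtain w where w: "w \<in> S" using u(2) by fastforce
  then have "{w} \<in> \<Delta>" using face_subset[OF S(1)] by blast
  then obtain y' :: "'v \<Rightarrow> 'a" and L' where "complete_fan {T. w \<notin> T \<and> insert w T \<in> \<Delta>} y' L' d"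
    using vertex_link by fastforce
  from Suc.IH[OF this] obtain T where "w \<notin> T" "insert w T \<in> \<Delta>" "card T = d" by blast
  then show ?case by (intro bexI[of _ "insert w T"]) auto
qed

section \<open>Top cycles of complete fans\<close>

text \<open>On a line, two vertices on the same side span the same ray and coincide by uniqueness,
  while the vector opposite to \<open>y a\<close> has to be covered by a second vertex.\<close>

lemma line_fan:
  assumes "complete_fan \<Delta> y L 1"
  obtains a b c where "a \<noteq> b" "{v. {v} \<in> \<Delta>} = {a, b}" "c > 0" "y b = - c *\<^sub>R y a"
proof -
  interpret complete_fan \<Delta> y L 1 by (rule assms)
  have single: "\<exists>v. S = {v}" if "S \<in> \<Delta>" "S \<noteq> {}" for S
    using card_face_le[OF that(1)] that(2) card_1_singletonE[of S] by (cases "card S") auto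
  obtain F where F: "F \<in> \<Delta>" "card F = 1" using facet_exists[OF assms] by blast
  then obtain a where a: "{a} \<in> \<Delta>" by (auto simp: card_1_singleton_iff)
  have ya: "y a \<noteq> 0" by (rule y_nonzero[OF a])
  obtain S e where S: "S \<in> \<Delta>" "\<forall>v\<in>S. e v > 0" "- y a = (\<Sum>v\<in>S. e v *\<^sub>R y v)"
    using cover[of "- y a"] subspace_neg[OF subspace_L y_in_L] by blast
  have "S \<noteq> {}" using S(3) ya by auto
  then obtain b where b: "S = {b}" using single S(1) by blast
  then have eb: "e b > 0" "- y a = e b *\<^sub>R y b" using S by auto
  have "y b = (1 / e b) *\<^sub>R (e b *\<^sub>R y b)" using eb(1) by simp
  then have yb: "y b = - (1 / e b) *\<^sub>R y a" unfolding eb(2)[symmetric] by simp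
  have "y a = - (- y a)" by simp
  then have ya': "y a = - e b *\<^sub>R y b" unfolding eb(2) by simp
  have same: "v = u" if "{v} \<in> \<Delta>" "{u} \<in> \<Delta>" "y v = t *\<^sub>R y u" "t > 0" for u v t
    using unique[OF that(1,2), of "\<lambda>_. 1" "\<lambda>_. t"] that(3,4) by auto
  have "a \<noteq> b"
  proof
    assume "a = b"
    then have h: "y a = - (1 / e b) *\<^sub>R y a" using yb by simp
    have "y a + (1 / e b) *\<^sub>R y a = 0" by (subst (1) h) simp
    then have "(1 + 1 / e b) *\<^sub>R y a = 0" by (simp add: scaleR_add_left)
    moreover have "1 + 1 / e b \<noteq> 0" using eb(1) by (smt (verit) zero_less_divide_1_iff)
    ultimately show False using ya by simp
  qed
  moreover have "{v. {v} \<in> \<Delta>} = {a, b}"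
  proof
    show "{a, b} \<subseteq> {v. {v} \<in> \<Delta>}" using a b S(1) by auto
    show "{v. {v} \<in> \<Delta>} \<subseteq> {a, b}"
    proof
      fix v assume "v \<in> {v. {v} \<in> \<Delta>}"
      then have v: "{v} \<in> \<Delta>" by simp
      have "L \<subseteq> span {y a}"
        by (rule card_ge_dim_independent) (use y_in_L dim_L ya in auto)
      then obtain t where t: "y v = t *\<^sub>R y a" using y_in_L[of v] by (auto simp: span_singleton)
      have "t \<noteq> 0" using t y_nonzero[OF v] by auto
      show "v \<in> {a, b}"
      proof (cases "t > 0")
        case True
        then show ?thesis using same[OF v a t] by simp
      next
        case False
        have "y v = (- t * e b) *\<^sub>R y b" unfolding t by (subst ya') simp
        moreover have "- t * e b > 0" using False \<open>t \<noteq> 0\<close> eb(1) by (simp add: mult_neg_pos)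
        moreover have "{b} \<in> \<Delta>" using b S(1) by simp
        ultimately have "v = b" using same[OF v] by blast
        then show ?thesis by simp
      qed
    qed
  qed
  ultimately show thesis using that[of a b "1 / e b"] eb(1) yb by simp
qed

lemma psign_sign:
  assumes "r \<noteq> (0 :: real)"
  shows "psign v T * (if r > 0 then 1 else - 1) = (if psign v T * r > 0 then 1 else - 1 :: 'k::comm_ring_1)"
  using assms by (cases "even (card {u \<in> T. u < v})") (auto simp: psign_def)

text \<open>On facets \<open>z\<close> is the sign of the determinant \<open>\<omega>\<close>, an
  orientation induced from \<open>L\<close>. At a face \<open>T\<close> of codimension one the link
  is a pair of opposite rays, on which the functional \<open>g T\<close> has opposite signs, so the
  two boundary terms cancel.\<close>

lemma top_cycle_exists:
  fixes y :: "'v::{finite, linorder} \<Rightarrow> 'a::euclidean_space"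
  assumes fan: "complete_fan \<Delta> y L d"
  shows "\<exists>z :: 'v set \<Rightarrow> 'k::field. (\<exists>S. z S \<noteq> 0) \<and> (\<forall>S. z S \<noteq> 0 \<longrightarrow> S \<in> \<Delta> \<and> card S = d) \<and>
    (\<forall>T. simplicial_boundary z T = 0)"
proof -
  interpret complete_fan \<Delta> y L d by (rule fan)
  obtain F where F: "F \<in> \<Delta>" "card F = d" using facet_exists[OF fan] by blast
  obtain \<omega> :: "'v set \<Rightarrow> real" and g where
    g: "\<And>T. Suc (card T) = d \<Longrightarrow> linear (g T)"
      "\<And>T v. Suc (card T) = d \<Longrightarrow> v \<notin> T \<Longrightarrow> g T (y v) = psign v T * \<omega> (insert v T)"
      "\<And>T v. Suc (card T) = d \<Longrightarrow> v \<in> T \<Longrightarrow> g T (y v) = 0"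
    and \<omega>F: "\<omega> F \<noteq> 0"
    using alternating_form_exists[OF lin_indep_face[OF F(1)]] unfolding F(2) by blast
  have nz: "\<omega> S \<noteq> 0" if S: "S \<in> \<Delta>" "card S = d" for S
  proof -
    have "L \<subseteq> span (y ` S)"
      by (rule card_ge_dim_independent)
        (use y_in_L dim_L S lin_indep_family_independent[OF lin_indep_face[OF S(1)]]
          card_image[OF lin_indep_family_inj[OF lin_indep_face[OF S(1)]]] in auto)
    then have span: "y v \<in> span (y ` S)" for v using y_in_L by blast
    \<comment> \<open>Steinitz exchange: in a set with nonzero determinant, an element outside
      \<open>S\<close> is replaced by one of \<open>S\<close> while the determinant stays
      nonzero.\<close>
    have "\<omega> S \<noteq> 0" if "\<omega> S1 \<noteq> 0" "card S1 = d" for S1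
      using that
    proof (induction "card (S1 - S)" arbitrary: S1 rule: less_induct)
      case less
      show ?case
      proof (cases "S1 \<subseteq> S")
        case True
        then have "S1 = S" using less.prems(2) S(2) by (simp add: card_subset_eq)
        then show ?thesis using less.prems(1) by simp
      next
        case False
        then obtain u where u: "u \<in> S1" "u \<notin> S" by blast
        let ?T = "S1 - {u}"
        have T: "Suc (card ?T) = d" using u(1) less.prems(2) card_Suc_Diff1[of S1 u] by simp
        have "g ?T (y u) = psign u ?T * \<omega> S1" using g(2)[OF T, of u] u(1) by (simp add: insert_absorb)
        then have gu: "g ?T (y u) \<noteq> 0" using less.prems(1) by simp
        have "\<exists>v\<in>S. g ?T (y v) \<noteq> 0"
        proof (rule ccontr)
          assume "\<not> (\<exists>v\<in>S. g ?T (y v) \<noteq> 0)"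
          then have "g ?T x = 0" if "x \<in> y ` S" for x using that by auto
          then have "g ?T (y u) = 0" using linear_eq_0_on_span[OF g(1)[OF T] _ span] by blast
          then show False using gu by simp
        qed
        then obtain v where v: "v \<in> S" "g ?T (y v) \<noteq> 0" by blast
        have vT: "v \<notin> ?T" using g(3)[OF T, of v] v(2) by blast
        then have \<omega>: "\<omega> (insert v ?T) \<noteq> 0" using g(2)[OF T vT] v(2) by auto
        have c: "card (insert v ?T) = d" using vT T by simp
        have "insert v ?T - S \<subset> S1 - S" using u v(1) by auto
        then have "card (insert v ?T - S) < card (S1 - S)" by (intro psubset_card_mono) auto
        then show ?thesis using less.hyps[OF _ \<omega> c] by blast
      qed
    qed
    then show ?thesis using \<omega>F F(2) by blast
  qed
  define z :: "'v set \<Rightarrow> 'k" where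
    "z S = (if S \<in> \<Delta> \<and> card S = d then (if \<omega> S > 0 then 1 else - 1) else 0)" for S
  have "simplicial_boundary z T = 0" for T
  proof (cases "Suc (card T) = d")
    case False
    then have "z (insert v T) = 0" if "v \<in> - T" for v using that by (auto simp: z_def)
    then show ?thesis by (simp add: simplicial_boundary_def)
  next
    case T: True
    let ?P = "{v. v \<notin> T \<and> insert v T \<in> \<Delta>}"
    have bd: "simplicial_boundary z T = (\<Sum>v\<in>?P. if g T (y v) > 0 then 1 else - 1)"
    proof -
      have "simplicial_boundary z T = (\<Sum>v\<in>?P. psign v T * z (insert v T))"
        unfolding simplicial_boundary_def by (rule sum.mono_neutral_right) (auto simp: z_def)
      also have "\<dots> = (\<Sum>v\<in>?P. if g T (y v) > 0 then 1 else - 1)"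
      proof (intro sum.cong refl)
        fix v assume v: "v \<in> ?P"
        then have "card (insert v T) = d" using T by simp
        then have "z (insert v T) = (if \<omega> (insert v T) > 0 then 1 else - 1)" "\<omega> (insert v T) \<noteq> 0"
          using v nz by (auto simp: z_def)
        then show "psign v T * z (insert v T) = (if g T (y v) > 0 then 1 else - 1)"
          using psign_sign[of "\<omega> (insert v T)" v T, where 'k='k] g(2)[OF T, of v] v by simp
      qed
      finally show ?thesis .
    qed
    show ?thesis
    proof (cases "?P = {}")
      case True
      then show ?thesis unfolding bd True by simp
    next
      case False
      then obtain v0 where "insert v0 T \<in> \<Delta>" by blast
      then have "T \<in> \<Delta>" using face_subset by blast
      moreover have "d - card T = 1" using T by simp
      ultimately obtain y' :: "'v \<Rightarrow> 'a" and L' where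
        y': "complete_fan {S. S \<inter> T = {} \<and> S \<union> T \<in> \<Delta>} y' L' 1" "\<And>v. y v - y' v \<in> span (y ` T)"
        using face_link[OF fan, of T] by auto
      obtain a b c where abc: "a \<noteq> b" "{v. {v} \<in> {S. S \<inter> T = {} \<and> S \<union> T \<in> \<Delta>}} = {a, b}"
        "c > 0" "y' b = - c *\<^sub>R y' a"
        using line_fan[OF y'(1)] by blast
      have P: "?P = {a, b}" using abc(2) by auto
      \<comment> \<open>\<open>g T\<close> vanishes on the rays of \<open>T\<close>, so it does not
        notice the projection to the link and can be evaluated on the opposite vectors
        \<open>y' a\<close> and \<open>y' b\<close>.\<close>
      have g': "g T (y v) = g T (y' v)" for v
      proof -
        have "g T (y v - y' v) = 0"
          by (rule linear_eq_0_on_span[OF g(1)[OF T] _ y'(2)]) (use g(3)[OF T] in auto)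
        then show ?thesis by (simp add: linear_diff[OF g(1)[OF T]])
      qed
      have a: "a \<notin> T" "insert a T \<in> \<Delta>" using P by auto
      then have "\<omega> (insert a T) \<noteq> 0" using nz T by simp
      then have ga: "g T (y a) \<noteq> 0" using g(2)[OF T a(1)] by simp
      have "g T (y b) = - c * g T (y a)"
        unfolding g' abc(4) by (simp add: linear_scale[OF g(1)[OF T]] linear_neg[OF g(1)[OF T]])
      then have "g T (y b) > 0 \<longleftrightarrow> \<not> g T (y a) > 0"
        using ga abc(3) by (auto simp: mult_less_0_iff zero_less_mult_iff)
      then show ?thesis unfolding bd P using abc(1) by simp
    qed
  qed
  moreover have "z F \<noteq> 0" using F by (simp add: z_def)
  moreover have "S \<in> \<Delta> \<and> card S = d" if "z S \<noteq> 0" for S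
    using that by (auto simp: z_def split: if_splits)
  ultimately show ?thesis by blast
qed

definition link_cycle :: "'v::linorder \<Rightarrow> ('v set \<Rightarrow> 'k::comm_ring_1) \<Rightarrow> 'v set \<Rightarrow> 'k" where
  "link_cycle v z T = (if v \<in> T then 0 else psign v T * z (insert v T))"

text \<open>For \<open>v\<close> outside \<open>T\<close> the boundary at \<open>T\<close> is, up to
  sign, the boundary of \<open>z\<close> at \<open>insert v T\<close>; for \<open>v\<close> in
  \<open>T\<close> every term is zero. Thus cycles restrict to cycles of vertex links.\<close>

lemma simplicial_boundary_link_cycle:
  fixes z :: "'v::{finite, linorder} set \<Rightarrow> 'k::comm_ring_1"
  assumes "\<And>T. simplicial_boundary z T = 0"
  shows "simplicial_boundary (link_cycle v z) T = 0"
proof (cases "v \<in> T")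
  case True
  then show ?thesis by (simp add: simplicial_boundary_def link_cycle_def)
next
  case False
  have "simplicial_boundary (link_cycle v z) T
      = (\<Sum>w\<in>- insert v T. psign w T * link_cycle v z (insert w T))"
    unfolding simplicial_boundary_def by (rule sum.mono_neutral_right) (auto simp: link_cycle_def)
  also have "\<dots> = (\<Sum>w\<in>- insert v T. - psign v T * (psign w (insert v T) * z (insert w (insert v T))))"
  proof (intro sum.cong refl)
    fix w assume w: "w \<in> - insert v T"
    have "psign w T * psign v (insert w T) = - (psign v T * psign w (insert v T) :: 'k)"
      by (rule psign_swap) (use w False in auto)
    then have "psign w T * (psign v (insert w T) * z (insert v (insert w T)))
        = - (psign v T * psign w (insert v T)) * z (insert v (insert w T))"
      by (simp add: mult.assoc[symmetric])
    then show "psign w T * link_cycle v z (insert w T)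
        = - psign v T * (psign w (insert v T) * z (insert w (insert v T)))"
      using w False by (auto simp: link_cycle_def insert_commute mult.assoc)
  qed
  also have "\<dots> = - psign v T * simplicial_boundary z (insert v T)"
    by (simp add: simplicial_boundary_def sum_distrib_left)
  finally show ?thesis using assms by simp
qed

section \<open>Connectedness of the 1-skeleton of a fan\<close>

context complete_fan
begin

definition face_cone :: "'v set \<Rightarrow> 'a set" where
  "face_cone S = {(\<Sum>v\<in>S. c v *\<^sub>R y v) | c. \<forall>v\<in>S. c v \<ge> 0}"

text \<open>Independent rays admit coordinate functionals, so the cone is cut out of a subspace by
  finitely many closed half-spaces.\<close>

lemma closed_face_cone:
  assumes S: "S \<in> \<Delta>" shows "closed (face_cone S)"
proof -
  have "\<exists>g. linear g \<and> (\<forall>u\<in>S. g (y u) = (if u = v then 1 else 0 :: real))" for v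
    using lin_indep_family_extend[OF lin_indep_face[OF S], of "\<lambda>u. if u = v then 1 else 0"] by metis
  then obtain g :: "'v \<Rightarrow> 'a \<Rightarrow> real" where g: "\<And>v. linear (g v)"
    "\<And>v u. u \<in> S \<Longrightarrow> g v (y u) = (if u = v then 1 else 0)" by metis
  have coord: "g v (\<Sum>u\<in>S. c u *\<^sub>R y u) = c v" if v: "v \<in> S" for c v
  proof -
    have "g v (\<Sum>u\<in>S. c u *\<^sub>R y u) = (\<Sum>u\<in>S. c u * (if u = v then 1 else 0))"
      unfolding linear_sum[OF g(1)] by (intro sum.cong refl) (simp add: linear_scale[OF g(1)] g(2))
    then show ?thesis using v by (simp add: if_distrib cong: if_cong)
  qed
  have "face_cone S = span (y ` S) \<inter> (\<Inter>v\<in>S. {u. 0 \<le> g v u})"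
  proof
    show "face_cone S \<subseteq> span (y ` S) \<inter> (\<Inter>v\<in>S. {u. 0 \<le> g v u})"
      by (auto simp: face_cone_def coord) (intro span_sum span_scale span_base imageI)
    show "span (y ` S) \<inter> (\<Inter>v\<in>S. {u. 0 \<le> g v u}) \<subseteq> face_cone S"
    proof
      fix u assume u: "u \<in> span (y ` S) \<inter> (\<Inter>v\<in>S. {u. 0 \<le> g v u})"
      then obtain r where "u = (\<Sum>x\<in>y ` S. r x *\<^sub>R x)" by (auto simp: span_finite)
      then have "u = (\<Sum>v\<in>S. r (y v) *\<^sub>R y v)"
        by (simp add: sum.reindex[OF lin_indep_family_inj[OF lin_indep_face[OF S]]])
      moreover from this have "r (y v) \<ge> 0" if "v \<in> S" for v
        using u that coord[OF that, of "\<lambda>v. r (y v)"] by auto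
      ultimately show "u \<in> face_cone S"
        unfolding face_cone_def by (intro CollectI exI[of _ "\<lambda>v. r (y v)"]) simp
    qed
  qed
  moreover have "closed {u. 0 \<le> g v u}" for v
    by (intro closed_Collect_le continuous_intros linear_continuous_on linear_linear[THEN iffD2] g(1))
  moreover have "closed (span (y ` S))" by (simp add: closed_subspace)
  ultimately show ?thesis by (simp add: closed_Int closed_INT)
qed

text \<open>No face mixes vertices of \<open>A\<close> with other vertices, so the cones over faces
  inside \<open>A\<close> and over faces outside \<open>A\<close> form two closed sets that cover
  \<open>L\<close> and meet only in 0. For \<open>d \<ge> 2\<close> the set \<open>L - {0}\<close>
  is connected, so one of the two contains no nonzero vector.\<close>

lemma vertex_set_connected:
  assumes d: "d \<ge> 2" and A: "\<And>u v. u \<in> A \<Longrightarrow> {u, v} \<in> \<Delta> \<Longrightarrow> v \<in> A"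
    and v: "v \<in> A" "{v} \<in> \<Delta>" and w: "{w} \<in> \<Delta>"
  shows "w \<in> A"
proof (rule ccontr)
  assume wA: "w \<notin> A"
  define K where "K X = (\<Union>S\<in>{S \<in> \<Delta>. S \<subseteq> X}. face_cone S)" for X
  have K: "closed (K X)" for X
    unfolding K_def by (intro closed_UN) (auto intro: closed_face_cone)
  have conn: "connected (L - {0})"
    by (rule connected_punctured_convex)
      (use d dim_L subspace_L in \<open>auto simp: subspace_imp_convex aff_dim_subspace\<close>)
  have "L - {0} \<subseteq> K A \<union> K (- A)"
  proof
    fix u assume "u \<in> L - {0}"
    then obtain S c where S: "S \<in> \<Delta>" "\<forall>v\<in>S. c v > 0" "u = (\<Sum>v\<in>S. c v *\<^sub>R y v)"
      using cover[of u] by blast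
    have "u \<in> face_cone S" using S(2,3) unfolding face_cone_def by (auto intro: less_imp_le)
    moreover have "S \<subseteq> A \<or> S \<subseteq> - A"
    proof (rule ccontr)
      assume "\<not> (S \<subseteq> A \<or> S \<subseteq> - A)"
      then obtain p q where "p \<in> S" "p \<in> A" "q \<in> S" "q \<notin> A" by blast
      moreover from this have "{p, q} \<in> \<Delta>" using face_subset[OF S(1)] by simp
      ultimately show False using A by blast
    qed
    ultimately show "u \<in> K A \<union> K (- A)" using S(1) unfolding K_def by blast
  qed
  moreover have "K A \<inter> K (- A) \<inter> (L - {0}) = {}"
  proof (rule ccontr)
    assume "K A \<inter> K (- A) \<inter> (L - {0}) \<noteq> {}"
    then obtain u S T c e where S: "S \<in> \<Delta>" "S \<subseteq> A" "\<forall>v\<in>S. c v \<ge> 0" "u = (\<Sum>v\<in>S. c v *\<^sub>R y v)"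
      and T: "T \<in> \<Delta>" "T \<subseteq> - A" "\<forall>v\<in>T. e v \<ge> 0" "u = (\<Sum>v\<in>T. e v *\<^sub>R y v)" and u: "u \<noteq> 0"
      unfolding K_def face_cone_def by blast
    have "{v \<in> S. c v > 0} = {v \<in> T. e v > 0}"
      by (rule unique_nonneg) (use S T in auto)
    then have "{v \<in> S. c v > 0} = {}" using S(2) T(2) by blast
    then have "c v = 0" if "v \<in> S" for v using S(3) that by force
    then show False using S(4) u by simp
  qed
  ultimately have "K A \<inter> (L - {0}) = {} \<or> K (- A) \<inter> (L - {0}) = {}"
    using connected_closedD[OF conn] K by blast
  moreover have mem: "y u \<in> K X \<inter> (L - {0})" if "{u} \<in> \<Delta>" "u \<in> X" for u X
  proof -
    have "y u = (\<Sum>v\<in>{u}. 1 *\<^sub>R y v)" by simp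
    then have "y u \<in> face_cone {u}" unfolding face_cone_def by (intro CollectI exI[of _ "\<lambda>_. 1"]) simp
    then show ?thesis using that y_in_L y_nonzero unfolding K_def by blast
  qed
  have "y v \<in> K A \<inter> (L - {0})" "y w \<in> K (- A) \<inter> (L - {0})"
    by (rule mem[OF v(2,1)], rule mem[OF w]) (use wA in simp)
  ultimately show False by blast
qed

end

text \<open>
  By induction on the vertex links, the support of a top cycle is closed under adjacency; and the
  1-skeleton is connected because \<open>L - {0}\<close> is.
\<close>

lemma top_cycle_full_support:
  fixes y :: "'v::{finite, linorder} \<Rightarrow> 'a::euclidean_space" and z :: "'v set \<Rightarrow> 'k::field"
  assumes "complete_fan \<Delta> y L d" "\<And>S. z S \<noteq> 0 \<Longrightarrow> S \<in> \<Delta> \<and> card S = d"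
    "\<And>T. simplicial_boundary z T = 0" "z S0 \<noteq> 0" "{w} \<in> \<Delta>"
  shows "\<exists>S. w \<in> S \<and> z S \<noteq> 0"
  using assms
proof (induction d arbitrary: \<Delta> y L z S0 w)
  case 0
  then show ?case using complete_fan.card_face_le[OF 0(1), of "{w}"] by simp
next
  case (Suc d)
  interpret complete_fan \<Delta> y L "Suc d" by (rule Suc.prems(1))
  show ?case
  \<comment> \<open>On a line \<open>L - {0}\<close> is disconnected, so this case is separate: the
    two vertices have opposite coefficients because the boundary at the empty face vanishes.\<close>
  proof (cases "d = 0")
    case True
    then have "complete_fan \<Delta> y L 1" using Suc.prems(1) by simp
    then obtain a b where ab: "a \<noteq> b" "{v. {v} \<in> \<Delta>} = {a, b}" using line_fan by metis
    have "0 = (\<Sum>v\<in>UNIV. z {v})"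
      using Suc.prems(3)[of "{}"] by (simp add: simplicial_boundary_def psign_def)
    also have "\<dots> = (\<Sum>v\<in>{a, b}. z {v})"
      unfolding ab(2)[symmetric] by (rule sum.mono_neutral_right) (use Suc.prems(2) in auto)
    finally have sum0: "z {a} + z {b} = 0" using ab(1) by simp
    have "card S0 = 1" "S0 \<in> \<Delta>" using Suc.prems(2)[OF Suc.prems(4)] True by auto
    then have "S0 = {a} \<or> S0 = {b}" using ab(2) by (auto simp: card_1_singleton_iff)
    then have "z {a} \<noteq> 0" "z {b} \<noteq> 0" using sum0 Suc.prems(4) by (auto simp: add_eq_0_iff)
    moreover have "w = a \<or> w = b" using ab(2) Suc.prems(5) by auto
    ultimately show ?thesis by (intro exI[of _ "{w}"]) auto
  next
    case False
    let ?A = "{v. \<exists>S. v \<in> S \<and> z S \<noteq> 0}"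
    have closed: "v \<in> ?A" if u: "u \<in> ?A" and uv: "{u, v} \<in> \<Delta>" for u v
    proof (cases "v = u")
      case False
      obtain S where S: "u \<in> S" "z S \<noteq> 0" using u by blast
      have "{u} \<in> \<Delta>" using uv face_subset[of "{u, v}" "{u}"] by simp
      then obtain y' :: "'v \<Rightarrow> 'a" and L' where fan': "complete_fan {T. u \<notin> T \<and> insert u T \<in> \<Delta>} y' L' d"
        using vertex_link by fastforce
      have "\<exists>T. v \<in> T \<and> link_cycle u z T \<noteq> 0"
      proof (rule Suc.IH[OF fan'])
        show "T \<in> {T. u \<notin> T \<and> insert u T \<in> \<Delta>} \<and> card T = d" if "link_cycle u z T \<noteq> 0" for T
          using that Suc.prems(2)[of "insert u T"] by (auto simp: link_cycle_def split: if_splits)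
        show "simplicial_boundary (link_cycle u z) T = 0" for T
          by (rule simplicial_boundary_link_cycle[OF Suc.prems(3)])
        show "link_cycle u z (S - {u}) \<noteq> 0" using S by (simp add: link_cycle_def insert_absorb)
        show "{v} \<in> {T. u \<notin> T \<and> insert u T \<in> \<Delta>}" using uv False by simp
      qed
      then obtain T where "v \<in> T" "link_cycle u z T \<noteq> 0" by blast
      then show ?thesis by (auto simp: link_cycle_def split: if_splits intro!: exI[of _ "insert u T"])
    qed (use u in simp)
    obtain v where v: "v \<in> S0"
      using Suc.prems(2)[OF Suc.prems(4)] by fastforce
    have "w \<in> ?A"
    proof (rule vertex_set_connected)
      show "v \<in> ?A" using v Suc.prems(4) by blast
      show "{v} \<in> \<Delta>" using Suc.prems(2)[OF Suc.prems(4)] face_subset[of S0 "{v}"] v by simp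
      show "2 \<le> Suc d" using False by simp
    qed (use closed Suc.prems(5) in \<open>assumption | blast\<close>)+
    then show ?thesis by simp
  qed
qed

section \<open>The face fan of a simplicial polytope\<close>

lemma simplicial_polytope_face:
  assumes P: "simplicial_polytope n P" and F: "F face_of P" "F \<noteq> P"
  shows "\<not> affine_dependent {p. p extreme_point_of F}" "F = convex hull {p. p extreme_point_of F}"
proof -
  obtain m where "m simplex F" using P F unfolding simplicial_polytope_def by blast
  then obtain C where C: "\<not> affine_dependent C" "F = convex hull C" unfolding simplex by blast
  then have "{p. p extreme_point_of F} = C"
    by (auto simp: extreme_point_of_convex_hull_affine_independent)
  then show "\<not> affine_dependent {p. p extreme_point_of F}" "F = convex hull {p. p extreme_point_of F}"
    using C by simp_all
qed

text \<open>A ray from a relative interior point \<open>p0\<close> meets the relative frontier in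
  exactly one point, which lies in the relative interior of exactly one proper face; since faces are
  simplices, its barycentric coordinates are unique. Translating \<open>p0\<close> to the origin
  turns this into a complete fan.\<close>

lemma polytope_complete_fan:
  fixes P :: "'a::euclidean_space set" and x :: "'v::{finite, linorder} \<Rightarrow> 'a"
  assumes P: "simplicial_polytope n P" and x: "bij_betw x UNIV {p. p extreme_point_of P}"
  shows "\<exists>(y :: 'v \<Rightarrow> 'a) L. complete_fan (boundary_complex P x) y L n"
proof -
  let ?\<Delta> = "boundary_complex P x"
  have poly: "polytope P" and dim: "aff_dim P = int n" using P by (auto simp: simplicial_polytope_def)
  have conv: "convex P" and comp: "compact P" using poly polytope_imp_convex polytope_imp_compact by blast+
  have inj: "inj x" using x by (auto simp: bij_betw_def)
  have ne: "P \<noteq> {}" using dim by auto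
  then obtain p0 where p0: "p0 \<in> rel_interior P" using rel_interior_eq_empty[OF conv] by blast
  have p0P: "p0 \<in> P" using p0 rel_interior_subset by blast
  have faceE: "convex hull (x ` S) face_of P \<and> convex hull (x ` S) \<noteq> P \<and> \<not> affine_dependent (x ` S)"
    if S: "S \<in> ?\<Delta>" for S
  proof -
    obtain F where F: "F face_of P" "F \<noteq> P" "x ` S = {p. p extreme_point_of F}"
      using S unfolding boundary_complex_def by blast
    then show ?thesis using simplicial_polytope_face[OF P F(1,2)] by simp
  qed
  have faceI: "S \<in> ?\<Delta>"
    if "convex hull (x ` S) face_of P" "convex hull (x ` S) \<noteq> P" "\<not> affine_dependent (x ` S)" for S
    unfolding boundary_complex_def
    using that by (intro CollectI exI[of _ "convex hull (x ` S)"])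
      (auto simp: extreme_point_of_convex_hull_affine_independent)
  have down: "T \<in> ?\<Delta>" if S: "S \<in> ?\<Delta>" and TS: "T \<subseteq> S" for S T
  proof (rule faceI)
    have sub: "x ` T \<subseteq> x ` S" using TS by blast
    have "convex hull (x ` T) face_of convex hull (x ` S)"
      using faceE[OF S] sub by (auto simp: face_of_convex_hull_affine_independent)
    then show "convex hull (x ` T) face_of P" using faceE[OF S] face_of_trans by blast
    have "convex hull (x ` T) \<subseteq> convex hull (x ` S)" using sub by (rule hull_mono)
    moreover have "convex hull (x ` S) \<subseteq> P" using faceE[OF S] face_of_imp_subset by blast
    ultimately show "convex hull (x ` T) \<noteq> P" using faceE[OF S] by blast
    show "\<not> affine_dependent (x ` T)" using faceE[OF S] affine_dependent_subset[OF _ sub] by blast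
  qed
  have empty: "{} \<in> ?\<Delta>" by (rule faceI) (use ne in auto)
  have p0_notin: "p0 \<notin> convex hull (x ` S)" if "S \<in> ?\<Delta>" for S
    using faceE[OF that] face_of_disjoint_rel_interior p0 by blast
  define y where "y v = x v - p0" for v
  define L where "L = (\<lambda>q. - p0 + q) ` (affine hull P)"
  have p0A: "p0 \<in> affine hull P" using p0P by (rule hull_inc)
  have sub_L: "subspace L"
    unfolding L_def by (rule affine_diffs_subspace) (use p0A affine_affine_hull in auto)
  have dim_L: "dim L = n"
  proof -
    have "aff_dim (affine hull P) = int (dim L)"
      unfolding L_def by (rule aff_dim_eq_dim) (use p0A in \<open>simp add: hull_hull\<close>)
    then show ?thesis using dim by simp
  qed
  have xP: "x v \<in> P" for v
  proof -
    have "x v extreme_point_of P" using bij_betwE[OF x] by blast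
    then show ?thesis by (simp add: extreme_point_of_def)
  qed
  have yL: "y v \<in> L" for v
    unfolding L_def y_def by (rule image_eqI[of _ _ "x v"]) (simp_all add: hull_inc[OF xP])
  have sum_y: "(\<Sum>v\<in>S. c v *\<^sub>R y v) = (\<Sum>v\<in>S. c v *\<^sub>R x v) - sum c S *\<^sub>R p0" for S c
    by (simp add: y_def scaleR_diff_right sum_subtractf scaleR_sum_left)
  have cover: "\<exists>S\<in>?\<Delta>. \<exists>c. (\<forall>v\<in>S. c v > 0) \<and> u = (\<Sum>v\<in>S. c v *\<^sub>R y v)" if u: "u \<in> L" for u
  proof (cases "u = 0")
    case True
    then show ?thesis using empty by (intro bexI[of _ "{}"]) auto
  next
    case False
    have "p0 + u \<in> affine hull P" using u by (auto simp: L_def)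
    then obtain t where t: "0 < t" "p0 + t *\<^sub>R u \<in> rel_frontier P"
      using ray_to_rel_frontier[OF compact_imp_bounded[OF comp] p0 _ False] by metis
    then obtain F where F: "F face_of P" "F \<noteq> P" "p0 + t *\<^sub>R u \<in> F"
      using rel_frontier_of_polyhedron_alt[OF polytope_imp_polyhedron[OF poly]] by blast
    define S where "S = x -` {p. p extreme_point_of F}"
    have "{p. p extreme_point_of F} \<subseteq> range x"
      using x extreme_point_of_face[OF F(1)] by (auto simp: bij_betw_def)
    then have xS: "x ` S = {p. p extreme_point_of F}" unfolding S_def by auto
    then have S: "S \<in> ?\<Delta>" unfolding boundary_complex_def using F by blast
    have "F = convex hull (x ` S)" using simplicial_polytope_face[OF P F(1,2)] xS by simp
    then obtain b where b: "\<forall>p\<in>x ` S. 0 \<le> b p" "sum b (x ` S) = 1" "(\<Sum>p\<in>x ` S. b p *\<^sub>R p) = p0 + t *\<^sub>R u"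
      using F(3) by (auto simp: convex_hull_finite)
    have injS: "inj_on x S" using inj inj_on_subset by blast
    let ?c = "\<lambda>v. b (x v)"
    have "(\<Sum>v\<in>S. ?c v *\<^sub>R y v) = t *\<^sub>R u"
      using b(2,3) unfolding sum_y by (simp add: sum.reindex[OF injS])
    then have "u = (1 / t) *\<^sub>R (\<Sum>v\<in>S. ?c v *\<^sub>R y v)" using t(1) by simp
    also have "\<dots> = (\<Sum>v\<in>S. (?c v / t) *\<^sub>R y v)" by (simp add: scaleR_sum_right)
    also have "\<dots> = (\<Sum>v\<in>{v \<in> S. ?c v > 0}. (?c v / t) *\<^sub>R y v)"
      using b(1) by (intro sum.mono_neutral_right) (auto simp: less_le)
    finally have "u = (\<Sum>v\<in>{v \<in> S. ?c v > 0}. (?c v / t) *\<^sub>R y v)" .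
    moreover have "{v \<in> S. ?c v > 0} \<in> ?\<Delta>" by (rule down[OF S]) blast
    ultimately show ?thesis
      using t(1) by (intro bexI[of _ "{v \<in> S. ?c v > 0}"] exI[of _ "\<lambda>v. ?c v / t"]) auto
  qed
  \<comment> \<open>Dividing by the coefficient sum turns a positive combination into a convex one,
    so its ray meets the relative interior of the corresponding face.\<close>
  have radial: "p0 + (1 / sum c S) *\<^sub>R (\<Sum>v\<in>S. c v *\<^sub>R y v) \<in> rel_interior (convex hull (x ` S)) \<and> sum c S > 0"
    if S: "S \<in> ?\<Delta>" "S \<noteq> {}" and c: "\<And>v. v \<in> S \<Longrightarrow> c v > 0" for S c
  proof -
    have pos: "sum c S > 0" using S(2) c by (intro sum_pos) auto
    have injS: "inj_on x S" using inj inj_on_subset by blast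
    let ?b = "\<lambda>p. c (inv x p) / sum c S"
    have "p0 + (1 / sum c S) *\<^sub>R (\<Sum>v\<in>S. c v *\<^sub>R y v) = (\<Sum>v\<in>S. (c v / sum c S) *\<^sub>R x v)"
      using pos unfolding sum_y by (simp add: scaleR_diff_right scaleR_sum_right)
    also have "\<dots> = (\<Sum>p\<in>x ` S. ?b p *\<^sub>R p)"
      using inj by (simp add: sum.reindex[OF injS])
    finally have e: "p0 + (1 / sum c S) *\<^sub>R (\<Sum>v\<in>S. c v *\<^sub>R y v) = (\<Sum>p\<in>x ` S. ?b p *\<^sub>R p)" .
    have "sum ?b (x ` S) = 1"
      using inj pos by (simp add: sum.reindex[OF injS] flip: sum_divide_distrib)
    moreover have "\<forall>p\<in>x ` S. 0 < ?b p" using c pos inj by simp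
    ultimately have "(\<Sum>p\<in>x ` S. ?b p *\<^sub>R p) \<in> rel_interior (convex hull (x ` S))"
      using faceE[OF S(1)] by (auto simp: rel_interior_convex_hull_explicit intro!: exI[of _ ?b])
    then show ?thesis unfolding e using pos by blast
  qed
  \<comment> \<open>A smaller sum for \<open>S\<close> would put its frontier point farther out on
    the ray; the point for \<open>T\<close>, strictly between \<open>p0\<close> and it, would then
    be both in the relative interior of \<open>P\<close> and on a proper face.\<close>
  have sum_le: "sum c S \<ge> sum e T"
    if S: "S \<in> ?\<Delta>" "S \<noteq> {}" and c: "\<And>v. v \<in> S \<Longrightarrow> c v > 0"
      and T: "T \<in> ?\<Delta>" "T \<noteq> {}" and e: "\<And>v. v \<in> T \<Longrightarrow> e v > 0"
      and eq: "(\<Sum>v\<in>S. c v *\<^sub>R y v) = (\<Sum>v\<in>T. e v *\<^sub>R y v)" for S T and c e :: "'v \<Rightarrow> real"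
  proof (rule ccontr)
    assume lt: "\<not> sum c S \<ge> sum e T"
    define u where "u = (\<Sum>v\<in>S. c v *\<^sub>R y v)"
    let ?q = "p0 + (1 / sum c S) *\<^sub>R u" and ?q' = "p0 + (1 / sum e T) *\<^sub>R u"
    have q: "?q \<in> convex hull (x ` S)" "sum c S > 0"
      using radial[OF S, of c, OF c] rel_interior_subset unfolding u_def by blast+
    have q': "?q' \<in> convex hull (x ` T)" "sum e T > 0"
      using radial[OF T, of e, OF e] rel_interior_subset unfolding u_def eq by blast+
    have qP: "?q \<in> P" using q(1) faceE[OF S(1)] face_of_imp_subset by blast
    let ?s = "sum c S / sum e T"
    have s: "0 < ?s" "?s < 1" using q(2) q'(2) lt by auto
    have ne: "p0 \<noteq> ?q" using q(1) p0_notin[OF S(1)] by metis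
    have "?q' = (1 - ?s) *\<^sub>R p0 + ?s *\<^sub>R ?q"
      using q(2) q'(2) by (simp add: algebra_simps)
    then have "?q' \<in> open_segment p0 ?q" using s ne unfolding in_segment by blast
    then have "?q' \<in> rel_interior P"
      using rel_interior_closure_convex_segment[OF conv p0] qP closure_subset by blast
    then show False
      using q'(1) faceE[OF T(1)] face_of_disjoint_rel_interior by blast
  qed
  have unique: "S = T \<and> (\<forall>v\<in>S. c v = e v)"
    if S: "S \<in> ?\<Delta>" and T: "T \<in> ?\<Delta>" and c: "\<And>v. v \<in> S \<Longrightarrow> c v > 0" and e: "\<And>v. v \<in> T \<Longrightarrow> e v > 0"
      and eq: "(\<Sum>v\<in>S. c v *\<^sub>R y v) = (\<Sum>v\<in>T. e v *\<^sub>R y v)" for S T and c e :: "'v \<Rightarrow> real"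
  proof -
    have nz: "(\<Sum>v\<in>S. c v *\<^sub>R y v) \<noteq> 0"
      if "S \<in> ?\<Delta>" "S \<noteq> {}" "\<And>v. v \<in> S \<Longrightarrow> c v > 0" for S and c :: "'v \<Rightarrow> real"
    proof
      assume "(\<Sum>v\<in>S. c v *\<^sub>R y v) = 0"
      then have "p0 \<in> rel_interior (convex hull (x ` S))"
        using radial[OF that(1,2), of c, OF that(3)] by simp
      then show False using p0_notin[OF that(1)] rel_interior_subset by blast
    qed
    show ?thesis
    proof (cases "S = {} \<or> T = {}")
      case True
      then have "S = {} \<and> T = {}" using nz[OF S, of c] nz[OF T, of e] c e eq by (cases "S = {}"; cases "T = {}") auto
      then show ?thesis by simp
    next
      case False
      then have ne: "S \<noteq> {}" "T \<noteq> {}" by auto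
      have sums: "sum c S = sum e T"
        using sum_le[OF S ne(1) _ T ne(2) _ eq] sum_le[OF T ne(2) _ S ne(1) _ eq[symmetric]] c e by force
      define q where "q = p0 + (1 / sum c S) *\<^sub>R (\<Sum>v\<in>S. c v *\<^sub>R y v)"
      have q: "q \<in> rel_interior (convex hull (x ` S))" "q \<in> rel_interior (convex hull (x ` T))"
        using radial[OF S ne(1), of c, OF c] radial[OF T ne(2), of e, OF e] unfolding q_def eq sums by blast+
      \<comment> \<open>A face meeting the relative interior of a subset of \<open>P\<close>
        contains this subset, and the common point \<open>q\<close> lies in both relative
        interiors.\<close>
      have sub: "convex hull (x ` S) \<subseteq> convex hull (x ` T)"
        if "S \<in> ?\<Delta>" "T \<in> ?\<Delta>" "q \<in> rel_interior (convex hull (x ` S))" "q \<in> rel_interior (convex hull (x ` T))" for S T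
      proof (rule subset_of_face_of)
        show "convex hull (x ` T) face_of P" using faceE[OF that(2)] by blast
        show "convex hull (x ` S) \<subseteq> P" using faceE[OF that(1)] face_of_imp_subset by blast
        show "convex hull (x ` T) \<inter> rel_interior (convex hull (x ` S)) \<noteq> {}"
          using that(3,4) rel_interior_subset by blast
      qed
      have hulls: "convex hull (x ` S) = convex hull (x ` T)" using sub[OF S T q] sub[OF T S q(2,1)] by blast
      have ext: "x ` S = {p. p extreme_point_of (convex hull (x ` S))}" if "S \<in> ?\<Delta>" for S
        using faceE[OF that] by (auto simp: extreme_point_of_convex_hull_affine_independent)
      have "x ` S = x ` T" using ext[OF S] ext[OF T] hulls by simp
      then have ST: "S = T" using inj by (simp add: inj_image_eq_iff)
      have injS: "inj_on x S" using inj inj_on_subset by blast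
      \<comment> \<open>The coefficient differences sum to 0, and so does the sum of the points
        weighted by them: an affine dependence unless all differences vanish.\<close>
      let ?U = "\<lambda>p. c (inv x p) - e (inv x p)"
      have "sum ?U (x ` S) = (\<Sum>v\<in>S. c v - e v)"
        by (subst sum.reindex[OF injS]) (use inj in simp)
      also have "\<dots> = 0" using sums ST by (simp add: sum_subtractf)
      finally have U0: "sum ?U (x ` S) = 0" .
      have "(\<Sum>p\<in>x ` S. ?U p *\<^sub>R p) = (\<Sum>v\<in>S. (c v - e v) *\<^sub>R x v)"
        by (subst sum.reindex[OF injS]) (use inj in simp)
      also have "\<dots> = 0"
        using eq sums ST unfolding sum_y by (simp add: scaleR_diff_left sum_subtractf)
      finally have "(\<Sum>p\<in>x ` S. ?U p *\<^sub>R p) = 0" .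
      with U0 have "?U p = 0" if "p \<in> x ` S" for p
        using faceE[OF S] that affine_dependent_explicit_finite[of "x ` S"] by auto
      then have "c v = e v" if "v \<in> S" for v using inj that by fastforce
      then show ?thesis using ST by blast
    qed
  qed
  have "complete_fan ?\<Delta> y L n"
    by unfold_locales (fact sub_L dim_L yL empty | erule (1) down | erule cover | rule unique; assumption)+
  then show ?thesis by blast
qed

section \<open>Jump sequences\<close>

definition link_vertices :: "'v set set \<Rightarrow> 'v set \<Rightarrow> 'v set" where
  "link_vertices \<Delta> F = {v. v \<notin> F \<and> insert v F \<in> \<Delta>}"

lemma clique_closed_faceI:
  assumes cc: "clique_closed \<Delta>" and S: "\<And>u v. u \<in> S \<Longrightarrow> v \<in> S \<Longrightarrow> u \<noteq> v \<Longrightarrow> {u, v} \<in> \<Delta>"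
  shows "S \<in> \<Delta>"
proof -
  have "S \<in> clique_complex (one_skeleton \<Delta>)"
    using S by (auto simp: clique_complex_def one_skeleton_def)
  then show ?thesis using cc by (simp add: clique_closed_def)
qed

lemma link_eq_induced:
  assumes cc: "clique_closed \<Delta>" and down: "\<And>S T. S \<in> \<Delta> \<Longrightarrow> T \<subseteq> S \<Longrightarrow> T \<in> \<Delta>" and F: "F \<in> \<Delta>"
  shows "induced_subcomplex \<Delta> (link_vertices \<Delta> F) = {T. T \<inter> F = {} \<and> T \<union> F \<in> \<Delta>}"
proof (intro equalityI subsetI)
  fix S assume "S \<in> induced_subcomplex \<Delta> (link_vertices \<Delta> F)"
  then have S: "S \<in> \<Delta>" "\<And>v. v \<in> S \<Longrightarrow> v \<notin> F" "\<And>v. v \<in> S \<Longrightarrow> insert v F \<in> \<Delta>"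
    by (auto simp: induced_subcomplex_def link_vertices_def)
  have "S \<union> F \<in> \<Delta>"
  proof (rule clique_closed_faceI[OF cc])
    fix u v assume uv: "u \<in> S \<union> F" "v \<in> S \<union> F"
    consider "{u, v} \<subseteq> S" | "{u, v} \<subseteq> F" | "u \<in> S" "v \<in> F" | "u \<in> F" "v \<in> S" using uv by blast
    then show "{u, v} \<in> \<Delta>"
    proof cases
      case 1 then show ?thesis by (rule down[OF S(1)])
    next
      case 2 then show ?thesis by (rule down[OF F])
    next
      case 3 then show ?thesis by (intro down[OF S(3)[of u]]) auto
    next
      case 4 then show ?thesis by (intro down[OF S(3)[of v]]) auto
    qed
  qed
  then show "S \<in> {T. T \<inter> F = {} \<and> T \<union> F \<in> \<Delta>}" using S(2) by blast
next
  fix T assume T: "T \<in> {T. T \<inter> F = {} \<and> T \<union> F \<in> \<Delta>}"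
  have "T \<in> \<Delta>" by (rule down[of "T \<union> F"]) (use T in auto)
  moreover have "insert v F \<in> \<Delta>" if "v \<in> T" for v by (rule down[of "T \<union> F"]) (use T that in auto)
  ultimately show "T \<in> induced_subcomplex \<Delta> (link_vertices \<Delta> F)"
    using T by (auto simp: induced_subcomplex_def link_vertices_def)
qed

lemma reduced_homology_nonzero_face:
  fixes X :: "'v::{finite, linorder} set set"
  assumes down: "\<And>S T. S \<in> X \<Longrightarrow> T \<subseteq> S \<Longrightarrow> T \<in> X"
    and nz: "reduced_homology_dim (K :: 'k::field itself) X (int c - 1) \<noteq> 0"
  shows "\<exists>S\<in>X. card S = c"
proof (rule ccontr)
  assume none: "\<not> (\<exists>S\<in>X. card S = c)"
  have "homology_vanishes K X c"
    unfolding homology_vanishes_def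
  proof (intro allI impI)
    fix z :: "'v set \<Rightarrow> 'k" assume "\<forall>S. z S \<noteq> 0 \<longrightarrow> S \<in> X \<and> card S = c"
    then have "z S = 0" for S using none by blast
    then have "z = simplicial_boundary (\<lambda>_. 0)" by (simp add: simplicial_boundary_def fun_eq_iff)
    then show "\<exists>y. (\<forall>S. y S \<noteq> 0 \<longrightarrow> S \<in> X \<and> card S = Suc c) \<and> z = simplicial_boundary y"
      by (intro exI[of _ "\<lambda>_. 0"]) simp
  qed
  moreover have "reduced_homology_dim K X (int c - 1) = 0 \<longleftrightarrow> homology_vanishes K X c"
    by (rule reduced_homology_dim_eq_0_iff) (erule (1) down)
  ultimately show False using nz by blast
qed

lemma exists_minimal_nonzero_homology:
  fixes W :: "'v::{finite, linorder} set"
  assumes "reduced_homology_dim K (induced_subcomplex \<Delta> W) i \<noteq> 0"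
  obtains W' where "W' \<subseteq> W" "minimal_nonzero_homology K \<Delta> i W'"
proof -
  have "\<exists>W'\<subseteq>W. minimal_nonzero_homology K \<Delta> i W'"
    using assms
  proof (induction W rule: finite_psubset_induct[OF finite])
    case (1 W)
    show ?case
    proof (cases "minimal_nonzero_homology K \<Delta> i W")
      case False
      then obtain W' where "W' \<subset> W" "reduced_homology_dim K (induced_subcomplex \<Delta> W') i \<noteq> 0"
        using "1.prems" unfolding minimal_nonzero_homology_def by blast
      then show ?thesis using "1.IH"[of W'] by blast
    qed blast
  qed
  then show thesis using that by blast
qed

text \<open>The link of \<open>F\<close> has no faces with \<open>d + 1\<close> vertices, so its
  homology in degree \<open>d - 1\<close> is its space of cycles and the top cycle is not a
  boundary. A cycle on a proper vertex subset is a top cycle of the whole link that misses a vertex,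
  hence zero.\<close>

lemma link_minimal_nonzero_homology:
  fixes y :: "'v::{finite, linorder} \<Rightarrow> 'a::euclidean_space"
  assumes cc: "clique_closed \<Delta>" and fan: "complete_fan \<Delta> y L n" and F: "F \<in> \<Delta>" and d: "card F + d = n"
  shows "minimal_nonzero_homology (K :: 'k::field itself) \<Delta> (int d - 1) (link_vertices \<Delta> F)"
proof -
  interpret complete_fan \<Delta> y L n by (rule fan)
  let ?X = "\<lambda>W. induced_subcomplex \<Delta> W" and ?N = "link_vertices \<Delta> F"
  have X: "?X ?N = {T. T \<inter> F = {} \<and> T \<union> F \<in> \<Delta>}"
    by (rule link_eq_induced[OF cc face_subset F])
  have "n - card F = d" using d by simp
  then obtain y' :: "'v \<Rightarrow> 'a" and L' where fan': "complete_fan (?X ?N) y' L' d"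
    using face_link[OF fan F] X by auto
  have down: "T \<in> ?X W" if "S \<in> ?X W" "T \<subseteq> S" for S T W
    using that face_subset by (auto simp: induced_subcomplex_def)
  have "\<not> homology_vanishes K (?X ?N) d"
  proof
    assume H: "homology_vanishes K (?X ?N) d"
    obtain z :: "'v set \<Rightarrow> 'k" where z: "\<exists>S. z S \<noteq> 0" "\<forall>S. z S \<noteq> 0 \<longrightarrow> S \<in> ?X ?N \<and> card S = d"
      "\<forall>T. simplicial_boundary z T = 0"
      using top_cycle_exists[OF fan', where 'k='k] by blast
    from H[unfolded homology_vanishes_def, THEN spec, THEN mp, THEN mp, OF z(2,3)]
    obtain c where c: "\<forall>S. c S \<noteq> 0 \<longrightarrow> S \<in> ?X ?N \<and> card S = Suc d" "z = simplicial_boundary c"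
      by (elim exE conjE)
    have "c S = 0" for S
      using c(1) complete_fan.card_face_le[OF fan', of S] by fastforce
    then have "z S = 0" for S unfolding c(2) by (simp add: simplicial_boundary_def)
    then show False using z(1) by blast
  qed
  moreover have "homology_vanishes K (?X W') d" if W': "W' \<subset> ?N" for W'
    unfolding homology_vanishes_def
  proof (intro allI impI)
    fix z :: "'v set \<Rightarrow> 'k"
    assume z: "\<forall>S. z S \<noteq> 0 \<longrightarrow> S \<in> ?X W' \<and> card S = d" "\<forall>T. simplicial_boundary z T = 0"
    have "z S = 0" for S
    proof (rule ccontr)
      assume nz: "z S \<noteq> 0"
      obtain w where w: "w \<in> ?N" "w \<notin> W'" using W' by blast
      have "\<exists>S. w \<in> S \<and> z S \<noteq> 0"
      proof (rule top_cycle_full_support[where z = z and ?S0.0 = S, OF fan' _ _ nz])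
        show "S \<in> ?X ?N \<and> card S = d" if "z S \<noteq> 0" for S
          using z(1) that W' by (auto simp: induced_subcomplex_def)
        show "simplicial_boundary z T = 0" for T using z(2) by blast
        show "{w} \<in> ?X ?N" using w(1) unfolding X by (auto simp: link_vertices_def)
      qed
      then show False using z(1) w(2) by (auto simp: induced_subcomplex_def)
    qed
    then have "z = simplicial_boundary (\<lambda>_. 0)" by (simp add: simplicial_boundary_def fun_eq_iff)
    then show "\<exists>y. (\<forall>S. y S \<noteq> 0 \<longrightarrow> S \<in> ?X W' \<and> card S = Suc d) \<and> z = simplicial_boundary y"
      by (intro exI[of _ "\<lambda>_. 0"]) simp
  qed
  moreover have "reduced_homology_dim K (?X W) (int d - 1) = 0 \<longleftrightarrow> homology_vanishes K (?X W) d" for W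
    by (rule reduced_homology_dim_eq_0_iff) (erule (1) down)
  ultimately show ?thesis
    unfolding minimal_nonzero_homology_def by blast
qed

theorem theorem4p7:
  fixes n :: nat
    and P :: "'a::euclidean_space set"
    and x :: "'v::{finite, linorder} \<Rightarrow> 'a"
    and \<Delta> E :: "'v set set"
  assumes "n \<ge> 2"
    and "simplicial_polytope n P"
    and "bij_betw x UNIV {p. p extreme_point_of P}"
    and "\<Delta> = boundary_complex P x"
    and "clique_closed \<Delta>"
    and "\<And>i W W'. minimal_nonzero_homology TYPE('k::field_char_0) \<Delta> i W \<Longrightarrow>
           minimal_nonzero_homology TYPE('k) \<Delta> i W' \<Longrightarrow> card W = card W'"
    and "simple_graph E"
    and "stanley_reisner_complex (edge_ideal E :: ('v, 'k) mpoly set) = \<Delta>"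
  shows "\<exists>rs. has_relative_jump_sequence (edge_ideal E :: ('v, 'k) mpoly set) n rs \<and>
           1 \<le> rs ! 0 \<and> (\<forall>j. j + 1 < n - 1 \<longrightarrow> rs ! j \<le> rs ! (j + 1))"
proof -
  let ?I = "edge_ideal E :: ('v, 'k) mpoly set"
  let ?N = "link_vertices \<Delta>"
  let ?h = "\<lambda>i W. reduced_homology_dim TYPE('k) (induced_subcomplex \<Delta> W) i"
  obtain y :: "'v \<Rightarrow> 'a" and L where fan: "complete_fan \<Delta> y L n"
    using polytope_complete_fan[OF assms(2,3)] assms(4) by blast
  interpret complete_fan \<Delta> y L n by (rule fan)
  have down: "T \<in> induced_subcomplex \<Delta> W" if "S \<in> induced_subcomplex \<Delta> W" "T \<subseteq> S" for S T W
    using that face_subset by (auto simp: induced_subcomplex_def)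
  obtain F0 where F0: "F0 \<in> \<Delta>" "card F0 = n" using facet_exists[OF fan] by blast
  \<comment> \<open>\<open>d\<close> counts the vertices of a facet of the link of
    \<open>G d\<close>, so \<open>G d\<close> has \<open>n - d\<close> elements and
    \<open>M d\<close> below is the minimal vertex number in homological degree
    \<open>d - 1\<close>.\<close>
  have "\<exists>G\<subseteq>F0. card G = n - d" for d
    using obtain_subset_with_card_n[of "n - d" F0] F0(2) by auto
  then obtain G where G: "\<And>d. G d \<subseteq> F0" "\<And>d. card (G d) = n - d" by metis
  have G\<Delta>: "G d \<in> \<Delta>" for d by (rule face_subset[OF F0(1) G(1)])
  define M where "M d = card (?N (G d))" for d
  have min: "minimal_nonzero_homology TYPE('k) \<Delta> (int d - 1) (?N F)"
    if "F \<in> \<Delta>" "card F + d = n" for F d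
    by (rule link_minimal_nonzero_homology[OF assms(5) fan that])
  have minG: "minimal_nonzero_homology TYPE('k) \<Delta> (int d - 1) (?N (G d))" if "d \<le> n" for d
    by (rule min[OF G\<Delta>]) (use that G(2) in simp)
  \<comment> \<open>The hypothesis of equal cardinalities enters here: every minimal subcomplex in
    degree \<open>d - 1\<close>, in particular the link of any other face of the same size, has as
    many vertices as the link of \<open>G d\<close>.\<close>
  have M: "card W = M d" if "minimal_nonzero_homology TYPE('k) \<Delta> (int d - 1) W" "d \<le> n" for W d
    using assms(6)[OF that(1) minG[OF that(2)]] by (simp add: M_def)
  have M_le: "M d \<le> card W" if nz: "?h (int d - 1) W \<noteq> 0" and d: "d \<le> n" for d W
  proof -
    obtain W' where W': "W' \<subseteq> W" "minimal_nonzero_homology TYPE('k) \<Delta> (int d - 1) W'"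
      using exists_minimal_nonzero_homology[OF nz] .
    then show ?thesis using M[OF W'(2) d] card_mono[OF finite W'(1)] by simp
  qed
  have MG: "?h (int d - 1) (?N (G d)) \<noteq> 0" if "d \<le> n" for d
    using minG[OF that] by (simp add: minimal_nonzero_homology_def)
  have face: "c \<le> n \<and> c \<le> card W" if nz: "?h (int c - 1) W \<noteq> 0" for c W
  proof -
    obtain S where S: "S \<in> induced_subcomplex \<Delta> W" "card S = c"
      using reduced_homology_nonzero_face[of "induced_subcomplex \<Delta> W", OF _ nz] down by blast
    then show ?thesis
      using card_face_le[of S] card_mono[OF finite, of S W] by (auto simp: induced_subcomplex_def)
  qed
  have dM: "d \<le> M d" if "d \<le> n" for d
    using face[OF MG[OF that]] by (simp add: M_def)
  have convex: "2 * M (d + 1) \<le> M (d + 2) + M d" if d: "d + 2 \<le> n" for d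
  proof -
    \<comment> \<open>\<open>G d\<close> is taken apart into \<open>H\<close> and two further
      vertices, so the links of \<open>H\<close>, of its two one-vertex extensions and of
      \<open>G d\<close> belong to the indices \<open>d + 2\<close>, \<open>d + 1\<close>,
      \<open>d + 1\<close> and \<open>d\<close>.\<close>
    obtain u v where uv: "u \<in> G d" "v \<in> G d" "u \<noteq> v"
    proof -
      have "2 \<le> card (G d)" using d G(2) by simp
      then obtain B where B: "B \<subseteq> G d" "card B = 2"
        using obtain_subset_with_card_n[of 2 "G d"] by auto
      then obtain p q where "B = {p, q}" "p \<noteq> q" by (auto simp: card_2_iff)
      then show thesis using that[of p q] B(1) by auto
    qed
    define H where "H = G d - {u, v}"
    have Gd: "G d = insert u (insert v H)" using uv by (auto simp: H_def)
    have H: "u \<notin> H" "v \<notin> H" by (auto simp: H_def)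
    have cH: "card H + (d + 2) = n" using G(2)[of d] H uv(3) d unfolding Gd by simp
    have sub: "H \<in> \<Delta>" "insert u H \<in> \<Delta>" "insert v H \<in> \<Delta>"
      by (rule face_subset[OF G\<Delta>[of d]], use Gd in blast)+
    have cards: "card (?N H) = M (d + 2)" "card (?N (insert u H)) = M (d + 1)" "card (?N (insert v H)) = M (d + 1)"
      using d cH H by (intro M min sub; simp)+
    have un: "?N (insert u H) \<union> ?N (insert v H) \<subseteq> ?N H"
    proof
      fix w assume "w \<in> ?N (insert u H) \<union> ?N (insert v H)"
      then have "w \<notin> H" "insert w (insert u H) \<in> \<Delta> \<or> insert w (insert v H) \<in> \<Delta>"
        by (auto simp: link_vertices_def)
      moreover from this have "insert w H \<in> \<Delta>" by (auto intro: face_subset)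
      ultimately show "w \<in> ?N H" by (simp add: link_vertices_def)
    qed
    have int: "?N (insert u H) \<inter> ?N (insert v H) \<subseteq> ?N (G d)"
    proof
      fix w assume "w \<in> ?N (insert u H) \<inter> ?N (insert v H)"
      then have w: "w \<notin> G d" "insert w (insert u H) \<in> \<Delta>" "insert w (insert v H) \<in> \<Delta>"
        by (auto simp: link_vertices_def Gd)
      have "insert w (G d) \<in> \<Delta>"
      proof (rule clique_closed_faceI[OF assms(5)])
        fix p q assume "p \<in> insert w (G d)" "q \<in> insert w (G d)" "p \<noteq> q"
        \<comment> \<open>Among \<open>w\<close>, \<open>u\<close>, \<open>v\<close> and the
          elements of \<open>H\<close>, the only pair outside both given faces is
          \<open>{u, v}\<close>, an edge of \<open>G d\<close>; flagness does the rest.\<close>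
        then consider "{p, q} \<subseteq> insert w (insert u H)" | "{p, q} \<subseteq> insert w (insert v H)" | "{p, q} \<subseteq> G d"
          unfolding Gd by blast
        then show "{p, q} \<in> \<Delta>"
          by cases (auto intro: face_subset[OF w(2)] face_subset[OF w(3)] face_subset[OF G\<Delta>[of d]])
      qed
      then show "w \<in> ?N (G d)" using w(1) by (simp add: link_vertices_def)
    qed
    have "card (?N (insert u H) \<union> ?N (insert v H)) + card (?N (insert u H) \<inter> ?N (insert v H)) = 2 * M (d + 1)"
      using card_Un_Int[of "?N (insert u H)" "?N (insert v H)"] cards by simp
    moreover have "card (?N (insert u H) \<union> ?N (insert v H)) \<le> M (d + 2)"
      using card_mono[OF finite un] cards(1) by simp
    moreover have "card (?N (insert u H) \<inter> ?N (insert v H)) \<le> M d"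
      using card_mono[OF finite int] by (simp add: M_def)
    ultimately show ?thesis by linarith
  qed
  \<comment> \<open>Degree -1 is represented by the link of a facet, whose only face is
    empty.\<close>
  have M0: "M 0 = 0"
  proof -
    have "v \<notin> ?N (G 0)" for v
      using card_face_le[of "insert v (G 0)"] G(2)[of 0] by (auto simp: link_vertices_def)
    then have "?N (G 0) = {}" by blast
    then show ?thesis by (simp add: M_def)
  qed
  \<comment> \<open>Degree 0 is represented by the link of a ridge, a fan on a line with two
    opposite rays.\<close>
  have M1: "M 1 = 2"
  proof -
    have "n - card (G 1) = 1" using G(2)[of 1] assms(1) by simp
    then obtain y' :: "'v \<Rightarrow> 'a" and L' where fan': "complete_fan {T. T \<inter> G 1 = {} \<and> T \<union> G 1 \<in> \<Delta>} y' L' 1"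
      using face_link[OF fan G\<Delta>[of 1]] by auto
    obtain a b c where ab: "a \<noteq> b" "{v. {v} \<in> {T. T \<inter> G 1 = {} \<and> T \<union> G 1 \<in> \<Delta>}} = {a, b}"
      "c > 0" "y' b = - c *\<^sub>R y' a"
      by (rule line_fan[OF fan'])
    have "?N (G 1) = {a, b}" unfolding ab(2)[symmetric] by (auto simp: link_vertices_def)
    then show ?thesis using ab(1) by (simp add: M_def)
  qed
  have betti: "graded_betti ?I i j \<noteq> 0 \<longleftrightarrow> (\<exists>W. card W = j \<and> ?h (int j - int i - 1) W \<noteq> 0)" for i j
    by (rule hochster_nonvanishing[OF assms(7,8)])
  \<comment> \<open>With \<open>j = M d\<close>, Hochster's degree \<open>j - i - 1\<close> is
    \<open>d - 1\<close> exactly for \<open>i = M d - d\<close>; the bound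
    \<open>d \<le> M d\<close> makes this subtraction exact.\<close>
  have betti_M: "graded_betti ?I (M d - d) (M d) \<noteq> 0" if "d \<le> n" for d
    unfolding betti using MG[OF that] dM[OF that]
    by (intro exI[of _ "?N (G d)"]) (simp add: M_def of_nat_diff)
  have reg: "regularity ?I = int n + 1"
    unfolding regularity_def
  proof (rule Max_eqI)
    \<comment> \<open>The lower bound, from the vanishing of homology below degree -1, gives
      finiteness of the set whose maximum is taken.\<close>
    have range: "1 \<le> int j - int i + 1 \<and> int j - int i + 1 \<le> int n + 1"
      if nz: "graded_betti ?I i j \<noteq> 0" for i j
    proof -
      obtain W where W: "card W = j" "?h (int j - int i - 1) W \<noteq> 0" using nz betti by blast
      have "\<not> int j - int i - 1 < - 1"
      proof
        assume "int j - int i - 1 < - 1"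
        then have "?h (int j - int i - 1) W = 0" by (rule reduced_homology_dim_negative)
        then show False using W(2) by simp
      qed
      then have ij: "i \<le> j" by simp
      then have "?h (int (j - i) - 1) W \<noteq> 0" using W(2) by (simp add: of_nat_diff)
      then have "j - i \<le> n" using face by blast
      then show ?thesis using ij by simp
    qed
    then have "{int j - int i + 1 | i j. graded_betti ?I i j \<noteq> 0} \<subseteq> {1..int n + 1}" by auto
    then show "finite {int j - int i + 1 | i j. graded_betti ?I i j \<noteq> 0}"
      using finite_subset by blast
    show "r \<le> int n + 1" if "r \<in> {int j - int i + 1 | i j. graded_betti ?I i j \<noteq> 0}" for r
      using that range by auto
    have "int n + 1 = int (M n) - int (M n - n) + 1" using dM[of n] by (simp add: of_nat_diff)
    then show "int n + 1 \<in> {int j - int i + 1 | i j. graded_betti ?I i j \<noteq> 0}"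
      using betti_M[of n] by blast
  qed
  \<comment> \<open>List position \<open>r\<close> holds jump number \<open>r + 1\<close>: the first
    nonzero Betti number occurs at \<open>i = M (r + 2) - (r + 2)\<close>, and the definition of the
    jump subtracts one more.\<close>
  define a where "a = map (\<lambda>r. int (M (r + 2)) - int r - 3) [0..<n - 1]"
  have len: "length a = n - 1" by (simp add: a_def)
  have a_nth: "a ! r = int (M (r + 2)) - int r - 3" if "r < n - 1" for r
    using that by (simp add: a_def)
  have "has_jump_sequence ?I n a"
    unfolding has_jump_sequence_def
  proof (intro conjI ballI)
    fix r assume "r \<in> {1..n - 1}"
    then have r: "1 \<le> r" "r + 1 \<le> n" "r - 1 < n - 1" using assms(1) by auto
    let ?m = "M (r + 1) - (r + 1)"
    have m: "?m + (r + 1) = M (r + 1)" using dM[OF r(2)] by simp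
    have "graded_betti ?I ?m (?m + r + 1) \<noteq> 0" using betti_M[OF r(2)] m by simp
    moreover have "graded_betti ?I i (i + r + 1) = 0" if i: "i < ?m" for i
    proof (rule ccontr)
      assume "graded_betti ?I i (i + r + 1) \<noteq> 0"
      then obtain W where W: "card W = i + r + 1" "?h (int (i + r + 1) - int i - 1) W \<noteq> 0"
        using betti by blast
      then have "?h (int (r + 1) - 1) W \<noteq> 0" by simp
      then have "M (r + 1) \<le> i + r + 1" using M_le[OF _ r(2)] W(1) by metis
      then show False using i by simp
    qed
    moreover have "a ! (r - 1) = int ?m - 1"
      using a_nth[OF r(3)] r(1) m by (simp add: of_nat_diff)
    ultimately show "\<exists>m. graded_betti ?I m (m + r + 1) \<noteq> 0 \<and>
        (\<forall>i<m. graded_betti ?I i (i + r + 1) = 0) \<and> a ! (r - 1) = int m - 1"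
      by blast
  qed (use reg len in auto)
  define rs where "rs = map (\<lambda>j. if j = 0 then a ! 0 else a ! j - a ! (j - 1)) [0..<length a]"
  \<comment> \<open>The value \<open>M 1 = 2\<close> makes the first entry, which is
    \<open>a ! 0\<close> itself, obey the same formula as the differences.\<close>
  have rs_nth: "rs ! j = int (M (j + 2)) - int (M (j + 1)) - 1" if j: "j < n - 1" for j
  proof (cases j)
    case 0
    then show ?thesis using j a_nth[of 0] M1 by (simp add: rs_def len)
  next
    case (Suc i)
    then show ?thesis using j a_nth[of j] a_nth[of i] by (simp add: rs_def len)
  qed
  have "has_relative_jump_sequence ?I n rs"
    unfolding has_relative_jump_sequence_def rs_def using \<open>has_jump_sequence ?I n a\<close> by blast
  \<comment> \<open>Convexity at \<open>d = 0\<close> reads \<open>4 \<le> M 2\<close>, while the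
    entry equals \<open>M 2 - 3\<close>.\<close>
  moreover have "1 \<le> rs ! 0"
    using rs_nth[of 0] convex[of 0] M0 M1 assms(1) by (simp add: numeral_2_eq_2)
  moreover have "rs ! j \<le> rs ! (j + 1)" if "j + 1 < n - 1" for j
  proof -
    have "j + 1 + 2 \<le> n" using that by simp
    from convex[OF this] have "2 * int (M (j + 2)) \<le> int (M (j + 3)) + int (M (j + 1))"
      by (simp add: algebra_simps eval_nat_numeral)
    then show ?thesis
      using rs_nth[of j] rs_nth[of "j + 1"] that by (simp add: algebra_simps eval_nat_numeral)
  qed
  ultimately show ?thesis by blast
qed

end
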